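(* Let $\psi\in\mathcal D(Y)$ be fixed. The map $$\mathcal F^{d}_{\alpha,\varrho,\delta}(X,Y,\Xi)\to \mathcal C^\infty(X),\qquad (\Phi,a)\mapsto A_{\Phi,a}[\psi]=\frac{1}{(2\pi)^{n_\Xi}}\int_\Xi\int_Y e^{i\Phi(x,y,\xi)}\,a(x,y,\xi)\,\psi(y)\,dy\,d\xi$$ (the integral being understood as an oscillatory integral) is continuous with respect to the topologies generated by the seminorms $(\boldsymbol p_m)_{m}$ on $\mathcal F^{d}_{\alpha,\varrho,\delta}(X,Y,\Xi)$ and $(\pi_{X,m})_{m}$ on $\mathcal C^\infty(X)$.
   Context: Let $n_X,n_Y,n_\Xi\ge 1$ be integers, $X\subset\mathbb R^{n_X}$ and $Y\subset\mathbb R^{n_Y}$ open, $\Xi=\mathbb R^{n_\Xi}\setminus\{0\}$, $\alpha>0$, $d\in\mathbb R$, $0\le\delta<1$, $0<\varrho\le 1$. Write $\langle\xi\rangle=(1+\|\xi\|^2)^{1/2}$. $\mathcal D(Y)$ is the space of smooth compactly supported functions on $Y$. For $Z\subset\mathbb R^{k}$ open and $m\in\{1,2,\dots\}$ put $K_{Z,m}=\{x\in Z:\|x\|\le m,\ \mathrm{dist}(x,\mathbb R^{k}\setminus Z)\ge 1/m\}$. Phase functions. $\mathcal M_{hg}(X,Y,\Xi)$ is the space of smooth functions $\Phi:X\times Y\times\Xi\to\mathbb R$ that are positively homogeneous of degree $1$ in $\xi$, with the topology given by the seminorms $$p_m(\Phi)=\sup\{\|\xi\|^{|l|-1}|\partial_x^j\partial_y^k\partial_\xi^l\Phi(x,y,\xi)|: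 x\in K_{X,m},\,y\in K_{Y,m},\,\xi\in\Xi,\ |j|+|k|+|l|\le m\}$$ ($j,k,l$ multi-indices). $\mathcal M_\alpha(X,Y,\Xi)$ is the subset of those $\Phi\in\mathcal M_{hg}(X,Y,\Xi)$ such that for all $(x,y,\xi)\in X\times Y\times\Xi$ $$\|\xi\|^{-2}\|\nabla_x\Phi\|^2+\|\nabla_\xi\Phi\|^2\ge\alpha\quad\text{and}\quad \|\xi\|^{-2}\|\nabla_y\Phi\|^2+\|\nabla_\xi\Phi\|^2\ge\alpha .$$ Amplitudes. $S^d_{\varrho,\delta}(X\times Y\times\mathbb R^{n_\Xi})$ is the Hörmander class of smooth functions $a$ such that for all multi-indices $j,k,l$ and all compact $K\subset X\times Y$ there is $C$ with $|\partial_x^j\partial_y^k\partial_\xi^l a(x,y,\xi)|\le C\langle\xi\rangle^{d-\varrho|l|+\delta(|j|+|k|)}$ for $(x,y)\in K$, $\xi\in\mathbb R^{n_\Xi}$. $\mathcal S^d_{\varrho,\delta}(X,Y,\Xi)$ is the space of restrictions to $X\times Y\times\Xi$ of elements of $S^d_{\varrho,\delta}(X\times Y\times\mathbb R^{n_\Xi})$, with seminorms $$q_m(a)=\sup\{\langle\xi\rangle^{-d+\varrho|l|-\delta(|j|+|k|)}|\partial_x^j\partial_y^k\partial_\xi^l a(x,y,\xi)|: x\in K_{X,m},\,y\in K_{Y,m},\,\xi\in\Xi,\ |j|+|k|+|l|\le m\}.$$ $\mathcal F^d_{\alpha,\varrho,\delta}(X,Y,\Xi)=\mathcal M_\alpha(X,Y,\Xi)\times\mathcal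 S^d_{\varrho,\delta}(X,Y,\Xi)$ carries the product topology, induced by $\boldsymbol p_m(\Phi,a)=p_m(\Phi)+q_m(a)$. $\mathcal C^\infty(X)$ carries the seminorms $\pi_{X,m}(v)=\sup\{|\partial_x^jv(x)|:x\in K_{X,m},|j|\le m\}$. Oscillatory integral. Fix $\chi\in\mathcal D(\mathbb R^{n_\Xi})$ with $\chi=1$ for $\|\xi\|<1$ and $\chi=0$ for $\|\xi\|>2$. For $\Phi\in\mathcal M_\alpha(X,Y,\Xi)$ let $r=\|\xi\|^2\|\nabla_\xi\Phi\|^2+\|\nabla_y\Phi\|^2$, $\underline\alpha_l=\frac{-i}{r}(1-\chi)\|\xi\|^2\partial_{\xi_l}\Phi$, $\underline\beta_k=\frac{-i}{r}(1-\chi)\partial_{y_k}\Phi$, $\underline\gamma=\chi$, and $Lf=-\sum_{l=1}^{n_\Xi}\partial_{\xi_l}(\underline\alpha_lf)-\sum_{k=1}^{n_Y}\partial_{y_k}(\underline\beta_kf)+\underline\gamma f$ (its formal transpose fixes $e^{i\Phi}$). Then $$A_{\Phi,a}[\psi](x)=\frac1{(2\pi)^{n_\Xi}}\int_\Xi\int_Y e^{i\Phi(x,y,\xi)}L^\kappa\big(a(x,y,\xi)\psi(y)\big)\,dy\,d\xi$$ for $\kappa\in\mathbb N$ large enough that the integral converges absolutely (e.g. $d-\kappa\min(\varrho,1-\delta)<-n_\Xi$); $A_{\Phi,a}[\psi]\in\mathcal C^\infty(X)$. *)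

theory Defs
  imports "HOL-Analysis.Analysis"
begin

text \<open>
  Functions on an open set are represented by total functions: every notion below depends only on
  their values on the open set in question.  Two representatives of the same function are
  topologically indistinguishable, so continuity is not affected by this encoding.
\<close>

section \<open>Partial derivatives and smoothness\<close>

definition partial :: "'a::real_normed_vector \<Rightarrow> ('a \<Rightarrow> 'b::real_normed_vector) \<Rightarrow> 'a \<Rightarrow> 'b" where
  "partial v f z = vector_derivative (\<lambda>t. f (z + t *\<^sub>R v)) (at 0)"

primrec Ck_on :: "nat \<Rightarrow> 'a::euclidean_space set \<Rightarrow> ('a \<Rightarrow> 'b::real_normed_vector) \<Rightarrow> bool" where
  "Ck_on 0 S f \<longleftrightarrow> continuous_on S f"
| "Ck_on (Suc n) S f \<longleftrightarrow>
     (\<forall>z\<in>S. f differentiable (at z)) \<and> (\<forall>b\<in>Basis. Ck_on n S (partial b f))"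

definition smooth_on :: "'a::euclidean_space set \<Rightarrow> ('a \<Rightarrow> 'b::real_normed_vector) \<Rightarrow> bool" where
  "smooth_on S f \<longleftrightarrow> (\<forall>n. Ck_on n S f)"

text \<open>
  A multi-index over the finite index type \<open>'i\<close> is a function \<open>j :: 'i \<Rightarrow> nat\<close>.  The derivative
  \<open>mpartial e j f\<close> applies \<open>partial (e i)\<close> exactly \<open>j i\<close> times for each \<open>i\<close>.  The index type carries
  no canonical order, so the coordinates are run through in some fixed order; for smooth \<open>f\<close> the
  choice is irrelevant.
\<close>

definition index_enum :: "'i::finite list" where
  "index_enum = (SOME is. distinct is \<and> set is = UNIV)"

definition mpartial ::
  "('i::finite \<Rightarrow> 'a) \<Rightarrow> ('i \<Rightarrow> nat) \<Rightarrow> ('a::real_normed_vector \<Rightarrow> 'b::real_normed_vector) \<Rightarrow> 'a \<Rightarrow> 'b" where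
  "mpartial e j f = foldr (\<lambda>i. partial (e i) ^^ j i) index_enum f"

definition mlen :: "('i::finite \<Rightarrow> nat) \<Rightarrow> nat" where
  "mlen j = (\<Sum>i\<in>UNIV. j i)"

type_synonym ('x, 'y, 'k) pt = "(real^'x) \<times> (real^'y) \<times> (real^'k)"

definition dir_x :: "'x::finite \<Rightarrow> ('x, 'y::finite, 'k::finite) pt" where
  "dir_x i = (axis i 1, 0, 0)"

definition dir_y :: "'y::finite \<Rightarrow> ('x::finite, 'y, 'k::finite) pt" where
  "dir_y i = (0, axis i 1, 0)"

definition dir_xi :: "'k::finite \<Rightarrow> ('x::finite, 'y::finite, 'k) pt" where
  "dir_xi i = (0, 0, axis i 1)"

definition deriv_xyxi ::
  "('x::finite \<Rightarrow> nat) \<Rightarrow> ('y::finite \<Rightarrow> nat) \<Rightarrow> ('k::finite \<Rightarrow> nat) \<Rightarrow>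
   (('x, 'y, 'k) pt \<Rightarrow> 'b::real_normed_vector) \<Rightarrow> ('x, 'y, 'k) pt \<Rightarrow> 'b" where
  "deriv_xyxi j k l f = mpartial dir_x j (mpartial dir_y k (mpartial dir_xi l f))"

definition grad_x :: "(('x::finite, 'y::finite, 'k::finite) pt \<Rightarrow> real) \<Rightarrow> ('x, 'y, 'k) pt \<Rightarrow> real^'x" where
  "grad_x \<Phi> z = (\<chi> i. partial (dir_x i) \<Phi> z)"

definition grad_y :: "(('x::finite, 'y::finite, 'k::finite) pt \<Rightarrow> real) \<Rightarrow> ('x, 'y, 'k) pt \<Rightarrow> real^'y" where
  "grad_y \<Phi> z = (\<chi> i. partial (dir_y i) \<Phi> z)"

definition grad_xi :: "(('x::finite, 'y::finite, 'k::finite) pt \<Rightarrow> real) \<Rightarrow> ('x, 'y, 'k) pt \<Rightarrow> real^'k" where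
  "grad_xi \<Phi> z = (\<chi> i. partial (dir_xi i) \<Phi> z)"

definition test_functions :: "'a::euclidean_space set \<Rightarrow> ('a \<Rightarrow> complex) set" where
  "test_functions Y = {\<psi>. smooth_on UNIV \<psi> \<and> compact (closure {y. \<psi> y \<noteq> 0}) \<and> closure {y. \<psi> y \<noteq> 0} \<subseteq> Y}"


section \<open>Topologies generated by seminorms\<close>

text \<open>
  Seminorms take values in \<open>[0,\<infinity>]\<close>, so that a supremum over the empty set is \<open>0\<close> and no
  boundedness has to be built into the definitions.  They are indexed by \<open>m \<ge> 1\<close>.
\<close>

definition seminorm_topology :: "'f::minus set \<Rightarrow> (nat \<Rightarrow> 'f \<Rightarrow> ennreal) \<Rightarrow> 'f topology" where
  "seminorm_topology S p =
     topology_generated_by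
       {{g \<in> S. p m (g - f) < ennreal \<epsilon>} | f m \<epsilon>. f \<in> S \<and> 1 \<le> m \<and> (0::real) < \<epsilon>}"

text \<open>
  The distance to the empty set is \<open>\<infinity>\<close>, whereas \<open>infdist x {} = 0\<close>; hence the case distinction.
\<close>

definition exhaust :: "(real^'n::finite) set \<Rightarrow> nat \<Rightarrow> (real^'n) set" where
  "exhaust Z m = {x \<in> Z. norm x \<le> real m \<and> (Z = UNIV \<or> 1 / real m \<le> infdist x (- Z))}"

definition Xi :: "(real^'k::finite) set" where
  "Xi = UNIV - {0}"

definition smooth_functions :: "(real^'x::finite) set \<Rightarrow> (real^'x \<Rightarrow> complex) set" where
  "smooth_functions X = {v. smooth_on X v}"

definition smooth_seminorm :: "(real^'x::finite) set \<Rightarrow> nat \<Rightarrow> (real^'x \<Rightarrow> complex) \<Rightarrow> ennreal" where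
  "smooth_seminorm X m v =
     Sup {ennreal (norm (mpartial (\<lambda>i. axis i 1) j v x)) | x j. x \<in> exhaust X m \<and> mlen j \<le> m}"

definition smooth_topology :: "(real^'x::finite) set \<Rightarrow> (real^'x \<Rightarrow> complex) topology" where
  "smooth_topology X = seminorm_topology (smooth_functions X) (smooth_seminorm X)"


section \<open>Phase functions\<close>

definition phases_hg ::
  "(real^'x::finite) set \<Rightarrow> (real^'y::finite) set \<Rightarrow> (('x, 'y, 'k::finite) pt \<Rightarrow> real) set" where
  "phases_hg X Y =
     {\<Phi>. smooth_on (X \<times> Y \<times> Xi) \<Phi> \<and>
         (\<forall>x\<in>X. \<forall>y\<in>Y. \<forall>\<xi>\<in>Xi. \<forall>t>0. \<Phi> (x, y, t *\<^sub>R \<xi>) = t * \<Phi> (x, y, \<xi>))}"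

definition phase_seminorm ::
  "(real^'x::finite) set \<Rightarrow> (real^'y::finite) set \<Rightarrow> nat \<Rightarrow> (('x, 'y, 'k::finite) pt \<Rightarrow> real) \<Rightarrow> ennreal" where
  "phase_seminorm X Y m \<Phi> =
     Sup {ennreal (norm \<xi> powr (real (mlen l) - 1) * \<bar>deriv_xyxi j k l \<Phi> (x, y, \<xi>)\<bar>)
          | x y \<xi> j k l. x \<in> exhaust X m \<and> y \<in> exhaust Y m \<and> \<xi> \<in> Xi \<and> mlen j + mlen k + mlen l \<le> m}"

definition phases ::
  "real \<Rightarrow> (real^'x::finite) set \<Rightarrow> (real^'y::finite) set \<Rightarrow> (('x, 'y, 'k::finite) pt \<Rightarrow> real) set" where
  "phases \<alpha> X Y =
     {\<Phi> \<in> phases_hg X Y. \<forall>x\<in>X. \<forall>y\<in>Y. \<forall>\<xi>\<in>Xi.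
        (norm (grad_x \<Phi> (x, y, \<xi>)))\<^sup>2 / (norm \<xi>)\<^sup>2 + (norm (grad_xi \<Phi> (x, y, \<xi>)))\<^sup>2 \<ge> \<alpha> \<and>
        (norm (grad_y \<Phi> (x, y, \<xi>)))\<^sup>2 / (norm \<xi>)\<^sup>2 + (norm (grad_xi \<Phi> (x, y, \<xi>)))\<^sup>2 \<ge> \<alpha>}"


section \<open>Amplitudes\<close>

definition japanese :: "real^'k::finite \<Rightarrow> real" where
  "japanese \<xi> = sqrt (1 + (norm \<xi>)\<^sup>2)"

definition hoermander_class ::
  "real \<Rightarrow> real \<Rightarrow> real \<Rightarrow> (real^'x::finite) set \<Rightarrow> (real^'y::finite) set \<Rightarrow>
   (('x, 'y, 'k::finite) pt \<Rightarrow> complex) set" where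
  "hoermander_class d \<rho> \<delta> X Y =
     {a. smooth_on (X \<times> Y \<times> UNIV) a \<and>
         (\<forall>j k l K. compact K \<and> K \<subseteq> X \<times> Y \<longrightarrow>
            (\<exists>C::real. \<forall>x y \<xi>. (x, y) \<in> K \<longrightarrow>
               norm (deriv_xyxi j k l a (x, y, \<xi>))
                 \<le> C * japanese \<xi> powr (d - \<rho> * real (mlen l) + \<delta> * real (mlen j + mlen k))))}"

definition amplitudes ::
  "real \<Rightarrow> real \<Rightarrow> real \<Rightarrow> (real^'x::finite) set \<Rightarrow> (real^'y::finite) set \<Rightarrow>
   (('x, 'y, 'k::finite) pt \<Rightarrow> complex) set" where
  "amplitudes d \<rho> \<delta> X Y =
     {a. \<exists>b \<in> hoermander_class d \<rho> \<delta> X Y. \<forall>z \<in> X \<times> Y \<times> Xi. a z = b z}"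

definition amplitude_seminorm ::
  "real \<Rightarrow> real \<Rightarrow> real \<Rightarrow> (real^'x::finite) set \<Rightarrow> (real^'y::finite) set \<Rightarrow> nat \<Rightarrow>
   (('x, 'y, 'k::finite) pt \<Rightarrow> complex) \<Rightarrow> ennreal" where
  "amplitude_seminorm d \<rho> \<delta> X Y m a =
     Sup {ennreal (japanese \<xi> powr (- d + \<rho> * real (mlen l) - \<delta> * real (mlen j + mlen k))
                     * norm (deriv_xyxi j k l a (x, y, \<xi>)))
          | x y \<xi> j k l. x \<in> exhaust X m \<and> y \<in> exhaust Y m \<and> \<xi> \<in> Xi \<and> mlen j + mlen k + mlen l \<le> m}"


section \<open>Pairs of phase functions and amplitudes\<close>

definition pair_seminorm ::
  "real \<Rightarrow> real \<Rightarrow> real \<Rightarrow> (real^'x::finite) set \<Rightarrow> (real^'y::finite) set \<Rightarrow> nat \<Rightarrow>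
   (('x, 'y, 'k::finite) pt \<Rightarrow> real) \<times> (('x, 'y, 'k) pt \<Rightarrow> complex) \<Rightarrow> ennreal" where
  "pair_seminorm d \<rho> \<delta> X Y m = (\<lambda>(\<Phi>, a). phase_seminorm X Y m \<Phi> + amplitude_seminorm d \<rho> \<delta> X Y m a)"

definition pair_topology ::
  "real \<Rightarrow> real \<Rightarrow> real \<Rightarrow> real \<Rightarrow> (real^'x::finite) set \<Rightarrow> (real^'y::finite) set \<Rightarrow>
   ((('x, 'y, 'k::finite) pt \<Rightarrow> real) \<times> (('x, 'y, 'k) pt \<Rightarrow> complex)) topology" where
  "pair_topology d \<alpha> \<rho> \<delta> X Y =
     seminorm_topology (phases \<alpha> X Y \<times> amplitudes d \<rho> \<delta> X Y) (pair_seminorm d \<rho> \<delta> X Y)"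


section \<open>Oscillatory integrals\<close>

definition cutoff :: "(real^'k::finite \<Rightarrow> complex) \<Rightarrow> bool" where
  "cutoff \<eta> \<longleftrightarrow> \<eta> \<in> test_functions UNIV \<and> (\<forall>\<xi>. norm \<xi> < 1 \<longrightarrow> \<eta> \<xi> = 1) \<and> (\<forall>\<xi>. norm \<xi> > 2 \<longrightarrow> \<eta> \<xi> = 0)"

definition osc_r :: "(('x::finite, 'y::finite, 'k::finite) pt \<Rightarrow> real) \<Rightarrow> ('x, 'y, 'k) pt \<Rightarrow> real" where
  "osc_r \<Phi> = (\<lambda>(x, y, \<xi>).
     (norm \<xi>)\<^sup>2 * (norm (grad_xi \<Phi> (x, y, \<xi>)))\<^sup>2 + (norm (grad_y \<Phi> (x, y, \<xi>)))\<^sup>2)"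

definition osc_alpha ::
  "(real^'k::finite \<Rightarrow> complex) \<Rightarrow> (('x::finite, 'y::finite, 'k) pt \<Rightarrow> real) \<Rightarrow> 'k \<Rightarrow> ('x, 'y, 'k) pt \<Rightarrow> complex" where
  "osc_alpha \<eta> \<Phi> l = (\<lambda>(x, y, \<xi>).
     - \<i> / of_real (osc_r \<Phi> (x, y, \<xi>)) * (1 - \<eta> \<xi>) * of_real ((norm \<xi>)\<^sup>2 * partial (dir_xi l) \<Phi> (x, y, \<xi>)))"

definition osc_beta ::
  "(real^'k::finite \<Rightarrow> complex) \<Rightarrow> (('x::finite, 'y::finite, 'k) pt \<Rightarrow> real) \<Rightarrow> 'y \<Rightarrow> ('x, 'y, 'k) pt \<Rightarrow> complex" where
  "osc_beta \<eta> \<Phi> k = (\<lambda>(x, y, \<xi>).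
     - \<i> / of_real (osc_r \<Phi> (x, y, \<xi>)) * (1 - \<eta> \<xi>) * of_real (partial (dir_y k) \<Phi> (x, y, \<xi>)))"

definition osc_L ::
  "(real^'k::finite \<Rightarrow> complex) \<Rightarrow> (('x::finite, 'y::finite, 'k) pt \<Rightarrow> real) \<Rightarrow>
   (('x, 'y, 'k) pt \<Rightarrow> complex) \<Rightarrow> ('x, 'y, 'k) pt \<Rightarrow> complex" where
  "osc_L \<eta> \<Phi> f = (\<lambda>(x, y, \<xi>).
     - (\<Sum>l\<in>UNIV. partial (dir_xi l) (\<lambda>w. osc_alpha \<eta> \<Phi> l w * f w) (x, y, \<xi>))
     - (\<Sum>k\<in>UNIV. partial (dir_y k) (\<lambda>w. osc_beta \<eta> \<Phi> k w * f w) (x, y, \<xi>))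
     + \<eta> \<xi> * f (x, y, \<xi>))"

definition osc_integral ::
  "(real^'k::finite \<Rightarrow> complex) \<Rightarrow> nat \<Rightarrow> (real^'y::finite) set \<Rightarrow> (('x::finite, 'y, 'k) pt \<Rightarrow> real) \<Rightarrow>
   (('x, 'y, 'k) pt \<Rightarrow> complex) \<Rightarrow> (real^'y \<Rightarrow> complex) \<Rightarrow> real^'x \<Rightarrow> complex" where
  "osc_integral \<eta> \<kappa> Y \<Phi> a \<psi> x =
     1 / (2 * of_real pi) ^ CARD('k) *
     (LINT \<xi>:Xi|lborel. LINT y:Y|lborel.
        exp (\<i> * of_real (\<Phi> (x, y, \<xi>))) *
        (osc_L \<eta> \<Phi> ^^ \<kappa>) (\<lambda>(x, y, \<xi>). a (x, y, \<xi>) * \<psi> y) (x, y, \<xi>))"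

end

theory Submission
  imports Defs
begin

text \<open>
  Continuity at a pair \<open>g\<^sub>0\<close> is tested along sequences.  If it failed for one of the seminorms of
  \<open>C\<^sup>\<infinity>(X)\<close>, there would be pairs \<open>g\<^sub>n\<close> whose distance from \<open>g\<^sub>0\<close> in the seminorm of index \<open>n + 1\<close>
  is below \<open>1 / (n + 1)\<close>, while their images stay a fixed distance away from the image of \<open>g\<^sub>0\<close>.
  The sequence and its limit form one family over the compact parameter set
  \<open>T = {0} \<union> {1 / (n + 1)}\<close>.  All derivatives of the oscillatory integral turn out to be jointly
  continuous in \<open>(t, x)\<close>; on \<open>T \<times> K\<close> with \<open>K\<close> compact this continuity is uniform, a contradiction.
  The constant sequence shows on the way that the oscillatory integral is smooth in \<open>x\<close>.

  Joint continuity comes from dominated convergence.  The bookkeeping is done by symbol families: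
  families of functions that are, with all their derivatives, jointly continuous in the parameter
  and the point, and bounded by powers of \<open>\<langle>\<xi>\<rangle>\<close> uniformly in the parameter.  They are closed under
  sums, products and reciprocals of functions that are bounded below.  Homogeneity makes a phase function a
  symbol of order 1 away from \<open>\<xi> = 0\<close>, the lower bound on its gradient makes \<open>1 / r\<close> a symbol of
  order \<open>-2\<close>, and therefore \<open>L\<close> lowers the order of a symbol by \<open>\<mu> = min \<rho> (1 - \<delta>)\<close>
  (\<open>symbol_osc_L\<close>).

  The exponent \<open>\<kappa>\<close> is fixed, but each \<open>x\<close>-derivative of \<open>e\<^bsup>i\<Phi>\<^esup>\<close> raises the order of the amplitude
  by 1, so that the differentiated integral need not converge.  Integration by parts shows that
  one more application of \<open>L\<close> does not change an integral that converges absolutely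
  (\<open>osc_int_osc_L\<close>).  Hence \<open>\<kappa>\<close> may be replaced by as large an exponent as the number of
  derivatives demands, and the integral is then differentiated under the integral sign
  (\<open>osc_int_partial\<close>, \<open>word_partial_osc_integral\<close>).
\<close>

section \<open>Derivatives along words of directions\<close>

lemma partial_eq_derivative:
  assumes "(f has_derivative f') (at z)"
  shows "partial v f z = f' v"
proof -
  have "((\<lambda>t. z + t *\<^sub>R v) has_derivative (\<lambda>t. t *\<^sub>R v)) (at 0)"
    by (auto intro!: derivative_eq_intros)
  moreover have "(f has_derivative f') (at (z + 0 *\<^sub>R v))"
    using assms by simp
  ultimately have "((\<lambda>t. f (z + t *\<^sub>R v)) has_derivative (\<lambda>t. f' (t *\<^sub>R v))) (at 0)"
    by (rule has_derivative_compose)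
  then have "((\<lambda>t. f (z + t *\<^sub>R v)) has_vector_derivative f' v) (at 0)"
    using linear_scale[OF has_derivative_linear[OF assms]] by (simp add: has_vector_derivative_def)
  then show ?thesis
    unfolding partial_def by (rule vector_derivative_at)
qed

lemma partial_eq_frechet:
  assumes "f differentiable (at z)"
  shows "partial v f z = frechet_derivative f (at z) v"
  using assms by (intro partial_eq_derivative) (simp add: frechet_derivative_works)

lemma has_vector_derivative_along_line:
  assumes "f differentiable (at (z + s *\<^sub>R v))"
  shows "((\<lambda>t. f (z + t *\<^sub>R v)) has_vector_derivative partial v f (z + s *\<^sub>R v)) (at s within A)"
proof -
  let ?f' = "frechet_derivative f (at (z + s *\<^sub>R v))"
  have f: "(f has_derivative ?f') (at (z + s *\<^sub>R v))"
    using assms by (simp add: frechet_derivative_works)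
  have "((\<lambda>t. z + t *\<^sub>R v) has_derivative (\<lambda>t. t *\<^sub>R v)) (at s)"
    by (auto intro!: derivative_eq_intros)
  from has_derivative_compose[OF this f]
  have "((\<lambda>t. f (z + t *\<^sub>R v)) has_derivative (\<lambda>t. ?f' (t *\<^sub>R v))) (at s)" .
  then have "((\<lambda>t. f (z + t *\<^sub>R v)) has_vector_derivative ?f' v) (at s)"
    using linear_scale[OF has_derivative_linear[OF f]] by (simp add: has_vector_derivative_def)
  then show ?thesis
    using assms by (simp add: partial_eq_frechet has_vector_derivative_at_within)
qed

lemma partial_cong_open:
  assumes "open S" "z \<in> S" "\<And>w. w \<in> S \<Longrightarrow> f w = g w"
  shows "partial v f z = partial v g z"
  unfolding partial_def
proof (rule vector_derivative_cong_eq)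
  have "continuous (at 0) (\<lambda>t::real. z + t *\<^sub>R v)"
    by (intro continuous_intros)
  then have "((\<lambda>t::real. z + t *\<^sub>R v) \<longlongrightarrow> z) (nhds 0)"
    by (simp add: continuous_at tendsto_nhds_iff)
  then have "eventually (\<lambda>t::real. z + t *\<^sub>R v \<in> S) (nhds 0)"
    using assms(1,2) by (auto simp: tendsto_def)
  then show "eventually (\<lambda>t. t \<in> UNIV \<longrightarrow> f (z + t *\<^sub>R v) = g (z + t *\<^sub>R v)) (nhds 0)"
    by eventually_elim (use assms(3) in auto)
qed auto

lemma differentiable_cong_open:
  assumes "open S" "z \<in> S" "\<And>w. w \<in> S \<Longrightarrow> f w = g w" "f differentiable (at z)"
  shows "g differentiable (at z)"
  using assms unfolding differentiable_def by (meson has_derivative_transform_within_open)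

lemma partial_zero_direction [simp]: "partial 0 f z = 0"
  by (simp add: partial_def)

lemma partial_const [simp]: "partial v (\<lambda>_. c) z = 0"
  by (simp add: partial_def)

lemma partial_compose_linear:
  assumes "linear h"
  shows "partial v (\<lambda>z. f (h z)) z = partial (h v) f (h z)"
  unfolding partial_def using assms by (simp add: linear_add linear_scale)

lemma partial_add:
  assumes "f differentiable (at z)" "g differentiable (at z)"
  shows "partial v (\<lambda>z. f z + g z) z = partial v f z + partial v g z"
  using assms by (subst partial_eq_derivative[OF has_derivative_add])
    (auto simp: frechet_derivative_works partial_eq_frechet)

lemma partial_diff:
  assumes "f differentiable (at z)" "g differentiable (at z)"
  shows "partial v (\<lambda>z. f z - g z) z = partial v f z - partial v g z"
  using assms by (subst partial_eq_derivative[OF has_derivative_diff])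
    (auto simp: frechet_derivative_works partial_eq_frechet)

lemma partial_bounded_linear:
  assumes "bounded_linear h" "f differentiable (at z)"
  shows "partial v (\<lambda>z. h (f z)) z = h (partial v f z)"
  using assms by (subst partial_eq_derivative[OF bounded_linear.has_derivative])
    (auto simp: frechet_derivative_works partial_eq_frechet)

lemma partial_mult:
  fixes f g :: "'a::real_normed_vector \<Rightarrow> 'b::real_normed_algebra"
  assumes "f differentiable (at z)" "g differentiable (at z)"
  shows "partial v (\<lambda>z. f z * g z) z = f z * partial v g z + partial v f z * g z"
  using assms by (subst partial_eq_derivative[OF has_derivative_mult])
    (auto simp: frechet_derivative_works partial_eq_frechet)

lemma partial_inverse:
  fixes f :: "'a::real_normed_vector \<Rightarrow> 'b::real_normed_field"
  assumes "f differentiable (at z)" "f z \<noteq> 0"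
  shows "partial v (\<lambda>z. inverse (f z)) z = - (partial v f z * (inverse (f z) * inverse (f z)))"
  using assms by (subst partial_eq_derivative[OF Deriv.has_derivative_inverse])
    (auto simp: frechet_derivative_works partial_eq_frechet)

lemma partial_exp:
  fixes f :: "'a::real_normed_vector \<Rightarrow> complex"
  assumes "f differentiable (at z)"
  shows "partial v (\<lambda>z. exp (f z)) z = exp (f z) * partial v f z"
    and "(\<lambda>z. exp (f z)) differentiable (at z)"
proof -
  have "(f has_derivative frechet_derivative f (at z)) (at z)"
    using assms by (simp add: frechet_derivative_works)
  moreover have "(exp has_derivative (*) (exp (f z))) (at (f z))"
    using DERIV_exp by (simp add: has_field_derivative_def)
  ultimately have *: "((\<lambda>z. exp (f z)) has_derivative
      (\<lambda>v. exp (f z) * frechet_derivative f (at z) v)) (at z)"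
    by (rule has_derivative_compose)
  then show "(\<lambda>z. exp (f z)) differentiable (at z)"
    by (rule differentiableI)
  show "partial v (\<lambda>z. exp (f z)) z = exp (f z) * partial v f z"
    using assms by (simp add: partial_eq_derivative[OF *] partial_eq_frechet)
qed

text \<open>
  Derivatives are indexed by lists of directions instead of multi-indices: inductions on the order
  of differentiation then add a single direction at either end of the list.
\<close>

definition word_partial :: "'a list \<Rightarrow> ('a::real_normed_vector \<Rightarrow> 'b::real_normed_vector) \<Rightarrow> 'a \<Rightarrow> 'b" where
  "word_partial ws f = foldr partial ws f"

lemma word_partial_simps [simp]:
  "word_partial [] f = f"
  "word_partial (b # ws) f = partial b (word_partial ws f)"
  by (simp_all add: word_partial_def)

lemma word_partial_append: "word_partial (us @ ws) f = word_partial us (word_partial ws f)"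
  by (simp add: word_partial_def)

lemma word_partial_cong_open:
  assumes "open S" "\<And>w. w \<in> S \<Longrightarrow> f w = g w" "z \<in> S"
  shows "word_partial ws f z = word_partial ws g z"
  using assms(3)
proof (induction ws arbitrary: z)
  case Nil then show ?case using assms by simp
next
  case (Cons b ws)
  have "partial b (word_partial ws f) z = partial b (word_partial ws g) z"
    by (rule partial_cong_open[OF assms(1)]) (use Cons in simp_all)
  then show ?case by simp
qed

lemma Ck_on_cong:
  assumes "open S" "\<And>z. z \<in> S \<Longrightarrow> f z = g z"
  shows "Ck_on n S f \<longleftrightarrow> Ck_on n S g"
  using assms(2)
proof (induction n arbitrary: f g)
  case 0 then show ?case by (simp cong: continuous_on_cong)
next
  case (Suc n)
  have "f differentiable (at z) \<longleftrightarrow> g differentiable (at z)" if "z \<in> S" for z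
    using differentiable_cong_open[OF assms(1) that, of f g]
      differentiable_cong_open[OF assms(1) that, of g f] Suc.prems by auto
  moreover have "Ck_on n S (partial b f) \<longleftrightarrow> Ck_on n S (partial b g)" for b
    using Suc.prems by (intro Suc.IH partial_cong_open[OF assms(1)]) auto
  ultimately show ?case by simp
qed

lemma Ck_on_subset: "Ck_on n S f \<Longrightarrow> S' \<subseteq> S \<Longrightarrow> Ck_on n S' f"
  by (induction n arbitrary: f) (auto intro: continuous_on_subset)

lemma Ck_on_diff:
  assumes "open S" "Ck_on n S f" "Ck_on n S g"
  shows "Ck_on n S (\<lambda>z. f z - g z)"
  using assms(2,3)
proof (induction n arbitrary: f g)
  case 0 then show ?case by (auto intro: continuous_intros)
next
  case (Suc n)
  then have "Ck_on n S (partial b (\<lambda>z. f z - g z))" if "b \<in> Basis" for b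
    using that by (subst Ck_on_cong[OF assms(1) partial_diff]) auto
  with Suc.prems show ?case by (simp add: differentiable_diff)
qed

lemma differentiable_of_real:
  assumes "f differentiable (at z)"
  shows "(\<lambda>z. of_real (f z) :: 'b::real_normed_field) differentiable (at z)"
  by (rule differentiable_compose[OF bounded_linear_imp_differentiable[OF bounded_linear_of_real] assms])

lemma smooth_on_cong:
  assumes "open S" "\<And>z. z \<in> S \<Longrightarrow> f z = g z"
  shows "smooth_on S f \<longleftrightarrow> smooth_on S g"
  using Ck_on_cong[OF assms] by (simp add: smooth_on_def)

lemma smooth_on_subset: "smooth_on S f \<Longrightarrow> S' \<subseteq> S \<Longrightarrow> smooth_on S' f"
  unfolding smooth_on_def by (blast intro: Ck_on_subset)

lemma smooth_on_diff: "open S \<Longrightarrow> smooth_on S f \<Longrightarrow> smooth_on S g \<Longrightarrow> smooth_on S (\<lambda>z. f z - g z)"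
  by (simp add: smooth_on_def Ck_on_diff)

lemma smooth_onD:
  assumes "smooth_on S f"
  shows "z \<in> S \<Longrightarrow> f differentiable (at z)" and "b \<in> Basis \<Longrightarrow> smooth_on S (partial b f)"
    and "continuous_on S f"
proof -
  have S: "Ck_on (Suc n) S f" for n
    using assms unfolding smooth_on_def by blast
  show "f differentiable (at z)" if "z \<in> S" using S[of 0] that by simp
  show "smooth_on S (partial b f)" if "b \<in> Basis" using S that by (simp add: smooth_on_def)
  show "continuous_on S f" using assms by (metis smooth_on_def Ck_on.simps(1))
qed

lemma smooth_on_word_partial: "smooth_on S f \<Longrightarrow> set ws \<subseteq> Basis \<Longrightarrow> smooth_on S (word_partial ws f)"
  by (induction ws) (simp_all add: smooth_onD(2))

lemma word_partial_diff:
  assumes "open S" "smooth_on S f" "smooth_on S g" "set ws \<subseteq> Basis" "z \<in> S"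
  shows "word_partial ws (\<lambda>z. f z - g z) z = word_partial ws f z - word_partial ws g z"
  using assms(4,5)
proof (induction ws arbitrary: z)
  case (Cons b ws)
  have "partial b (word_partial ws (\<lambda>z. f z - g z)) z
      = partial b (\<lambda>z. word_partial ws f z - word_partial ws g z) z"
    by (rule partial_cong_open[OF assms(1)]) (use Cons in simp_all)
  also have "\<dots> = partial b (word_partial ws f) z - partial b (word_partial ws g) z"
    using Cons.prems assms by (intro partial_diff smooth_onD(1)[OF smooth_on_word_partial]) auto
  finally show ?case by simp
qed auto

lemma increment_bound:
  fixes h :: "real \<Rightarrow> 'b::real_normed_vector"
  assumes "0 \<le> t" "\<And>s. 0 \<le> s \<Longrightarrow> s \<le> t \<Longrightarrow> (h has_vector_derivative h' s) (at s within {0..t})"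
    and "\<And>s. 0 \<le> s \<Longrightarrow> s \<le> t \<Longrightarrow> norm (h' s - c) \<le> e"
  shows "norm (h t - h 0 - t *\<^sub>R c) \<le> e * t"
proof -
  have d: "((\<lambda>s. h s - s *\<^sub>R c) has_derivative (\<lambda>r. r *\<^sub>R (h' s - c))) (at s within {0..t})"
    if "s \<in> {0..t}" for s
    using assms(2)[of s] that
    by (auto simp: has_vector_derivative_def scaleR_diff_right intro!: derivative_intros)
  have "norm ((h t - t *\<^sub>R c) - (h 0 - 0 *\<^sub>R c)) \<le> e * norm (t - 0)"
  proof (rule differentiable_bound[OF _ d])
    show "onorm (\<lambda>r. r *\<^sub>R (h' s - c)) \<le> e" if "s \<in> {0..t}" for s
    proof (rule onorm_le)
      fix r show "norm (r *\<^sub>R (h' s - c)) \<le> e * norm r"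
        using mult_left_mono[OF assms(3)[of s], of "norm r"] that by (simp add: mult.commute)
    qed
  qed (use assms in auto)
  then show ?thesis using assms(1) by (simp add: algebra_simps)
qed

text \<open>
  For fixed \<open>s\<close> the increment of \<open>\<partial>\<^sub>u f\<close> along \<open>t v\<close> is close to \<open>t c\<close>, which is then integrated
  over \<open>s\<close>.  The left-hand side of the estimate contains \<open>u\<close> and \<open>v\<close> symmetrically, whereas the
  hypothesis concerns only one of the two mixed derivatives.
\<close>

lemma second_difference_bound:
  fixes f :: "'a::real_normed_vector \<Rightarrow> 'b::real_normed_vector"
  assumes "0 \<le> t"
    and "\<And>s r. s \<in> {0..t} \<Longrightarrow> r \<in> {0..t} \<Longrightarrow> f differentiable (at (z + s *\<^sub>R u + r *\<^sub>R v))"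
    and "\<And>s r. s \<in> {0..t} \<Longrightarrow> r \<in> {0..t} \<Longrightarrow> partial u f differentiable (at (z + s *\<^sub>R u + r *\<^sub>R v))"
    and "\<And>s r. s \<in> {0..t} \<Longrightarrow> r \<in> {0..t} \<Longrightarrow>
           norm (partial v (partial u f) (z + s *\<^sub>R u + r *\<^sub>R v) - c) \<le> e"
  shows "norm ((f (z + t *\<^sub>R u + t *\<^sub>R v) - f (z + t *\<^sub>R u)) - (f (z + t *\<^sub>R v) - f z) - (t * t) *\<^sub>R c) \<le> e * t * t"
proof -
  let ?h = "\<lambda>s. f (z + s *\<^sub>R u + t *\<^sub>R v) - f (z + s *\<^sub>R u)"
  have "norm (?h t - ?h 0 - t *\<^sub>R (t *\<^sub>R c)) \<le> (e * t) * t"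
  proof (rule increment_bound[OF assms(1)])
    fix s assume s: "0 \<le> s" "s \<le> t"
    have 1: "z + t *\<^sub>R v + r *\<^sub>R u = z + r *\<^sub>R u + t *\<^sub>R v" for r by simp
    show "(?h has_vector_derivative
        partial u f (z + s *\<^sub>R u + t *\<^sub>R v) - partial u f (z + s *\<^sub>R u)) (at s within {0..t})"
      using has_vector_derivative_along_line[of f "z + t *\<^sub>R v" s u "{0..t}"]
        has_vector_derivative_along_line[of f z s u "{0..t}"]
        assms(2)[of s t] assms(2)[of s 0] s unfolding 1
      by (intro has_vector_derivative_diff) auto
    have "norm (partial u f (z + s *\<^sub>R u + t *\<^sub>R v) - partial u f (z + s *\<^sub>R u + 0 *\<^sub>R v) - t *\<^sub>R c) \<le> e * t"
      by (rule increment_bound[OF assms(1) has_vector_derivative_along_line]) (use s assms(3,4) in auto)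
    then show "norm (partial u f (z + s *\<^sub>R u + t *\<^sub>R v) - partial u f (z + s *\<^sub>R u) - t *\<^sub>R c) \<le> e * t"
      by simp
  qed
  then show ?thesis by (simp add: mult.assoc)
qed

text \<open>
  Schwarz's theorem: by the preceding estimate the second difference of \<open>f\<close>, divided by \<open>t\<^sup>2\<close>,
  approximates both mixed derivatives.
\<close>

lemma partial_commute:
  fixes f :: "'a::real_normed_vector \<Rightarrow> 'b::real_normed_vector"
  assumes "open S" "z \<in> S"
    and f: "\<And>w. w \<in> S \<Longrightarrow> f differentiable (at w)"
    and u: "\<And>w. w \<in> S \<Longrightarrow> partial u f differentiable (at w)"
    and v: "\<And>w. w \<in> S \<Longrightarrow> partial v f differentiable (at w)"
    and cuv: "continuous_on S (partial u (partial v f))" and cvu: "continuous_on S (partial v (partial u f))"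
  shows "partial u (partial v f) z = partial v (partial u f) z"
proof -
  let ?a = "partial v (partial u f) z" and ?b = "partial u (partial v f) z"
  have "norm (?a - ?b) \<le> e" if "e > 0" for e
  proof -
    obtain d where d: "d > 0" "\<And>w. dist w z < d \<Longrightarrow> w \<in> S"
      "\<And>w. dist w z < d \<Longrightarrow> norm (partial v (partial u f) w - ?a) < e / 2"
      "\<And>w. dist w z < d \<Longrightarrow> norm (partial u (partial v f) w - ?b) < e / 2"
    proof -
      obtain d0 where "d0 > 0" "\<And>w. dist w z < d0 \<Longrightarrow> w \<in> S"
        using assms(1,2) by (meson open_dist)
      moreover obtain d1 where "d1 > 0"
        "\<And>w. w \<in> S \<Longrightarrow> dist w z < d1 \<Longrightarrow> norm (partial v (partial u f) w - ?a) < e / 2"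
        using cvu assms(2) \<open>e > 0\<close> unfolding continuous_on_iff dist_norm by (metis half_gt_zero)
      moreover obtain d2 where "d2 > 0"
        "\<And>w. w \<in> S \<Longrightarrow> dist w z < d2 \<Longrightarrow> norm (partial u (partial v f) w - ?b) < e / 2"
        using cuv assms(2) \<open>e > 0\<close> unfolding continuous_on_iff dist_norm by (metis half_gt_zero)
      ultimately show thesis by (intro that[of "min d0 (min d1 d2)"]) auto
    qed
    \<comment> \<open>Small enough for the parallelogram spanned by \<open>t u\<close> and \<open>t v\<close> to stay within distance \<open>d\<close>.\<close>
    define t where "t = d / (2 * (norm u + norm v + 1))"
    have t: "t > 0" unfolding t_def using d(1) by (auto intro!: divide_pos_pos add_nonneg_pos)
    have near: "dist (z + s *\<^sub>R u + r *\<^sub>R v) z < d" "dist (z + r *\<^sub>R v + s *\<^sub>R u) z < d"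
      if "s \<in> {0..t}" "r \<in> {0..t}" for s r
    proof -
      have "norm (s *\<^sub>R u + r *\<^sub>R v) \<le> s * norm u + r * norm v"
        using that norm_triangle_ineq[of "s *\<^sub>R u" "r *\<^sub>R v"] by simp
      also have "\<dots> \<le> t * norm u + t * norm v"
        using that by (intro add_mono mult_right_mono) auto
      also have "\<dots> \<le> t * (norm u + norm v + 1)" using t by (simp add: algebra_simps)
      also have "\<dots> = d / 2"
        using add_nonneg_pos[of "norm u + norm v" 1] by (simp add: t_def field_simps)
      finally have "norm (s *\<^sub>R u + r *\<^sub>R v) < d" using d(1) by simp
      then show "dist (z + s *\<^sub>R u + r *\<^sub>R v) z < d" "dist (z + r *\<^sub>R v + s *\<^sub>R u) z < d"
        by (simp_all add: dist_norm add.assoc add.commute add.left_commute)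
    qed
    let ?\<Delta> = "(f (z + t *\<^sub>R u + t *\<^sub>R v) - f (z + t *\<^sub>R u)) - (f (z + t *\<^sub>R v) - f z)"
    have 1: "norm (?\<Delta> - (t * t) *\<^sub>R ?a) \<le> e / 2 * t * t"
      by (rule second_difference_bound)
        (use t in \<open>auto intro!: f u d(2) near less_imp_le[OF d(3)[OF near(1)], simplified]\<close>)
    have "norm ((f (z + t *\<^sub>R v + t *\<^sub>R u) - f (z + t *\<^sub>R v)) - (f (z + t *\<^sub>R u) - f z) - (t * t) *\<^sub>R ?b) \<le> e / 2 * t * t"
      by (rule second_difference_bound)
        (use t in \<open>auto intro!: f v d(2) near less_imp_le[OF d(4)[OF near(2)], simplified]\<close>)
    moreover have "(f (z + t *\<^sub>R v + t *\<^sub>R u) - f (z + t *\<^sub>R v)) - (f (z + t *\<^sub>R u) - f z) = ?\<Delta>"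
      by (simp add: algebra_simps)
    ultimately have 2: "norm (?\<Delta> - (t * t) *\<^sub>R ?b) \<le> e / 2 * t * t" by metis
    have "norm ((t * t) *\<^sub>R (?a - ?b)) = norm ((?\<Delta> - (t * t) *\<^sub>R ?b) - (?\<Delta> - (t * t) *\<^sub>R ?a))"
      by (simp add: algebra_simps)
    also have "\<dots> \<le> e / 2 * t * t + e / 2 * t * t"
      by (rule order_trans[OF norm_triangle_ineq4 add_mono[OF 2 1]])
    finally have "(t * t) * norm (?a - ?b) \<le> (t * t) * e"
      unfolding norm_scaleR using t by (simp add: abs_mult algebra_simps)
    then show ?thesis using t by (simp add: mult_le_cancel_left)
  qed
  then have "norm (?a - ?b) \<le> 0" by (metis add_0 field_le_epsilon)
  then show ?thesis by simp
qed

lemma smooth_on_partial_commute: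
  assumes "open S" "smooth_on S f" "u \<in> Basis" "v \<in> Basis" "z \<in> S"
  shows "partial u (partial v f) z = partial v (partial u f) z"
  by (rule partial_commute[OF assms(1,5)])
    (use assms(2-4) in \<open>simp_all add: smooth_onD(1) smooth_onD(1)[OF smooth_onD(2)]
      smooth_onD(3)[OF smooth_onD(2)[OF smooth_onD(2)]]\<close>)

lemma word_partial_move:
  assumes "open S" "smooth_on S f" "b \<in> Basis" "set ws \<subseteq> Basis" "z \<in> S"
  shows "word_partial ws (partial b f) z = partial b (word_partial ws f) z"
  using assms(4,5)
proof (induction ws arbitrary: z)
  case (Cons a ws)
  have "word_partial (a # ws) (partial b f) z = partial a (partial b (word_partial ws f)) z"
    unfolding word_partial_simps
    by (rule partial_cong_open[OF assms(1)]) (use Cons in simp_all)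
  also have "\<dots> = partial b (partial a (word_partial ws f)) z"
    using Cons.prems assms by (intro smooth_on_partial_commute[OF assms(1)] smooth_on_word_partial) auto
  finally show ?case by simp
qed auto

text \<open>
  The first letter of one word is moved to the front of the other, past the letters before it.
\<close>

lemma word_partial_perm:
  assumes "open S" "smooth_on S f" "mset us = mset ws" "set us \<subseteq> Basis" "z \<in> S"
  shows "word_partial us f z = word_partial ws f z"
  using assms(3-5)
proof (induction us arbitrary: ws z)
  case (Cons a us)
  then have "a \<in> set ws" by (metis list.set_intros(1) mset_eq_setD)
  then obtain p q where ws: "ws = p @ a # q" by (meson split_list)
  have sub: "set p \<subseteq> Basis" "set q \<subseteq> Basis"
    using Cons.prems mset_eq_setD[OF Cons.prems(1)] by (auto simp: ws)
  have "word_partial ws f z = partial a (word_partial (p @ q) f) z"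
    using Cons.prems sub assms
    by (auto simp: ws word_partial_append intro!: word_partial_move[OF assms(1)] smooth_on_word_partial)
  also have "\<dots> = partial a (word_partial us f) z"
    by (rule partial_cong_open[OF assms(1)]) (use Cons.prems in \<open>simp_all add: ws Cons.IH[of "p @ q"]\<close>)
  finally show ?case by simp
qed auto

section \<open>Calculus of symbol families\<close>

text \<open>
  \<open>T\<close> is the parameter set of the families and \<open>\<Omega>\<close> the common domain of their members.  The
  weight \<open>J\<close> measures growth; it will be \<open>\<langle>\<xi>\<rangle>\<close>.
\<close>

locale symbol_calculus =
  fixes T :: "real set" and \<Omega> :: "'a::euclidean_space set" and J :: "'a \<Rightarrow> real"
  assumes open_domain: "open \<Omega>" and weight_ge_1: "\<And>z. 1 \<le> J z"
begin

lemma weight_pos [simp]: "J z > 0" "J z \<noteq> 0"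
  using weight_ge_1[of z] by simp_all

text \<open>
  Joint continuity contains the convergence of the members of a family as the parameter tends to a
  limit, and the bounds provide dominating functions.  The bounds hold on each member of a collection
  \<open>\<P>\<close> of sets, with a constant that depends on the set: derivatives are taken on all of \<open>\<Omega>\<close>, but
  estimates are available only for \<open>x\<close> and \<open>y\<close> in compact sets and, for phase functions, for
  large \<open>\<xi>\<close>.
\<close>

definition symbol0 :: "'a set set \<Rightarrow> real \<Rightarrow> (real \<Rightarrow> 'a \<Rightarrow> 'b::real_normed_vector) \<Rightarrow> bool" where
  "symbol0 \<P> m F \<longleftrightarrow> continuous_on (T \<times> \<Omega>) (\<lambda>(t, z). F t z) \<and>
     (\<forall>P\<in>\<P>. \<exists>C. \<forall>t\<in>T. \<forall>z\<in>P \<inter> \<Omega>. norm (F t z) \<le> C * J z powr m)"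

text \<open>
  \<open>W\<close> is the set of directions in which derivatives are controlled, and a derivative in direction
  \<open>b\<close> lowers the order by \<open>\<omega> b\<close>.
\<close>

primrec symbol_upto ::
  "nat \<Rightarrow> 'a set set \<Rightarrow> 'a set \<Rightarrow> ('a \<Rightarrow> real) \<Rightarrow> real \<Rightarrow> (real \<Rightarrow> 'a \<Rightarrow> 'b::real_normed_vector) \<Rightarrow> bool" where
  "symbol_upto 0 \<P> W \<omega> m F \<longleftrightarrow> symbol0 \<P> m F"
| "symbol_upto (Suc n) \<P> W \<omega> m F \<longleftrightarrow> symbol0 \<P> m F \<and> (\<forall>t\<in>T. \<forall>z\<in>\<Omega>. F t differentiable (at z)) \<and>
     (\<forall>b\<in>W. symbol_upto n \<P> W \<omega> (m - \<omega> b) (\<lambda>t. partial b (F t)))"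

definition symbol ::
  "'a set set \<Rightarrow> 'a set \<Rightarrow> ('a \<Rightarrow> real) \<Rightarrow> real \<Rightarrow> (real \<Rightarrow> 'a \<Rightarrow> 'b::real_normed_vector) \<Rightarrow> bool" where
  "symbol \<P> W \<omega> m F \<longleftrightarrow> (\<forall>n. symbol_upto n \<P> W \<omega> m F)"

lemma symbol_upto_0: "symbol_upto n \<P> W \<omega> m F \<Longrightarrow> symbol0 \<P> m F"
  by (cases n) auto

lemma symbol_upto_SucD: "symbol_upto (Suc n) \<P> W \<omega> m F \<Longrightarrow> symbol_upto n \<P> W \<omega> m F"
proof (induction n arbitrary: m F)
  case (Suc n)
  have "symbol_upto n \<P> W \<omega> (m - \<omega> b) (\<lambda>t. partial b (F t))" if "b \<in> W" for b
    using Suc.prems that by (intro Suc.IH) simp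
  then show ?case using Suc.prems by simp
qed auto

lemma symbolD:
  assumes "symbol \<P> W \<omega> m F"
  shows "continuous_on (T \<times> \<Omega>) (\<lambda>(t, z). F t z)"
    and "P \<in> \<P> \<Longrightarrow> \<exists>C. \<forall>t\<in>T. \<forall>z\<in>P \<inter> \<Omega>. norm (F t z) \<le> C * J z powr m"
    and "t \<in> T \<Longrightarrow> z \<in> \<Omega> \<Longrightarrow> F t differentiable (at z)"
    and "b \<in> W \<Longrightarrow> symbol \<P> W \<omega> (m - \<omega> b) (\<lambda>t. partial b (F t))"
proof -
  have S: "symbol_upto n \<P> W \<omega> m F" for n using assms by (simp add: symbol_def)
  show "continuous_on (T \<times> \<Omega>) (\<lambda>(t, z). F t z)"
    "P \<in> \<P> \<Longrightarrow> \<exists>C. \<forall>t\<in>T. \<forall>z\<in>P \<inter> \<Omega>. norm (F t z) \<le> C * J z powr m"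
    using S[of 0] by (simp_all add: symbol0_def)
  show "F t differentiable (at z)" if "t \<in> T" "z \<in> \<Omega>" using S[of "Suc 0"] that by simp
  show "symbol \<P> W \<omega> (m - \<omega> b) (\<lambda>t. partial b (F t))" if "b \<in> W"
    unfolding symbol_def
  proof
    fix n show "symbol_upto n \<P> W \<omega> (m - \<omega> b) (\<lambda>t. partial b (F t))" using S[of "Suc n"] that by simp
  qed
qed

lemma symbol0_cong:
  assumes "\<And>t z. t \<in> T \<Longrightarrow> z \<in> \<Omega> \<Longrightarrow> F t z = G t z"
  shows "symbol0 \<P> m F \<longleftrightarrow> symbol0 \<P> m G"
proof -
  have "continuous_on (T \<times> \<Omega>) (\<lambda>(t, z). F t z) \<longleftrightarrow> continuous_on (T \<times> \<Omega>) (\<lambda>(t, z). G t z)"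
    by (rule continuous_on_cong) (use assms in auto)
  moreover have "(\<forall>t\<in>T. \<forall>z\<in>P \<inter> \<Omega>. norm (F t z) \<le> C * J z powr m) \<longleftrightarrow>
      (\<forall>t\<in>T. \<forall>z\<in>P \<inter> \<Omega>. norm (G t z) \<le> C * J z powr m)" for P C
    using assms by (metis IntD2)
  ultimately show ?thesis by (simp add: symbol0_def)
qed

lemma symbol_upto_cong:
  assumes "\<And>t z. t \<in> T \<Longrightarrow> z \<in> \<Omega> \<Longrightarrow> F t z = G t z" "symbol_upto n \<P> W \<omega> m F"
  shows "symbol_upto n \<P> W \<omega> m G"
  using assms
proof (induction n arbitrary: m F G)
  case 0 then show ?case using symbol0_cong[of F G] by simp
next
  case (Suc n)
  have "symbol_upto n \<P> W \<omega> (m - \<omega> b) (\<lambda>t. partial b (G t))" if "b \<in> W" for b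
  proof (rule Suc.IH)
    show "symbol_upto n \<P> W \<omega> (m - \<omega> b) (\<lambda>t. partial b (F t))" using Suc.prems that by simp
    show "partial b (F t) z = partial b (G t) z" if "t \<in> T" "z \<in> \<Omega>" for t z
      by (rule partial_cong_open[OF open_domain]) (use that Suc.prems in auto)
  qed
  moreover have "G t differentiable (at z)" if "t \<in> T" "z \<in> \<Omega>" for t z
    by (rule differentiable_cong_open[OF open_domain, of _ "F t"]) (use that Suc.prems in auto)
  moreover have "symbol0 \<P> m G" using symbol0_cong[of F G] Suc.prems by simp
  ultimately show ?case by simp
qed

lemma symbol_cong:
  assumes "symbol \<P> W \<omega> m F" "\<And>t z. t \<in> T \<Longrightarrow> z \<in> \<Omega> \<Longrightarrow> F t z = G t z"
  shows "symbol \<P> W \<omega> m G"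
  using assms symbol_upto_cong[of F G] by (simp add: symbol_def)

lemma symbol0_weaken:
  assumes "symbol0 \<P> m F" "\<And>P'. P' \<in> \<P>' \<Longrightarrow> \<exists>P\<in>\<P>. P' \<subseteq> P" "m \<le> m'"
  shows "symbol0 \<P>' m' F"
  unfolding symbol0_def
proof (intro conjI ballI)
  show "continuous_on (T \<times> \<Omega>) (\<lambda>(t, z). F t z)" using assms(1) by (simp add: symbol0_def)
  fix P' assume "P' \<in> \<P>'"
  then obtain P where P: "P \<in> \<P>" "P' \<subseteq> P" using assms(2) by blast
  then obtain C where C: "\<And>t z. t \<in> T \<Longrightarrow> z \<in> P \<inter> \<Omega> \<Longrightarrow> norm (F t z) \<le> C * J z powr m"
    using assms(1) unfolding symbol0_def by blast
  have "norm (F t z) \<le> \<bar>C\<bar> * J z powr m'" if "t \<in> T" "z \<in> P' \<inter> \<Omega>" for t z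
  proof -
    have "norm (F t z) \<le> C * J z powr m" using C that P by blast
    also have "\<dots> \<le> \<bar>C\<bar> * J z powr m'"
      using assms(3) weight_ge_1[of z] by (intro mult_mono powr_mono) auto
    finally show ?thesis .
  qed
  then show "\<exists>C. \<forall>t\<in>T. \<forall>z\<in>P' \<inter> \<Omega>. norm (F t z) \<le> C * J z powr m'" by blast
qed

lemma symbol_upto_weaken:
  assumes "symbol_upto n \<P> W \<omega> m F" "\<And>P'. P' \<in> \<P>' \<Longrightarrow> \<exists>P\<in>\<P>. P' \<subseteq> P" "W' \<subseteq> W"
    "\<And>b. b \<in> W' \<Longrightarrow> \<omega>' b \<le> \<omega> b" "m \<le> m'"
  shows "symbol_upto n \<P>' W' \<omega>' m' F"
  using assms(1,5)
proof (induction n arbitrary: m m' F)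
  case 0 then show ?case by (simp add: symbol0_weaken[OF _ assms(2)])
next
  case (Suc n)
  have "symbol_upto n \<P>' W' \<omega>' (m' - \<omega>' b) (\<lambda>t. partial b (F t))" if "b \<in> W'" for b
    by (rule Suc.IH[of "m - \<omega> b"]) (use Suc.prems assms(3) assms(4)[OF that] that in auto)
  moreover have "symbol0 \<P>' m' F"
    by (rule symbol0_weaken[OF _ assms(2)]) (use Suc.prems in auto)
  ultimately show ?case using Suc.prems assms(3) by simp
qed

lemma symbol_weaken:
  assumes "symbol \<P> W \<omega> m F" "\<And>P'. P' \<in> \<P>' \<Longrightarrow> \<exists>P\<in>\<P>. P' \<subseteq> P" "W' \<subseteq> W"
    "\<And>b. b \<in> W' \<Longrightarrow> \<omega>' b \<le> \<omega> b" "m \<le> m'"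
  shows "symbol \<P>' W' \<omega>' m' F"
  unfolding symbol_def
proof
  fix n
  have "symbol_upto n \<P> W \<omega> m F" using assms(1) by (simp add: symbol_def)
  then show "symbol_upto n \<P>' W' \<omega>' m' F" by (rule symbol_upto_weaken) (use assms(2-5) in auto)
qed

lemma symbol_order_mono: "symbol \<P> W \<omega> m F \<Longrightarrow> m \<le> m' \<Longrightarrow> symbol \<P> W \<omega> m' F"
  by (rule symbol_weaken) auto

lemma symbol_upto_zero: "symbol_upto n \<P> W \<omega> m (\<lambda>t z. 0 :: 'b::real_normed_vector)"
proof (induction n arbitrary: m)
  case 0 then show ?case by (auto simp: symbol0_def split_beta intro!: exI[of _ 0])
next
  case (Suc n)
  have "(\<lambda>t::real. partial b (\<lambda>z. 0 :: 'b)) = (\<lambda>t z. 0)" for b :: 'a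
    by (intro ext) simp
  then show ?case using Suc by (auto simp: symbol0_def split_beta intro!: exI[of _ 0])
qed

lemma symbol_zero: "symbol \<P> W \<omega> m (\<lambda>t z. 0)"
  by (simp add: symbol_def symbol_upto_zero)

lemma symbol_const: "0 \<le> m \<Longrightarrow> symbol \<P> W \<omega> m (\<lambda>t z. c)"
  unfolding symbol_def
proof
  fix n assume m: "0 \<le> m"
  have "symbol0 \<P> m (\<lambda>t z. c)"
    using weight_ge_1 m
    by (auto simp: symbol0_def split_beta mult_le_cancel_left1 ge_one_powr_ge_zero intro!: exI[of _ "norm c"])
  moreover have "(\<lambda>t::real. partial b (\<lambda>z. c)) = (\<lambda>t z. 0)" for b :: 'a
    by (intro ext) simp
  ultimately show "symbol_upto n \<P> W \<omega> m (\<lambda>t z. c)"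
    by (cases n) (simp_all add: symbol_upto_zero)
qed

lemma symbol0_add:
  assumes "symbol0 \<P> m F" "symbol0 \<P> m G"
  shows "symbol0 \<P> m (\<lambda>t z. F t z + G t z)"
  unfolding symbol0_def
proof (intro conjI ballI)
  show "continuous_on (T \<times> \<Omega>) (\<lambda>(t, z). F t z + G t z)"
    using assms by (auto simp: symbol0_def split_beta intro: continuous_on_add)
  fix P assume "P \<in> \<P>"
  then obtain C D where "\<And>t z. t \<in> T \<Longrightarrow> z \<in> P \<inter> \<Omega> \<Longrightarrow> norm (F t z) \<le> C * J z powr m"
    and "\<And>t z. t \<in> T \<Longrightarrow> z \<in> P \<inter> \<Omega> \<Longrightarrow> norm (G t z) \<le> D * J z powr m"
    using assms unfolding symbol0_def by meson
  then have "norm (F t z + G t z) \<le> (C + D) * J z powr m" if "t \<in> T" "z \<in> P \<inter> \<Omega>" for t z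
    using that by (intro order_trans[OF norm_triangle_ineq]) (simp add: distrib_right add_mono)
  then show "\<exists>C. \<forall>t\<in>T. \<forall>z\<in>P \<inter> \<Omega>. norm (F t z + G t z) \<le> C * J z powr m" by blast
qed

lemma symbol_upto_add:
  assumes "symbol_upto n \<P> W \<omega> m F" "symbol_upto n \<P> W \<omega> m G"
  shows "symbol_upto n \<P> W \<omega> m (\<lambda>t z. F t z + G t z)"
  using assms
proof (induction n arbitrary: m F G)
  case 0 then show ?case by (simp add: symbol0_add)
next
  case (Suc n)
  have "symbol_upto n \<P> W \<omega> (m - \<omega> b) (\<lambda>t. partial b (\<lambda>z. F t z + G t z))" if "b \<in> W" for b
  proof (rule symbol_upto_cong)
    show "symbol_upto n \<P> W \<omega> (m - \<omega> b) (\<lambda>t z. partial b (F t) z + partial b (G t) z)"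
      using Suc that by simp
  qed (use Suc.prems in \<open>simp add: partial_add\<close>)
  then show ?case using Suc.prems by (simp add: symbol0_add differentiable_add)
qed

lemma symbol_add:
  "symbol \<P> W \<omega> m F \<Longrightarrow> symbol \<P> W \<omega> m G \<Longrightarrow> symbol \<P> W \<omega> m (\<lambda>t z. F t z + G t z)"
  by (simp add: symbol_def symbol_upto_add)

lemma symbol_sum:
  "finite A \<Longrightarrow> (\<And>i. i \<in> A \<Longrightarrow> symbol \<P> W \<omega> m (F i)) \<Longrightarrow> symbol \<P> W \<omega> m (\<lambda>t z. \<Sum>i\<in>A. F i t z)"
proof (induction A rule: finite_induct)
  case empty then show ?case by (simp add: symbol_zero)
next
  case (insert i A) then show ?case by (simp add: symbol_add)
qed

lemma symbol0_mult:
  fixes F G :: "real \<Rightarrow> 'a \<Rightarrow> 'b::real_normed_algebra"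
  assumes "symbol0 \<P> m F" "symbol0 \<P> m' G"
  shows "symbol0 \<P> (m + m') (\<lambda>t z. F t z * G t z)"
  unfolding symbol0_def
proof (intro conjI ballI)
  show "continuous_on (T \<times> \<Omega>) (\<lambda>(t, z). F t z * G t z)"
    using assms by (auto simp: symbol0_def split_beta intro: continuous_on_mult)
  fix P assume "P \<in> \<P>"
  then obtain C D where C: "\<And>t z. t \<in> T \<Longrightarrow> z \<in> P \<inter> \<Omega> \<Longrightarrow> norm (F t z) \<le> C * J z powr m"
    and D: "\<And>t z. t \<in> T \<Longrightarrow> z \<in> P \<inter> \<Omega> \<Longrightarrow> norm (G t z) \<le> D * J z powr m'"
    using assms unfolding symbol0_def by meson
  have "norm (F t z * G t z) \<le> (C * D) * J z powr (m + m')" if "t \<in> T" "z \<in> P \<inter> \<Omega>" for t z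
  proof -
    have "norm (F t z * G t z) \<le> norm (F t z) * norm (G t z)" by (rule norm_mult_ineq)
    also have "\<dots> \<le> (C * J z powr m) * (D * J z powr m')"
      by (rule mult_mono[OF C D]) (use that order_trans[OF norm_ge_zero C] in auto)
    finally show ?thesis by (simp add: powr_add algebra_simps)
  qed
  then show "\<exists>C. \<forall>t\<in>T. \<forall>z\<in>P \<inter> \<Omega>. norm (F t z * G t z) \<le> C * J z powr (m + m')" by blast
qed

lemma symbol_upto_mult:
  fixes F G :: "real \<Rightarrow> 'a \<Rightarrow> 'b::real_normed_algebra"
  assumes "symbol_upto n \<P> W \<omega> m F" "symbol_upto n \<P> W \<omega> m' G"
  shows "symbol_upto n \<P> W \<omega> (m + m') (\<lambda>t z. F t z * G t z)"
  using assms
proof (induction n arbitrary: m m' F G)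
  case 0 then show ?case by (simp add: symbol0_mult)
next
  case (Suc n)
  have "symbol_upto n \<P> W \<omega> (m + m' - \<omega> b) (\<lambda>t. partial b (\<lambda>z. F t z * G t z))" if "b \<in> W" for b
  proof (rule symbol_upto_cong)
    have "symbol_upto n \<P> W \<omega> (m + (m' - \<omega> b)) (\<lambda>t z. F t z * partial b (G t) z)"
      "symbol_upto n \<P> W \<omega> ((m - \<omega> b) + m') (\<lambda>t z. partial b (F t) z * G t z)"
      using Suc.prems[THEN symbol_upto_SucD] Suc.prems that by (auto intro!: Suc.IH)
    then show "symbol_upto n \<P> W \<omega> (m + m' - \<omega> b)
        (\<lambda>t z. F t z * partial b (G t) z + partial b (F t) z * G t z)"
      by (intro symbol_upto_add) (simp_all add: algebra_simps)
  qed (use Suc.prems in \<open>simp add: partial_mult\<close>)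
  then show ?case using Suc.prems by (simp add: symbol0_mult)
qed

lemma symbol_mult:
  fixes F G :: "real \<Rightarrow> 'a \<Rightarrow> 'b::real_normed_algebra"
  assumes "symbol \<P> W \<omega> m F" "symbol \<P> W \<omega> m' G"
  shows "symbol \<P> W \<omega> (m + m') (\<lambda>t z. F t z * G t z)"
  using assms by (simp add: symbol_def symbol_upto_mult)

lemma symbol_cmult:
  fixes F :: "real \<Rightarrow> 'a \<Rightarrow> 'b::real_normed_algebra"
  assumes "symbol \<P> W \<omega> m F"
  shows "symbol \<P> W \<omega> m (\<lambda>t z. c * F t z)"
  using symbol_mult[OF symbol_const[OF order_refl, of \<P> W \<omega> c] assms] by simp

lemma symbol_uminus:
  fixes F :: "real \<Rightarrow> 'a \<Rightarrow> 'b::real_normed_algebra_1"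
  assumes "symbol \<P> W \<omega> m F"
  shows "symbol \<P> W \<omega> m (\<lambda>t z. - F t z)"
  using symbol_cmult[OF assms, of "- 1"] by simp

lemma symbol_of_real:
  assumes "symbol \<P> W \<omega> m F"
  shows "symbol \<P> W \<omega> m (\<lambda>t z. of_real (F t z) :: 'b::real_normed_field)"
proof -
  have base: "symbol0 \<P> m (\<lambda>t z. of_real (F t z) :: 'b)" if "symbol0 \<P> m F" for m F
    using that by (auto simp: symbol0_def split_beta intro: continuous_on_of_real)
  have "symbol_upto n \<P> W \<omega> m (\<lambda>t z. of_real (F t z) :: 'b)" if "symbol_upto n \<P> W \<omega> m F" for n m F
    using that
  proof (induction n arbitrary: m F)
    case 0 then show ?case by (simp add: base)
  next
    case (Suc n)
    have "symbol_upto n \<P> W \<omega> (m - \<omega> b) (\<lambda>t. partial b (\<lambda>z. of_real (F t z) :: 'b))" if "b \<in> W" for b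
    proof (rule symbol_upto_cong)
      show "symbol_upto n \<P> W \<omega> (m - \<omega> b) (\<lambda>t z. of_real (partial b (F t) z) :: 'b)"
        using Suc that by simp
    qed (use Suc.prems in \<open>simp add: partial_bounded_linear[OF bounded_linear_of_real]\<close>)
    then show ?case using Suc.prems by (simp add: base differentiable_of_real)
  qed
  then show ?thesis using assms by (simp add: symbol_def)
qed

text \<open>
  Since \<open>\<partial>(1 / F) = - \<partial>F \<cdot> (1 / F)\<^sup>2\<close>, estimates for \<open>n + 1\<close> derivatives of \<open>1 / F\<close> follow from
  those for \<open>n\<close> derivatives.
\<close>

lemma symbol_inverse:
  fixes F :: "real \<Rightarrow> 'a \<Rightarrow> 'b::real_normed_field"
  assumes F: "symbol \<P> W \<omega> m F"
    and nz: "\<And>t z. t \<in> T \<Longrightarrow> z \<in> \<Omega> \<Longrightarrow> F t z \<noteq> 0"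
    and lower: "\<And>P. P \<in> \<P> \<Longrightarrow> \<exists>c>0. \<forall>t\<in>T. \<forall>z\<in>P \<inter> \<Omega>. c * J z powr m \<le> norm (F t z)"
  shows "symbol \<P> W \<omega> (- m) (\<lambda>t z. inverse (F t z))"
proof -
  have base: "symbol0 \<P> (- m) (\<lambda>t z. inverse (F t z))"
    unfolding symbol0_def
  proof (intro conjI ballI)
    show "continuous_on (T \<times> \<Omega>) (\<lambda>(t, z). inverse (F t z))"
      using symbolD(1)[OF F] nz by (auto simp: split_beta intro!: continuous_on_inverse)
    fix P assume "P \<in> \<P>"
    then obtain c where c: "c > 0" "\<And>t z. t \<in> T \<Longrightarrow> z \<in> P \<inter> \<Omega> \<Longrightarrow> c * J z powr m \<le> norm (F t z)"
      using lower by blast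
    have "norm (inverse (F t z)) \<le> inverse c * J z powr - m" if "t \<in> T" "z \<in> P \<inter> \<Omega>" for t z
    proof -
      have "inverse (norm (F t z)) \<le> inverse (c * J z powr m)"
        using c that by (intro le_imp_inverse_le) auto
      then show ?thesis by (simp add: norm_inverse powr_minus)
    qed
    then show "\<exists>C. \<forall>t\<in>T. \<forall>z\<in>P \<inter> \<Omega>. norm (inverse (F t z)) \<le> C * J z powr - m" by blast
  qed
  have "symbol_upto n \<P> W \<omega> (- m) (\<lambda>t z. inverse (F t z))" for n
  proof (induction n)
    case 0 then show ?case using base by simp
  next
    case (Suc n)
    have "symbol_upto n \<P> W \<omega> (- m - \<omega> b) (\<lambda>t. partial b (\<lambda>z. inverse (F t z)))" if "b \<in> W" for b
    proof (rule symbol_upto_cong)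
      have "symbol_upto n \<P> W \<omega> (m - \<omega> b) (\<lambda>t z. partial b (F t) z)"
        using symbolD(4)[OF F that] by (simp add: symbol_def)
      from symbol_upto_mult[OF this symbol_upto_mult[OF Suc Suc]]
      have "symbol_upto n \<P> W \<omega> (0 + (m - \<omega> b + (- m + - m)))
          (\<lambda>t z. (- 1) * (partial b (F t) z * (inverse (F t z) * inverse (F t z))))"
        using symbol_const[of 0 \<P> W \<omega> "- 1 :: 'b"]
        by (intro symbol_upto_mult[where m = 0 and F = "\<lambda>t z. - 1"]) (simp_all add: symbol_def)
      then show "symbol_upto n \<P> W \<omega> (- m - \<omega> b)
          (\<lambda>t z. - (partial b (F t) z * (inverse (F t z) * inverse (F t z))))"
        by (simp add: algebra_simps)
    qed (use symbolD(3)[OF F] nz in \<open>simp add: partial_inverse\<close>)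
    moreover have "(\<lambda>z. inverse (F t z)) differentiable (at z)" if "t \<in> T" "z \<in> \<Omega>" for t z
      using symbolD(3)[OF F that] nz[OF that] by (intro differentiable_inverse)
    ultimately show ?case using base by simp
  qed
  then show ?thesis by (simp add: symbol_def)
qed

text \<open>
  Where a family vanishes on an open set, its derivatives vanish too, so that this set may be added
  to every set of \<open>\<P>\<close>.  It serves to pass from large \<open>\<xi>\<close> to all \<open>\<xi>\<close> after multiplication by
  \<open>1 - \<chi>\<close>.
\<close>

lemma symbol_localize:
  assumes F: "symbol \<P> W \<omega> m F" and "open U"
    and vanish: "\<And>t z. t \<in> T \<Longrightarrow> z \<in> U \<inter> \<Omega> \<Longrightarrow> F t z = 0"
    and cover: "\<And>P'. P' \<in> \<P>' \<Longrightarrow> \<exists>P\<in>\<P>. P' \<subseteq> P \<union> U"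
  shows "symbol \<P>' W \<omega> m F"
proof -
  have base: "symbol0 \<P>' m F"
    if F: "symbol0 \<P> m F" and van: "\<forall>t\<in>T. \<forall>z\<in>U \<inter> \<Omega>. F t z = 0" for m and F :: "real \<Rightarrow> 'a \<Rightarrow> 'b"
    unfolding symbol0_def
  proof (intro conjI ballI)
    show "continuous_on (T \<times> \<Omega>) (\<lambda>(t, z). F t z)" using F by (simp add: symbol0_def)
    fix P' assume "P' \<in> \<P>'"
    then obtain P where P: "P \<in> \<P>" "P' \<subseteq> P \<union> U" using cover by blast
    then obtain C where C: "\<And>t z. t \<in> T \<Longrightarrow> z \<in> P \<inter> \<Omega> \<Longrightarrow> norm (F t z) \<le> C * J z powr m"
      using F unfolding symbol0_def by blast
    have "norm (F t z) \<le> \<bar>C\<bar> * J z powr m" if "t \<in> T" "z \<in> P' \<inter> \<Omega>" for t z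
    proof (cases "z \<in> U")
      case True then show ?thesis using van that by simp
    next
      case False
      then have "norm (F t z) \<le> C * J z powr m" using C that P by blast
      also have "\<dots> \<le> \<bar>C\<bar> * J z powr m" by (intro mult_right_mono) auto
      finally show ?thesis .
    qed
    then show "\<exists>C. \<forall>t\<in>T. \<forall>z\<in>P' \<inter> \<Omega>. norm (F t z) \<le> C * J z powr m" by blast
  qed
  have "symbol_upto n \<P>' W \<omega> m F"
    if "symbol_upto n \<P> W \<omega> m F" "\<forall>t\<in>T. \<forall>z\<in>U \<inter> \<Omega>. F t z = 0" for n m and F :: "real \<Rightarrow> 'a \<Rightarrow> 'b"
    using that
  proof (induction n arbitrary: m F)
    case 0 then show ?case using base by simp
  next
    case (Suc n)
    have "partial b (F t) z = 0" if "t \<in> T" "z \<in> U \<inter> \<Omega>" for b t z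
    proof -
      have "partial b (F t) z = partial b (\<lambda>_. 0) z"
        by (rule partial_cong_open[of "U \<inter> \<Omega>"]) (use that Suc.prems assms(2) open_domain in auto)
      then show ?thesis by simp
    qed
    then have "symbol_upto n \<P>' W \<omega> (m - \<omega> b) (\<lambda>t. partial b (F t))" if "b \<in> W" for b
      using Suc that by simp
    then show ?case using Suc.prems base by simp
  qed
  then show ?thesis using F vanish by (simp add: symbol_def)
qed

text \<open>
  The recursive definition peels off the innermost derivative, which is the last letter of a word.
\<close>

lemma symbol_word_criterion:
  assumes smooth: "\<And>t. t \<in> T \<Longrightarrow> smooth_on \<Omega> (F t)" and W: "W \<subseteq> Basis"
    and words: "\<And>ws. set ws \<subseteq> W \<Longrightarrow> symbol0 \<P> (m - sum_list (map \<omega> ws)) (\<lambda>t. word_partial ws (F t))"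
  shows "symbol \<P> W \<omega> m F"
proof -
  have "symbol_upto n \<P> W \<omega> m F"
    if "\<forall>t\<in>T. smooth_on \<Omega> (F t)"
      "\<forall>ws. set ws \<subseteq> W \<longrightarrow> symbol0 \<P> (m - sum_list (map \<omega> ws)) (\<lambda>t. word_partial ws (F t))"
    for n m and F :: "real \<Rightarrow> 'a \<Rightarrow> 'b"
    using that
  proof (induction n arbitrary: m F)
    case 0 then show ?case by (auto dest: spec[of _ "[]"])
  next
    case (Suc n)
    have "symbol_upto n \<P> W \<omega> (m - \<omega> b) (\<lambda>t. partial b (F t))" if b: "b \<in> W" for b
    proof (rule Suc.IH)
      show "\<forall>t\<in>T. smooth_on \<Omega> (partial b (F t))"
        using Suc.prems(1) b W by (blast intro: smooth_onD(2))
      show "\<forall>ws. set ws \<subseteq> W \<longrightarrow>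
          symbol0 \<P> (m - \<omega> b - sum_list (map \<omega> ws)) (\<lambda>t. word_partial ws (partial b (F t)))"
      proof (intro allI impI)
        fix ws assume "set ws \<subseteq> W"
        then show "symbol0 \<P> (m - \<omega> b - sum_list (map \<omega> ws)) (\<lambda>t. word_partial ws (partial b (F t)))"
          using Suc.prems(2)[rule_format, of "ws @ [b]"] b by (simp add: word_partial_append algebra_simps)
      qed
    qed
    moreover have "symbol0 \<P> m F" using Suc.prems(2)[rule_format, of "[]"] by simp
    ultimately show ?case using Suc.prems(1) by (auto intro: smooth_onD(1))
  qed
  then show ?thesis using smooth words by (simp add: symbol_def)
qed

end

section \<open>Integrals\<close>

lemma translation_invariant_integral:
  fixes f :: "'a::euclidean_space \<Rightarrow> 'b::{banach, second_countable_topology}"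
  assumes "f \<in> borel_measurable borel"
  shows "(LINT z|lborel. f (z + v)) = (LINT z|lborel. f z)"
    and "integrable lborel (\<lambda>z. f (z + v)) \<longleftrightarrow> integrable lborel f"
proof -
  have "(LINT z|lborel. f z) = (LINT z|distr lborel borel ((+) v). f z)"
    by (subst lborel_distr_plus) (rule refl)
  also have "\<dots> = (LINT z|lborel. f (v + z))"
    by (rule integral_distr) (use assms in auto)
  finally show "(LINT z|lborel. f (z + v)) = (LINT z|lborel. f z)" by (simp add: add.commute)
  have "integrable lborel f \<longleftrightarrow> integrable (distr lborel borel ((+) v)) f"
    by (subst lborel_distr_plus) (rule refl)
  also have "\<dots> \<longleftrightarrow> integrable lborel (\<lambda>z. f (v + z))"
    by (rule integrable_distr_eq) (use assms in auto)
  finally show "integrable lborel (\<lambda>z. f (z + v)) \<longleftrightarrow> integrable lborel f" by (simp add: add.commute)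
qed

text \<open>
  Integrals are translation invariant, so \<open>\<integral> (f (z + v) - f z) dz = 0\<close>.  The integrand is
  \<open>\<integral>\<^sub>0\<^sup>1 \<partial>\<^sub>v f (z + s v) ds\<close>, and after an exchange of the two integrals translation invariance
  applies once more.
\<close>

lemma integral_partial_eq_zero:
  fixes f :: "'a::euclidean_space \<Rightarrow> 'b::euclidean_space"
  assumes diff: "\<And>z. f differentiable (at z)" and cont: "continuous_on UNIV (partial v f)"
    and f: "integrable lborel f" and f': "integrable lborel (partial v f)"
  shows "(LINT z|lborel. partial v f z) = 0"
proof -
  let ?g = "partial v f"
  let ?h = "\<lambda>(s::real, z). indicator {0..1} s *\<^sub>R ?g (z + s *\<^sub>R v)"
  have g_meas: "?g \<in> borel_measurable borel"
    using cont by (rule borel_measurable_continuous_onI)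
  have f_meas: "f \<in> borel_measurable borel"
    using f by (simp add: borel_measurable_integrable)
  have h_meas: "?h \<in> borel_measurable (lborel \<Otimes>\<^sub>M lborel)"
  proof -
    have "(\<lambda>p. ?g (snd p + fst p *\<^sub>R v)) \<in> borel_measurable (borel :: (real \<times> 'a) measure)"
      by (intro borel_measurable_continuous_onI continuous_on_compose2[OF cont] continuous_intros) auto
    then have "(\<lambda>p. ?g (snd p + fst p *\<^sub>R v)) \<in> borel_measurable (lborel \<Otimes>\<^sub>M (lborel :: 'a measure))"
      by (simp add: lborel_prod)
    moreover have "(\<lambda>p. indicator {0..1::real} (fst p) :: real) \<in> borel_measurable (lborel \<Otimes>\<^sub>M (lborel :: 'a measure))"
      by measurable
    ultimately show ?thesis unfolding split_beta by (rule borel_measurable_scaleR[rotated])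
  qed
  have inner: "(LINT z|lborel. norm (?h (s, z))) = indicator {0..1} s * (LINT z|lborel. norm (?g z))"
    "(LINT z|lborel. ?h (s, z)) = indicator {0..1} s *\<^sub>R (LINT z|lborel. ?g z)" for s
    using translation_invariant_integral(1)[of "\<lambda>z. norm (?g z)" "s *\<^sub>R v"]
      translation_invariant_integral(1)[of ?g "s *\<^sub>R v"] g_meas by auto
  have h_int: "integrable (lborel \<Otimes>\<^sub>M lborel) ?h"
  proof (rule lborel_pair.Fubini_integrable[OF h_meas])
    show "integrable lborel (\<lambda>s. LINT z|lborel. norm (?h (s, z)))"
      unfolding inner by (intro integrable_mult_left) (simp add: emeasure_lborel_Icc_eq)
    show "AE s in lborel. integrable lborel (\<lambda>z. ?h (s, z))"
      using translation_invariant_integral(2)[OF g_meas] f' by (intro AE_I2) simp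
  qed
  have line: "(LINT s|lborel. ?h (s, z)) = f (z + v) - f z" for z
  proof -
    have "(LINT s|lborel. indicator {0..1} s *\<^sub>R ?g (z + s *\<^sub>R v)) = f (z + 1 *\<^sub>R v) - f (z + 0 *\<^sub>R v)"
      by (rule integral_FTC_Icc[where F = "\<lambda>s. f (z + s *\<^sub>R v)"])
        (auto intro!: has_vector_derivative_along_line diff continuous_on_compose2[OF cont] continuous_intros)
    then show ?thesis by simp
  qed
  have "(LINT z|lborel. ?g z) = (LINT s|lborel. LINT z|lborel. ?h (s, z))"
    unfolding inner by (subst integral_scaleR_left) (simp_all add: emeasure_lborel_Icc_eq)
  also have "\<dots> = (LINT z|lborel. LINT s|lborel. ?h (s, z))"
    using lborel_pair.Fubini_integral[of "\<lambda>s z. ?h (s, z)"] h_int by simp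
  also have "\<dots> = (LINT z|lborel. f (z + v) - f z)"
    unfolding line ..
  also have "\<dots> = (LINT z|lborel. f (z + v)) - (LINT z|lborel. f z)"
    using f translation_invariant_integral(2)[OF f_meas, of v] by (intro Bochner_Integration.integral_diff) auto
  also have "\<dots> = 0" using translation_invariant_integral(1)[OF f_meas] by simp
  finally show ?thesis .
qed

lemma japanese_ge_1: "1 \<le> japanese \<xi>"
  by (simp add: japanese_def)

lemma japanese_pos: "0 < japanese \<xi>" and japanese_ne_0: "japanese \<xi> \<noteq> 0"
  using japanese_ge_1[of \<xi>] by auto

lemma norm_le_japanese: "norm \<xi> \<le> japanese \<xi>"
  unfolding japanese_def by (rule real_le_rsqrt) simp

lemma japanese_le: "1 \<le> norm \<xi> \<Longrightarrow> japanese \<xi> \<le> 2 * norm \<xi>"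
proof -
  assume "1 \<le> norm \<xi>"
  then have "1 + (norm \<xi>)\<^sup>2 \<le> (2 * norm \<xi>)\<^sup>2"
    using power_mono[of 1 "norm \<xi>" 2] by (simp add: power_mult_distrib del: one_le_power)
  then show ?thesis unfolding japanese_def by (intro real_le_lsqrt) auto
qed

lemma continuous_on_japanese [continuous_intros]:
  "continuous_on S f \<Longrightarrow> continuous_on S (\<lambda>x. japanese (f x))"
  unfolding japanese_def by (intro continuous_intros)

text \<open>
  The integrand is at most the sum over \<open>j\<close> of the indicators of the balls of radius \<open>2\<^bsup>j+1\<^esup>\<close>, with
  factors \<open>2\<^bsup>js\<^esup>\<close>, and the integral of this sum is a geometric series.
\<close>

lemma integrable_japanese_powr:
  assumes "s < - real CARD('k::finite)"
  shows "integrable lborel (\<lambda>\<xi>::real^'k. japanese \<xi> powr s)"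
proof (rule integrableI_bounded)
  show "(\<lambda>\<xi>::real^'k. japanese \<xi> powr s) \<in> borel_measurable lborel"
    using japanese_ne_0 by (auto intro!: borel_measurable_continuous_onI continuous_intros)
  \<comment> \<open>The ratio of the geometric series: \<open>2\<^sup>s\<close> from the integrand, \<open>2\<^bsup>CARD('k)\<^esup>\<close> from the volume.\<close>
  define c where "c = 2 powr (s + real CARD('k))"
  have c: "0 < c" "c < 1" using assms using powr_less_cancel_iff[of 2 "s + real CARD('k)" 0] by (simp_all add: c_def)
  let ?g = "\<lambda>j \<xi>::real^'k. ennreal ((2 powr s) ^ j) * indicator (ball 0 (2 ^ Suc j)) \<xi>"
  have "ball (0::real^'k) r \<in> sets lborel" for r by simp
  then have g_meas: "?g j \<in> borel_measurable lborel" for j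
    by (intro borel_measurable_times_ennreal borel_measurable_indicator borel_measurable_const)
  have "ennreal (norm (japanese \<xi> powr s)) \<le> (\<Sum>j. ?g j \<xi>)" for \<xi> :: "real^'k"
  proof -
    have "\<exists>j. norm \<xi> < 2 ^ Suc j"
    proof -
      obtain n where "norm \<xi> < 2 ^ n" using real_arch_pow[of 2 "norm \<xi>"] by auto
      also have "(2::real) ^ n \<le> 2 ^ Suc n" by simp
      finally show ?thesis by blast
    qed
    define j where "j = (LEAST j. norm \<xi> < 2 ^ Suc j)"
    have j: "norm \<xi> < 2 ^ Suc j"
      unfolding j_def by (rule LeastI_ex) fact
    have "(2::real) ^ j \<le> japanese \<xi>"
    proof (cases j)
      case 0 then show ?thesis using japanese_ge_1 by simp
    next
      case (Suc i)
      then have "\<not> norm \<xi> < 2 ^ Suc i" using not_less_Least[of i "\<lambda>j. norm \<xi> < 2 ^ Suc j"] by (simp add: j_def)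
      then show ?thesis using Suc norm_le_japanese[of \<xi>] by simp
    qed
    then have "japanese \<xi> powr s \<le> (2 ^ j) powr s"
      using assms by (intro powr_mono2') auto
    also have "\<dots> = (2 powr s) ^ j"
      by (simp add: powr_powr powr_realpow[symmetric] mult.commute)
    finally have "ennreal (norm (japanese \<xi> powr s)) \<le> ?g j \<xi>"
      using j by (simp add: ennreal_leI)
    also have "\<dots> \<le> (\<Sum>j. ?g j \<xi>)"
    proof -
      have "G j \<le> suminf G" for G :: "nat \<Rightarrow> ennreal"
        using sum_le_suminf[OF summableI, of "{j}" G] by simp
      then show ?thesis .
    qed
    finally show ?thesis .
  qed
  note * = this
  have "(\<integral>\<^sup>+ \<xi>. ennreal (norm (japanese (\<xi>::real^'k) powr s)) \<partial>lborel) \<le> (\<integral>\<^sup>+ \<xi>. (\<Sum>j. ?g j \<xi>) \<partial>lborel)"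
    by (rule nn_integral_mono) (rule *)
  also have "\<dots> = (\<Sum>j. \<integral>\<^sup>+ \<xi>. ?g j \<xi> \<partial>lborel)"
    by (rule nn_integral_suminf[of ?g]) (rule g_meas)
  also have "\<dots> = (\<Sum>j. ennreal (unit_ball_vol (real CARD('k)) * 2 ^ CARD('k) * c ^ j))"
  proof (rule suminf_cong)
    fix j
    have "(\<integral>\<^sup>+ \<xi>. ?g j \<xi> \<partial>lborel) = ennreal ((2 powr s) ^ j) * emeasure lborel (ball (0::real^'k) (2 ^ Suc j))"
      by (rule nn_integral_cmult_indicator) simp
    also have "\<dots> = ennreal ((2 powr s) ^ j * (unit_ball_vol (real CARD('k)) * (2 ^ Suc j) ^ CARD('k)))"
      by (simp add: emeasure_ball ennreal_mult unit_ball_vol_nonneg)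
    also have "(2 powr s) ^ j * (unit_ball_vol (real CARD('k)) * (2 ^ Suc j) ^ CARD('k)) =
        unit_ball_vol (real CARD('k)) * 2 ^ CARD('k) * c ^ j"
    proof -
      have "((2::real) ^ Suc j) ^ CARD('k) = 2 ^ CARD('k) * (2 ^ CARD('k)) ^ j"
        by (simp add: power_mult_distrib mult.commute flip: power_mult)
      moreover have "c ^ j = (2 powr s) ^ j * (2 ^ CARD('k)) ^ j"
        by (simp add: c_def powr_add powr_realpow power_mult_distrib)
      ultimately show ?thesis by (simp only: mult_ac)
    qed
    finally show "(\<integral>\<^sup>+ \<xi>. ?g j \<xi> \<partial>lborel) = ennreal (unit_ball_vol (real CARD('k)) * 2 ^ CARD('k) * c ^ j)" .
  qed
  also have "\<dots> = ennreal (\<Sum>j. unit_ball_vol (real CARD('k)) * 2 ^ CARD('k) * c ^ j)"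
    using c by (intro suminf_ennreal2) (auto intro!: mult_nonneg_nonneg summable_mult summable_geometric unit_ball_vol_nonneg)
  also have "\<dots> < \<infinity>" by simp
  finally show "(\<integral>\<^sup>+ \<xi>. ennreal (norm (japanese (\<xi>::real^'k) powr s)) \<partial>lborel) < \<infinity>" .
qed

lemma integrable_tensor_indicator:
  assumes g: "integrable lborel g" "\<And>\<xi>. 0 \<le> g \<xi>" and K: "compact K"
  shows "integrable lborel (\<lambda>(\<xi>::'a::euclidean_space, y::'b::euclidean_space). C * g \<xi> * indicator K y :: real)"
proof -
  have fin: "emeasure lborel K < \<infinity>" and [measurable]: "K \<in> sets borel"
    using K emeasure_compact_finite by (auto intro: borel_compact)
  have [measurable]: "g \<in> borel_measurable borel" using g(1) by (simp add: borel_measurable_integrable)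
  have "integrable (lborel \<Otimes>\<^sub>M lborel) (\<lambda>(\<xi>, y). g \<xi> * indicator K y :: real)"
  proof (rule lborel_pair.Fubini_integrable)
    show "(\<lambda>(\<xi>, y). g \<xi> * indicator K y :: real) \<in> borel_measurable (lborel \<Otimes>\<^sub>M lborel)"
      by measurable
    show "integrable lborel (\<lambda>\<xi>. LINT y|lborel. norm (case (\<xi>, y) of (\<xi>, y) \<Rightarrow> g \<xi> * indicator K y))"
      using g by (simp add: abs_mult)
    show "AE \<xi> in lborel. integrable lborel (\<lambda>y. case (\<xi>, y) of (\<xi>, y) \<Rightarrow> g \<xi> * indicator K y)"
      using fin by (intro AE_I2) simp
  qed
  then have "integrable lborel (\<lambda>(\<xi>, y). g \<xi> * indicator K y :: real)"
    by (simp add: lborel_prod)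
  from integrable_mult_right[OF this, of C] show ?thesis by (simp only: split_beta' mult.assoc)
qed

text \<open>
  A convergent sequence together with its limit is compact, so that a single dominating function
  serves along the sequence.
\<close>

lemma continuous_on_integral_dominated:
  fixes h :: "'p::heine_borel \<Rightarrow> 'w \<Rightarrow> 'b::{banach, second_countable_topology}"
  assumes cont: "\<And>w. continuous_on S (\<lambda>p. h p w)" and meas: "\<And>p. p \<in> S \<Longrightarrow> h p \<in> borel_measurable M"
    and bound: "\<And>K. compact K \<Longrightarrow> K \<subseteq> S \<Longrightarrow> \<exists>g. integrable M g \<and> (\<forall>p\<in>K. \<forall>w. norm (h p w) \<le> g w)"
  shows "continuous_on S (\<lambda>p. LINT w|M. h p w)"
  unfolding continuous_on_sequentially comp_def
proof (intro allI ballI impI, elim conjE)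
  fix u a assume u: "a \<in> S" "\<forall>n. u n \<in> S" "u \<longlonglongrightarrow> a"
  then have "compact (insert a (range u))" "insert a (range u) \<subseteq> S"
    using compact_sequence_with_limit[of u a] by auto
  from bound[OF this] obtain g where g: "integrable M g" "\<And>p w. p \<in> insert a (range u) \<Longrightarrow> norm (h p w) \<le> g w"
    by blast
  show "(\<lambda>n. LINT w|M. h (u n) w) \<longlonglongrightarrow> (LINT w|M. h a w)"
  proof (rule integral_dominated_convergence[OF _ _ g(1)])
    show "AE w in M. (\<lambda>n. h (u n) w) \<longlonglongrightarrow> h a w"
      using cont u by (intro AE_I2) (auto simp: continuous_on_sequentially comp_def)
  qed (use u meas g(2) in auto)
qed

text \<open>
  By the mean value inequality the dominating functions of the partial derivatives also dominate
  the difference quotients, uniformly in the direction of the increment.  Dominated convergence then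
  applies to the remainder of the first order expansion and yields a Frechet derivative.
\<close>

lemma has_derivative_integral_dominated:
  fixes h :: "'a::euclidean_space \<Rightarrow> 'w \<Rightarrow> 'b::{banach, second_countable_topology}"
  assumes "open S" "x \<in> S"
    and deriv: "\<And>y w. y \<in> S \<Longrightarrow> (\<lambda>y. h y w) differentiable (at y)"
    and meas: "\<And>y. y \<in> S \<Longrightarrow> h y \<in> borel_measurable M"
    and meas': "\<And>b. b \<in> Basis \<Longrightarrow> (\<lambda>w. partial b (\<lambda>y. h y w) x) \<in> borel_measurable M"
    and int: "integrable M (h x)"
    and bound: "\<And>b K. b \<in> Basis \<Longrightarrow> compact K \<Longrightarrow> K \<subseteq> S \<Longrightarrow>
       \<exists>g. integrable M g \<and> (\<forall>y\<in>K. \<forall>w. norm (partial b (\<lambda>y. h y w) y) \<le> g w)"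
  shows "(\<lambda>y. LINT w|M. h y w) differentiable (at x)"
    and "b \<in> Basis \<Longrightarrow> partial b (\<lambda>y. LINT w|M. h y w) x = (LINT w|M. partial b (\<lambda>y. h y w) x)"
proof -
  let ?D = "\<lambda>w v. \<Sum>b\<in>Basis. (v \<bullet> b) *\<^sub>R partial b (\<lambda>y. h y w) x"
  let ?I = "\<lambda>v. \<Sum>b\<in>Basis. (v \<bullet> b) *\<^sub>R (LINT w|M. partial b (\<lambda>y. h y w) x)"
  obtain e where e: "e > 0" "cball x e \<subseteq> S" using assms(1,2) open_contains_cball by blast
  have "\<forall>b\<in>Basis. \<exists>g. integrable M g \<and> (\<forall>y\<in>cball x e. \<forall>w. norm (partial b (\<lambda>y. h y w) y) \<le> g w)"
    using bound[OF _ compact_cball e(2)] by blast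
  from bchoice[OF this] obtain gb where gb: "\<And>b. b \<in> Basis \<Longrightarrow> integrable M (gb b)"
    "\<And>b y w. b \<in> Basis \<Longrightarrow> y \<in> cball x e \<Longrightarrow> norm (partial b (\<lambda>y. h y w) y) \<le> gb b w" by blast
  define g where "g w = (\<Sum>b\<in>(Basis::'a set). gb b w)" for w
  have g: "integrable M g" unfolding g_def using gb(1) by (intro Bochner_Integration.integrable_sum) auto
  have D: "((\<lambda>y. h y w) has_derivative (\<lambda>v. \<Sum>b\<in>Basis. (v \<bullet> b) *\<^sub>R partial b (\<lambda>y. h y w) y)) (at y)"
    if "y \<in> S" for y w
  proof -
    let ?f' = "frechet_derivative (\<lambda>y. h y w) (at y)"
    have f': "((\<lambda>y. h y w) has_derivative ?f') (at y)"
      using deriv[OF that] by (simp add: frechet_derivative_works)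
    have rep: "?f' v = (\<Sum>b\<in>Basis. (v \<bullet> b) *\<^sub>R ?f' b)" for v
    proof -
      note lin = has_derivative_linear[OF f']
      have "?f' v = ?f' (\<Sum>b\<in>Basis. (v \<bullet> b) *\<^sub>R b)" by (simp only: euclidean_representation)
      also have "\<dots> = (\<Sum>b\<in>Basis. (v \<bullet> b) *\<^sub>R ?f' b)"
        by (subst linear_sum[OF lin]) (rule sum.cong[OF refl linear_scale[OF lin]])
      finally show ?thesis .
    qed
    have "?f' = (\<lambda>v. \<Sum>b\<in>Basis. (v \<bullet> b) *\<^sub>R partial b (\<lambda>y. h y w) y)"
      unfolding partial_eq_frechet[OF deriv[OF that]] by (rule ext) (rule rep)
    then show ?thesis using f' by simp
  qed
  have D_bound: "norm (\<Sum>b\<in>Basis. (v \<bullet> b) *\<^sub>R partial b (\<lambda>y. h y w) y) \<le> g w * norm v"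
    if "y \<in> cball x e" for y w v
  proof -
    have "norm (\<Sum>b\<in>Basis. (v \<bullet> b) *\<^sub>R partial b (\<lambda>y. h y w) y) \<le> (\<Sum>b\<in>Basis. norm v * gb b w)"
      using gb(2) that by (intro sum_norm_le) (auto intro!: mult_mono Basis_le_norm)
    then show ?thesis by (simp add: g_def sum_distrib_left[symmetric] mult.commute)
  qed
  have int_h: "integrable M (h y)" if y: "y \<in> cball x e" for y
  proof (rule Bochner_Integration.integrable_bound)
    show "integrable M (\<lambda>w. norm (h x w) + g w * e)" using int g by simp
    show "h y \<in> borel_measurable M" using meas e(2) y by blast
    have "norm (h y w) \<le> norm (norm (h x w) + g w * e)" for w
    proof -
      have "norm (h y w - h x w) \<le> g w * norm (y - x)"
        by (rule differentiable_bound[OF convex_cball has_derivative_at_withinI[OF D]])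
          (use e y D_bound in \<open>auto intro!: onorm_le\<close>)
      also have "\<dots> \<le> g w * e"
      proof (rule mult_left_mono)
        show "norm (y - x) \<le> e" using y by (simp add: dist_norm norm_minus_commute)
        show "0 \<le> g w" unfolding g_def
          using gb(2)[of _ x w] e(1) by (intro sum_nonneg) (metis centre_in_cball less_imp_le norm_ge_zero order_trans)
      qed
      finally show ?thesis using norm_triangle_ineq2[of "h y w" "h x w"] by simp
    qed
    then show "AE w in M. norm (h y w) \<le> norm (norm (h x w) + g w * e)" by simp
  qed
  have int_D: "integrable M (\<lambda>w. partial b (\<lambda>y. h y w) x)" if "b \<in> Basis" for b
    by (rule Bochner_Integration.integrable_bound[OF gb(1)[OF that] meas'[OF that]])
      (use gb(2)[OF that, of x] e(1) in \<open>auto intro!: AE_I2 order_trans[OF _ abs_ge_self]\<close>)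
  have I: "?I v = (LINT w|M. ?D w v)" for v
    using int_D by (subst Bochner_Integration.integral_sum) auto
  have "((\<lambda>y. LINT w|M. h y w) has_derivative ?I) (at x)"
    unfolding has_derivative_at
  proof
    show "bounded_linear ?I"
      by (intro bounded_linear_sum bounded_linear_scaleR_const bounded_linear_inner_left)
    show "(\<lambda>v. norm ((LINT w|M. h (x + v) w) - (LINT w|M. h x w) - ?I v) / norm v) \<midarrow>0\<rightarrow> 0"
      unfolding tendsto_at_iff_sequentially
    proof (intro allI impI)
      fix u :: "nat \<Rightarrow> 'a" assume u: "\<forall>i. u i \<in> UNIV - {0}" "u \<longlonglongrightarrow> 0"
      define q where "q i w = (if norm (u i) \<le> e then (1 / norm (u i)) *\<^sub>R (h (x + u i) w - h x w - ?D w (u i)) else 0)" for i w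
      have near: "x + u i \<in> cball x e" if "norm (u i) \<le> e" for i using that by (simp add: dist_norm)
      have "(\<lambda>i. LINT w|M. q i w) \<longlonglongrightarrow> (LINT w|M. 0)"
      proof (rule integral_dominated_convergence[where w = "\<lambda>w. 2 * g w"])
        show "integrable M (\<lambda>w. 2 * g w)" using g by simp
        show "q i \<in> borel_measurable M" for i
          using near[of i] meas[of "x + u i"] meas[of x] meas' e(2) assms(2)
          unfolding q_def by (cases "norm (u i) \<le> e") (auto intro!: borel_measurable_scaleR borel_measurable_diff borel_measurable_sum)
        show "AE w in M. (\<lambda>i. q i w) \<longlonglongrightarrow> 0"
        proof (rule AE_I2)
          fix w
          have "(\<lambda>v. norm (h (x + v) w - h x w - ?D w v) / norm v) \<midarrow>0\<rightarrow> 0"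
            using D[OF assms(2), of w] unfolding has_derivative_at by blast
          then have "(\<lambda>i. norm (h (x + u i) w - h x w - ?D w (u i)) / norm (u i)) \<longlonglongrightarrow> 0"
            using u unfolding tendsto_at_iff_sequentially comp_def by blast
          then show "(\<lambda>i. q i w) \<longlonglongrightarrow> 0"
            by (rule Lim_null_comparison[rotated]) (auto simp: q_def intro!: always_eventually)
        qed
        show "AE w in M. norm (q i w) \<le> 2 * g w" for i
        proof (rule AE_I2)
          fix w
          have gnn: "0 \<le> g w" unfolding g_def
            using gb(2)[of _ x w] e(1) by (intro sum_nonneg) (metis centre_in_cball less_imp_le norm_ge_zero order_trans)
          show "norm (q i w) \<le> 2 * g w"
          proof (cases "norm (u i) \<le> e")
            case True
            have "norm (h (x + u i) w - h x w) \<le> g w * norm ((x + u i) - x)"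
              by (rule differentiable_bound[OF convex_cball has_derivative_at_withinI[OF D]])
                (use e near[OF True] D_bound in \<open>auto intro!: onorm_le\<close>)
            moreover have "norm (?D w (u i)) \<le> g w * norm (u i)" using D_bound[of x "u i" w] e(1) by simp
            ultimately have "norm (h (x + u i) w - h x w - ?D w (u i)) \<le> (2 * g w) * norm (u i)"
              by (intro order_trans[OF norm_triangle_ineq4]) simp
            then show ?thesis using u(1) True by (simp add: q_def divide_simps)
          qed (use gnn in \<open>simp add: q_def\<close>)
        qed
      qed auto
      then have lim: "(\<lambda>i. norm (LINT w|M. q i w)) \<longlonglongrightarrow> 0" using tendsto_norm_zero by fastforce
      have "eventually (\<lambda>i. norm (u i) < e) sequentially"
        using u(2) e(1) by (metis order_tendstoD(2) tendsto_norm_zero)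
      then have "eventually (\<lambda>i. norm (LINT w|M. q i w) =
          norm ((LINT w|M. h (x + u i) w) - (LINT w|M. h x w) - ?I (u i)) / norm (u i)) sequentially"
      proof eventually_elim
        case (elim i)
        then have "(LINT w|M. q i w) = (1 / norm (u i)) *\<^sub>R (LINT w|M. h (x + u i) w - h x w - ?D w (u i))"
          by (simp add: q_def)
        also have "(LINT w|M. h (x + u i) w - h x w - ?D w (u i)) = (LINT w|M. h (x + u i) w) - (LINT w|M. h x w) - ?I (u i)"
          unfolding I using int_h near[of i] int elim int_D
          by (subst Bochner_Integration.integral_diff) (auto simp: Bochner_Integration.integral_diff)
        finally show ?case by simp
      qed
      then show "((\<lambda>v. norm ((LINT w|M. h (x + v) w) - (LINT w|M. h x w) - ?I v) / norm v) \<circ> u) \<longlonglongrightarrow> 0"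
        unfolding comp_def using lim by (rule Lim_transform_eventually[rotated])
    qed
  qed
  note d = this
  show "(\<lambda>y. LINT w|M. h y w) differentiable (at x)" using d by (rule differentiableI)
  show "partial b (\<lambda>y. LINT w|M. h y w) x = (LINT w|M. partial b (\<lambda>y. h y w) x)" if b: "b \<in> Basis"
  proof -
    have "?I b = (\<Sum>c\<in>Basis. if c = b then LINT w|M. partial b (\<lambda>y. h y w) x else 0)"
      using b by (intro sum.cong) (auto simp: inner_Basis)
    then show ?thesis using partial_eq_derivative[OF d, of b] b by simp
  qed
qed

section \<open>Words and multi-indices\<close>

text \<open>
  The amount by which a derivative in a coordinate direction lowers the order of a symbol of type
  \<open>(\<rho>, \<delta>)\<close>: derivatives in \<open>x\<close> and \<open>y\<close> raise the order by \<open>\<delta>\<close>.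
\<close>

definition order_gain :: "real \<Rightarrow> real \<Rightarrow> ('x::finite, 'y::finite, 'k::finite) pt \<Rightarrow> real" where
  "order_gain \<rho> \<delta> b = (if snd (snd b) = 0 then - \<delta> else \<rho>)"

abbreviation word_gain :: "real \<Rightarrow> real \<Rightarrow> ('x::finite, 'y::finite, 'k::finite) pt list \<Rightarrow> real" where
  "word_gain \<rho> \<delta> ws \<equiv> sum_list (map (order_gain \<rho> \<delta>) ws)"

lemma order_gain_simps [simp]:
  "order_gain \<rho> \<delta> (dir_x i) = - \<delta>" "order_gain \<rho> \<delta> (dir_y i') = - \<delta>" "order_gain \<rho> \<delta> (dir_xi i'') = \<rho>"
  by (simp_all add: order_gain_def dir_x_def dir_y_def dir_xi_def axis_eq_0_iff)

lemma dir_in_Basis [simp]: "dir_x i \<in> Basis" "dir_y i' \<in> Basis" "dir_xi i'' \<in> Basis"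
  by (simp_all add: dir_x_def dir_y_def dir_xi_def Basis_prod_def image_iff axis_in_Basis_iff axis_eq_0_iff zero_prod_def)

lemma Basis_pt_cases:
  fixes b :: "('x::finite, 'y::finite, 'k::finite) pt"
  assumes "b \<in> Basis"
  obtains (x) i where "b = dir_x i" | (y) i where "b = dir_y i" | (xi) i where "b = dir_xi i"
  using assms by (auto simp: Basis_prod_def Basis_vec_def dir_x_def dir_y_def dir_xi_def zero_prod_def)

lemma mpartial_eq_word_partial:
  "mpartial e j f = word_partial (concat (map (\<lambda>i. replicate (j i) (e i)) index_enum)) f"
proof -
  have r: "word_partial (replicate n v) g = (partial v ^^ n) g" for n v g
    by (induction n) simp_all
  have "foldr (\<lambda>i. partial (e i) ^^ j i) is f = word_partial (concat (map (\<lambda>i. replicate (j i) (e i)) is)) f" for "is"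
    by (induction "is") (simp_all add: word_partial_append r)
  then show ?thesis by (simp add: mpartial_def)
qed

lemma index_enum: "distinct (index_enum :: 'i::finite list)" "set (index_enum :: 'i list) = UNIV"
proof -
  have "\<exists>is :: 'i list. distinct is \<and> set is = UNIV"
    using finite_distinct_list[of "UNIV :: 'i set"] by auto
  from someI_ex[OF this] show "distinct (index_enum :: 'i list)" "set (index_enum :: 'i list) = UNIV"
    by (simp_all add: index_enum_def)
qed

text \<open>
  The word of directions that a multi-index stands for, in the order in which derivatives with
  respect to multi-indices run through the coordinates.
\<close>

definition multi_word :: "('i::finite \<Rightarrow> 'a) \<Rightarrow> ('i \<Rightarrow> nat) \<Rightarrow> 'a list" where
  "multi_word e j = concat (map (\<lambda>i. replicate (j i) (e i)) index_enum)"

lemma mset_multi_word: "mset (multi_word e j) = (\<Sum>i\<in>UNIV. replicate_mset (j i) (e i))"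
proof -
  have "mset (concat (map (\<lambda>i. replicate (j i) (e i)) is)) = (\<Sum>i\<leftarrow>is. replicate_mset (j i) (e i))" for "is"
    by (induction "is") simp_all
  then show ?thesis
    using sum.distinct_set_conv_list[OF index_enum(1), of "\<lambda>i. replicate_mset (j i) (e i)"]
    by (simp add: multi_word_def index_enum(2))
qed

lemma multi_word_increment:
  "mset (multi_word e (j(i := Suc (j i)))) = add_mset (e i) (mset (multi_word e j))"
proof -
  have "(\<Sum>i'\<in>UNIV - {i}. replicate_mset ((j(i := Suc (j i))) i') (e i')) = (\<Sum>i'\<in>UNIV - {i}. replicate_mset (j i') (e i'))"
    by (intro sum.cong) auto
  then show ?thesis
    by (simp add: mset_multi_word sum.remove[of UNIV i])
qed

lemma mlen_increment: "mlen (j(i := Suc (j i))) = Suc (mlen j)"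
proof -
  have "(\<Sum>i'\<in>UNIV - {i}. (j(i := Suc (j i))) i') = (\<Sum>i'\<in>UNIV - {i}. j i')"
    by (intro sum.cong) auto
  then show ?thesis by (simp add: mlen_def sum.remove[of UNIV i])
qed

lemma deriv_xyxi_eq_word_partial:
  "deriv_xyxi j k l f = word_partial (multi_word dir_x j @ multi_word dir_y k @ multi_word dir_xi l) f"
  by (simp add: deriv_xyxi_def mpartial_eq_word_partial multi_word_def word_partial_append)

text \<open>
  The seminorms control derivatives in one particular order.  Up to a permutation every word of
  coordinate directions is such a derivative, and both its length and its effect on the order of a
  symbol can be read off from the multi-indices.
\<close>

lemma word_as_multi_index:
  fixes ws :: "('x::finite, 'y::finite, 'k::finite) pt list"
  assumes "set ws \<subseteq> Basis"
  shows "\<exists>j k l. mlen j + mlen k + mlen l = length ws \<and>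
     (\<forall>\<rho> \<delta>. word_gain \<rho> \<delta> ws = \<rho> * real (mlen l) - \<delta> * real (mlen j + mlen k)) \<and>
     mset ws = mset (multi_word dir_x j @ multi_word dir_y k @ multi_word dir_xi l)"
  using assms
proof (induction ws)
  case Nil
  have 0: "mset (multi_word e (\<lambda>_. 0)) = {#}" for e :: "'i::finite \<Rightarrow> 'a"
    by (simp add: mset_multi_word)
  show ?case
    by (rule exI[of _ "\<lambda>_. 0"], rule exI[of _ "\<lambda>_. 0"], rule exI[of _ "\<lambda>_. 0"]) (simp add: mlen_def 0 del: mset_zero_iff)
next
  case (Cons b ws)
  then obtain j k l where jkl: "mlen j + mlen k + mlen l = length ws"
    "\<And>\<rho> \<delta>. word_gain \<rho> \<delta> ws = \<rho> * real (mlen l) - \<delta> * real (mlen j + mlen k)"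
    "mset ws = mset (multi_word dir_x j @ multi_word dir_y k @ multi_word dir_xi l)" by auto
  from Cons.prems have "b \<in> Basis" by simp
  then show ?case
  proof (cases rule: Basis_pt_cases)
    case (x i)
    obtain j' where "mlen j' = Suc (mlen j)"
      "mset (multi_word dir_x j') = add_mset b (mset (multi_word dir_x j))"
      using mlen_increment multi_word_increment x by metis
    then show ?thesis using jkl x
      by (intro exI[of _ j'] exI[of _ k] exI[of _ l]) (simp add: algebra_simps)
  next
    case (y i)
    obtain j' where "mlen j' = Suc (mlen k)"
      "mset (multi_word dir_y j') = add_mset b (mset (multi_word dir_y k))"
      using mlen_increment multi_word_increment y by metis
    then show ?thesis using jkl y
      by (intro exI[of _ j] exI[of _ j'] exI[of _ l]) (simp add: algebra_simps)
  next
    case (xi i)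
    obtain j' where "mlen j' = Suc (mlen l)"
      "mset (multi_word dir_xi j') = add_mset b (mset (multi_word dir_xi l))"
      using mlen_increment multi_word_increment xi by metis
    then show ?thesis using jkl xi
      by (intro exI[of _ j] exI[of _ k] exI[of _ j']) (simp add: algebra_simps)
  qed
qed

lemma word_partial_eq_deriv_xyxi:
  assumes "mset ws = mset (multi_word dir_x j @ multi_word dir_y k @ multi_word dir_xi l)"
    and "set ws \<subseteq> Basis" "open S" "smooth_on S f" "z \<in> S"
  shows "word_partial ws f z = deriv_xyxi j k l f z"
  unfolding deriv_xyxi_eq_word_partial using assms by (intro word_partial_perm)

section \<open>Homogeneous phase functions\<close>

lemma open_Xi: "open Xi"
  by (simp add: Xi_def open_delete)

text \<open>
  Differentiating the identity \<open>f (x, y, s \<xi>) = s\<^sup>m f (x, y, \<xi>)\<close> in a \<open>\<xi>\<close>-direction produces a factor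
  \<open>s\<close> on the left, so the degree drops by 1; in the other directions it does not change.
\<close>

lemma homogeneous_partial:
  fixes f :: "('x::finite, 'y::finite, 'k::finite) pt \<Rightarrow> real"
  assumes "open X" "open Y"
    and diff: "\<And>z. z \<in> X \<times> Y \<times> Xi \<Longrightarrow> f differentiable (at z)"
    and hom: "\<And>x y \<xi> s. x \<in> X \<Longrightarrow> y \<in> Y \<Longrightarrow> \<xi> \<in> Xi \<Longrightarrow> s > 0 \<Longrightarrow> f (x, y, s *\<^sub>R \<xi>) = s powr m * f (x, y, \<xi>)"
    and b: "b \<in> Basis" and xyxi: "x \<in> X" "y \<in> Y" "\<xi> \<in> Xi" "s > 0"
  shows "partial b f (x, y, s *\<^sub>R \<xi>) = s powr (m - order_gain 1 0 b) * partial b f (x, y, \<xi>)"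
proof -
  define S where "S = (\<lambda>(x, y, \<xi>). (x, y, s *\<^sub>R \<xi>) :: ('x, 'y, 'k) pt)"
  have lin: "linear S" by (auto simp: S_def linear_iff scaleR_add_right scaleR_left_commute)
  have op: "open (X \<times> Y \<times> Xi)" using assms(1,2) open_Xi by (intro open_Times)
  have d: "f differentiable (at (x, y, s *\<^sub>R \<xi>))" using xyxi by (intro diff) (auto simp: Xi_def)
  have "partial (S b) f (S (x, y, \<xi>)) = partial b (\<lambda>z. f (S z)) (x, y, \<xi>)"
    by (rule partial_compose_linear[OF lin, symmetric])
  also have "\<dots> = partial b (\<lambda>z. s powr m * f z) (x, y, \<xi>)"
    by (rule partial_cong_open[OF op]) (use xyxi hom in \<open>auto simp: S_def\<close>)
  also have "\<dots> = s powr m * partial b f (x, y, \<xi>)"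
    by (rule partial_bounded_linear[OF bounded_linear_mult_right diff]) (use xyxi in auto)
  finally have *: "partial (S b) f (x, y, s *\<^sub>R \<xi>) = s powr m * partial b f (x, y, \<xi>)" by (simp add: S_def)
  have "partial (S b) f (x, y, s *\<^sub>R \<xi>) = s powr order_gain 1 0 b * partial b f (x, y, s *\<^sub>R \<xi>)"
    using b
  proof (cases rule: Basis_pt_cases)
    case (xi i)
    then have "S b = s *\<^sub>R b" by (simp add: S_def dir_xi_def)
    moreover have "linear (frechet_derivative f (at (x, y, s *\<^sub>R \<xi>)))"
      using d by (rule linear_frechet_derivative)
    ultimately show ?thesis using d xyxi xi by (simp add: partial_eq_frechet linear_scale)
  qed (use xyxi in \<open>simp_all add: S_def dir_x_def dir_y_def order_gain_def\<close>)
  with * show ?thesis using xyxi by (simp add: powr_diff field_simps)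
qed

lemma homogeneous_word_partial:
  fixes f :: "('x::finite, 'y::finite, 'k::finite) pt \<Rightarrow> real"
  assumes "open X" "open Y" and f: "f \<in> phases_hg X Y" and ws: "set ws \<subseteq> Basis"
    and xyxi: "x \<in> X" "y \<in> Y" "\<xi> \<in> Xi" "s > 0"
  shows "word_partial ws f (x, y, s *\<^sub>R \<xi>)
    = s powr (1 - word_gain 1 0 ws) * word_partial ws f (x, y, \<xi>)"
  using ws xyxi
proof (induction ws arbitrary: x y \<xi> s)
  case Nil then show ?case using f by (auto simp: phases_hg_def)
next
  case (Cons b ws)
  have "partial b (word_partial ws f) (x, y, s *\<^sub>R \<xi>)
     = s powr (1 - word_gain 1 0 ws - order_gain 1 0 b) * partial b (word_partial ws f) (x, y, \<xi>)"
  proof (rule homogeneous_partial[OF assms(1,2)])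
    show "word_partial ws f differentiable (at z)" if "z \<in> X \<times> Y \<times> Xi" for z
      using f Cons.prems(1) that by (intro smooth_onD(1)[OF smooth_on_word_partial]) (auto simp: phases_hg_def)
  qed (use Cons in auto)
  then show ?case by (simp add: algebra_simps)
qed

text \<open>
  By homogeneity it suffices to bound the derivative on the unit sphere, where it is a continuous
  function on a compact set.
\<close>

lemma phase_derivative_bound:
  fixes f :: "('x::finite, 'y::finite, 'k::finite) pt \<Rightarrow> real"
  assumes "open X" "open Y" and f: "f \<in> phases_hg X Y" and ws: "set ws \<subseteq> Basis"
    and K: "compact K" "K \<subseteq> X \<times> Y"
  obtains C where "\<And>x y \<xi>. (x, y) \<in> K \<Longrightarrow> \<xi> \<in> Xi \<Longrightarrow>
    \<bar>word_partial ws f (x, y, \<xi>)\<bar> \<le> C * norm \<xi> powr (1 - word_gain 1 0 ws)"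
proof -
  let ?m = "1 - word_gain 1 0 ws"
  let ?Q = "(\<lambda>((x, y), \<xi>). (x, y, \<xi>)) ` (K \<times> sphere 0 1) :: ('x, 'y, 'k) pt set"
  have Q: "compact ?Q"
    using K by (intro compact_continuous_image compact_Times) (auto simp: split_beta intro!: continuous_intros)
  have sub: "?Q \<subseteq> X \<times> Y \<times> Xi" using K(2) by (force simp: Xi_def)
  have "continuous_on (X \<times> Y \<times> Xi) (word_partial ws f)"
    using f ws by (intro smooth_onD(3) smooth_on_word_partial) (auto simp: phases_hg_def)
  then have "bounded (word_partial ws f ` ?Q)"
    using compact_imp_bounded[OF compact_continuous_image[OF continuous_on_subset[OF _ sub] Q]] by blast
  then obtain C where "\<forall>v\<in>word_partial ws f ` ?Q. norm v \<le> C"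
    unfolding bounded_iff by (elim exE)
  then have C: "\<And>z. z \<in> ?Q \<Longrightarrow> \<bar>word_partial ws f z\<bar> \<le> C"
    unfolding real_norm_def by (rule bspec) (rule imageI)
  have "\<bar>word_partial ws f (x, y, \<xi>)\<bar> \<le> C * norm \<xi> powr ?m" if "(x, y) \<in> K" "\<xi> \<in> Xi" for x y \<xi>
  proof -
    have nz: "\<xi> \<noteq> 0" using that by (simp add: Xi_def)
    \<comment> \<open>The projection of \<open>\<xi>\<close> to the unit sphere.\<close>
    define u where "u = inverse (norm \<xi>) *\<^sub>R \<xi>"
    have u: "norm u = 1" "u \<in> Xi" "norm \<xi> *\<^sub>R u = \<xi>" using nz by (auto simp: u_def Xi_def)
    have "word_partial ws f (x, y, norm \<xi> *\<^sub>R u) = norm \<xi> powr ?m * word_partial ws f (x, y, u)"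
      by (rule homogeneous_word_partial[OF assms(1-3) ws]) (use that K(2) u nz in auto)
    moreover have "\<bar>word_partial ws f (x, y, u)\<bar> \<le> C"
      using that u by (intro C) (auto intro!: image_eqI[of _ _ "((x, y), u)"])
    ultimately show ?thesis
      unfolding u(3) by (simp add: abs_mult mult.commute mult_right_mono)
  qed
  then show thesis by (rule that)
qed

section \<open>Exhaustions by compact sets\<close>

lemma compact_exhaust:
  assumes "open Z"
  shows "compact (exhaust Z m)" and "exhaust Z m \<subseteq> Z"
proof -
  show "exhaust Z m \<subseteq> Z" by (auto simp: exhaust_def)
  show "compact (exhaust Z m)"
  proof (cases "Z = UNIV \<or> m = 0")
    case True
    then show ?thesis
    proof
      assume "Z = UNIV"
      then have "exhaust Z m = cball 0 (real m)" by (auto simp: exhaust_def)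
      then show ?thesis by simp
    next
      assume "m = 0"
      then have "exhaust Z m \<subseteq> {0}" by (auto simp: exhaust_def)
      then show ?thesis by (meson finite.emptyI finite_insert finite_imp_compact finite_subset)
    qed
  next
    case False
    then have "- Z \<noteq> {}" "m > 0" by auto
    have "x \<in> Z" if "1 / real m \<le> infdist x (- Z)" for x
    proof (rule ccontr)
      assume "x \<notin> Z"
      then have "infdist x (- Z) = 0" by (intro infdist_zero) simp
      with that \<open>m > 0\<close> show False by simp
    qed
    then have "exhaust Z m = cball 0 (real m) \<inter> {x. 1 / real m \<le> infdist x (- Z)}"
      using False by (auto simp: exhaust_def)
    moreover have "closed {x. 1 / real m \<le> infdist x (- Z)}"
      by (intro closed_Collect_le continuous_intros)
    ultimately show ?thesis by (simp add: compact_Int_closed)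
  qed
qed

lemma compact_subset_exhaust:
  assumes "open Z" "compact K" "K \<subseteq> Z"
  obtains N where "\<And>m. m \<ge> N \<Longrightarrow> K \<subseteq> exhaust Z m"
proof -
  obtain B where B: "\<And>x. x \<in> K \<Longrightarrow> norm x \<le> B"
    using compact_imp_bounded[OF assms(2)] by (auto simp: bounded_iff)
  obtain e where e: "e > 0" "\<And>x. x \<in> K \<Longrightarrow> Z = UNIV \<or> e \<le> infdist x (- Z)"
  proof (cases "Z = UNIV \<or> K = {}")
    case True then show thesis using that[of 1] by auto
  next
    case False
    then have "- Z \<noteq> {}" "K \<noteq> {}" by auto
    have "continuous_on K (\<lambda>x. infdist x (- Z))" by (intro continuous_intros)
    then obtain x0 where x0: "x0 \<in> K" "\<And>x. x \<in> K \<Longrightarrow> infdist x0 (- Z) \<le> infdist x (- Z)"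
      using continuous_attains_inf[OF assms(2) \<open>K \<noteq> {}\<close>] by blast
    have "x0 \<notin> closure (- Z)" using x0(1) assms by (auto simp: closed_open closure_closed)
    then have "infdist x0 (- Z) > 0"
      using \<open>- Z \<noteq> {}\<close> by (metis in_closure_iff_infdist_zero infdist_nonneg less_eq_real_def)
    then show thesis using that x0(2) by blast
  qed
  obtain N where N: "max B (1 / e) \<le> real N" using real_arch_simple by blast
  have "K \<subseteq> exhaust Z m" if "m \<ge> N" for m
  proof
    fix x assume x: "x \<in> K"
    have m: "B \<le> real m" "1 / e \<le> real m" using N that by simp_all
    have "0 < 1 / e" using e(1) by simp
    then have "0 < real m" using m(2) by linarith
    then have "1 / real m \<le> e" using e(1) m(2) by (simp add: field_simps)
    then show "x \<in> exhaust Z m" using x B[OF x] e(2)[OF x] m(1) assms(3) by (auto simp: exhaust_def)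
  qed
  then show thesis by (rule that)
qed

section \<open>Sequences as families\<close>

definition seq_param :: "nat \<Rightarrow> real" where
  "seq_param n = inverse (real (Suc n))"

definition seq_params :: "real set" where
  "seq_params = insert 0 (range seq_param)"

lemma seq_param_pos: "seq_param n > 0"
  by (simp add: seq_param_def)

lemma inj_seq_param: "seq_param m = seq_param n \<longleftrightarrow> m = n"
  by (simp add: seq_param_def)

lemma seq_param_tendsto: "seq_param \<longlonglongrightarrow> 0"
  unfolding seq_param_def[abs_def] by (rule LIMSEQ_inverse_real_of_nat)

lemma compact_seq_params: "compact seq_params"
  unfolding seq_params_def by (rule compact_sequence_with_limit[OF seq_param_tendsto])

lemma seq_param_isolated:
  obtains e where "e > 0" "\<And>s. s \<in> seq_params \<Longrightarrow> dist s (seq_param n) < e \<Longrightarrow> s = seq_param n"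
proof -
  have "\<not> seq_param n islimpt seq_params"
  proof
    assume "seq_param n islimpt seq_params"
    then have "seq_param n islimpt (range seq_param)"
      by (simp add: seq_params_def islimpt_insert)
    then have "seq_param n = 0" by (rule sequence_unique_limpt[OF seq_param_tendsto])
    then show False using seq_param_pos[of n] by simp
  qed
  then show thesis using that unfolding islimpt_approachable by metis
qed

text \<open>
  Every parameter other than 0 is isolated, so only continuity at 0 has content, and there it is
  locally uniform convergence to a continuous limit.
\<close>

lemma continuous_on_sequence_family:
  fixes F :: "real \<Rightarrow> 'a::metric_space \<Rightarrow> 'b::metric_space"
  assumes cont: "\<And>t. t \<in> seq_params \<Longrightarrow> continuous_on S (F t)"
    and conv: "\<And>z e. z \<in> S \<Longrightarrow> e > 0 \<Longrightarrow> \<exists>r>0. \<exists>N. \<forall>n\<ge>N. \<forall>w\<in>S. dist w z < r \<longrightarrow> dist (F (seq_param n) w) (F 0 w) < e"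
  shows "continuous_on (seq_params \<times> S) (\<lambda>(t, z). F t z)"
  unfolding continuous_on_iff
proof (intro ballI allI impI)
  fix p e assume p: "p \<in> seq_params \<times> S" and e: "(e::real) > 0"
  obtain t z where tz: "p = (t, z)" "t \<in> seq_params" "z \<in> S" using p by auto
  obtain r0 where r0: "r0 > 0" "\<And>w. w \<in> S \<Longrightarrow> dist w z < r0 \<Longrightarrow> dist (F t w) (F t z) < e / 2"
    using cont[OF tz(2)] tz(3) e unfolding continuous_on_iff by (metis half_gt_zero)
  have "\<exists>r>0. \<forall>s\<in>seq_params. \<forall>w\<in>S. dist s t < r \<longrightarrow> dist w z < r \<longrightarrow> dist (F s w) (F t z) < e"
  proof (cases "t = 0")
    case False
    then obtain n where n: "t = seq_param n" using tz(2) by (auto simp: seq_params_def)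
    obtain r1 where "r1 > 0" "\<And>s. s \<in> seq_params \<Longrightarrow> dist s t < r1 \<Longrightarrow> s = t"
      using seq_param_isolated[of n] n by metis
    then show ?thesis using r0 e by (intro exI[of _ "min r0 r1"]) fastforce
  next
    case True
    obtain r1 N where r1: "r1 > 0" "\<And>n w. n \<ge> N \<Longrightarrow> w \<in> S \<Longrightarrow> dist w z < r1 \<Longrightarrow> dist (F (seq_param n) w) (F 0 w) < e / 2"
      using conv[OF tz(3), of "e / 2"] e by fastforce
    have "dist (F s w) (F t z) < e"
      if s: "s \<in> seq_params" "dist s t < seq_param N" and w: "w \<in> S" "dist w z < min r0 r1" for s w
    proof (cases "s = 0")
      case True then show ?thesis using r0(2)[OF w(1)] w(2) \<open>t = 0\<close> e by simp
    next
      case False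
      then obtain n where n: "s = seq_param n" using s(1) by (auto simp: seq_params_def)
      then have "seq_param n < seq_param N" using s(2) \<open>t = 0\<close> seq_param_pos[of n] by (simp add: dist_real_def)
      then have "N \<le> n" by (simp add: seq_param_def field_simps)
      then have "dist (F s w) (F 0 w) < e / 2" using r1(2)[of n w] w n by simp
      moreover have "dist (F 0 w) (F t z) < e / 2" using r0(2)[OF w(1)] w(2) \<open>t = 0\<close> by simp
      ultimately show ?thesis using dist_triangle[of "F s w" "F t z" "F 0 w"] by simp
    qed
    then show ?thesis using r0(1) r1(1) seq_param_pos[of N]
      by (intro exI[of _ "min (seq_param N) (min r0 r1)"]) auto
  qed
  then obtain r where r: "r > 0" "\<And>s w. s \<in> seq_params \<Longrightarrow> w \<in> S \<Longrightarrow> dist s t < r \<Longrightarrow> dist w z < r \<Longrightarrow> dist (F s w) (F t z) < e"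
    by blast
  have "dist (case q of (s, w) \<Rightarrow> F s w) (case p of (t, z) \<Rightarrow> F t z) < e"
    if "q \<in> seq_params \<times> S" "dist q p < r" for q
  proof -
    obtain s w where q: "q = (s, w)" by force
    have "dist s t < r" "dist w z < r"
      using that(2) dist_fst_le[of q p] dist_snd_le[of q p] by (simp_all add: q tz(1))
    then show ?thesis using r(2)[of s w] that(1) by (simp add: q tz(1))
  qed
  then show "\<exists>d>0. \<forall>q\<in>seq_params \<times> S. dist q p < d \<longrightarrow>
      dist (case q of (s, w) \<Rightarrow> F s w) (case p of (t, z) \<Rightarrow> F t z) < e"
    using r(1) by blast
qed

text \<open>
  Far along the sequence the bound of the limit serves, and only finitely many members remain.
\<close>

lemma uniform_bound_sequence_family:
  fixes F :: "real \<Rightarrow> 'a \<Rightarrow> 'b::real_normed_vector"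
  assumes nn: "\<And>z. z \<in> P \<Longrightarrow> 0 \<le> \<nu> z"
    and each: "\<And>t. t \<in> seq_params \<Longrightarrow> \<exists>C. \<forall>z\<in>P. norm (F t z) \<le> C * \<nu> z"
    and conv: "\<exists>N. \<forall>n\<ge>N. \<forall>z\<in>P. norm (F (seq_param n) z - F 0 z) \<le> seq_param n * \<nu> z"
  shows "\<exists>C. \<forall>t\<in>seq_params. \<forall>z\<in>P. norm (F t z) \<le> C * \<nu> z"
proof -
  obtain C where C: "\<And>t z. t \<in> seq_params \<Longrightarrow> z \<in> P \<Longrightarrow> norm (F t z) \<le> C t * \<nu> z"
    using each by metis
  obtain N where N: "\<And>n z. n \<ge> N \<Longrightarrow> z \<in> P \<Longrightarrow> norm (F (seq_param n) z - F 0 z) \<le> seq_param n * \<nu> z"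
    using conv by blast
  \<comment> \<open>The summand 1 pays for the distance to the limit, as \<open>1 / (n + 1) \<le> 1\<close>.\<close>
  define D where "D = (\<Sum>n<N. \<bar>C (seq_param n)\<bar>) + \<bar>C 0\<bar> + 1"
  have "norm (F t z) \<le> D * \<nu> z" if t: "t \<in> seq_params" and z: "z \<in> P" for t z
  proof -
    have z0: "norm (F 0 z) \<le> \<bar>C 0\<bar> * \<nu> z"
      using C[of 0 z] z mult_right_mono[OF abs_ge_self nn[OF z], of "C 0"] by (simp add: seq_params_def)
    consider "t = 0" | n where "t = seq_param n" "n < N" | n where "t = seq_param n" "n \<ge> N"
      using t by (fastforce simp: seq_params_def)
    then show ?thesis
    proof cases
      case 1
      have "\<bar>C 0\<bar> * \<nu> z \<le> D * \<nu> z"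
        unfolding D_def by (intro mult_right_mono nn z) (simp add: sum_nonneg)
      then show ?thesis using z0 1 by simp
    next
      case 2
      have "C t \<le> \<bar>C (seq_param n)\<bar>" using 2 by simp
      also have "\<dots> \<le> (\<Sum>n<N. \<bar>C (seq_param n)\<bar>)" using 2 by (intro member_le_sum) auto
      also have "\<dots> \<le> D" by (simp add: D_def)
      finally have "C t * \<nu> z \<le> D * \<nu> z" by (intro mult_right_mono nn z)
      then show ?thesis using C[OF t z] by simp
    next
      case 3
      have "seq_param n \<le> 1" by (simp add: seq_param_def field_simps)
      have "norm (F t z) \<le> norm (F 0 z) + norm (F t z - F 0 z)"
        using norm_triangle_ineq[of "F 0 z" "F t z - F 0 z"] by simp
      also have "\<dots> \<le> \<bar>C 0\<bar> * \<nu> z + 1 * \<nu> z"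
        using z0 N[OF 3(2) z] 3(1) mult_right_mono[OF \<open>seq_param n \<le> 1\<close> nn[OF z]] by simp
      also have "\<dots> = (\<bar>C 0\<bar> + 1) * \<nu> z" by (simp add: distrib_right)
      also have "\<dots> \<le> D * \<nu> z"
        unfolding D_def by (intro mult_right_mono nn z) (simp add: sum_nonneg)
      finally show ?thesis .
    qed
  qed
  then show ?thesis by blast
qed

section \<open>The operator L on symbol families\<close>

definition fsupp :: "('a::topological_space \<Rightarrow> 'b::zero) \<Rightarrow> 'a set" where
  "fsupp f = closure {x. f x \<noteq> 0}"

lemma fsupp_outside: "x \<notin> fsupp f \<Longrightarrow> f x = 0"
  using closure_subset[of "{x. f x \<noteq> 0}"] by (auto simp: fsupp_def)

text \<open>
  The sets on which estimates are uniform: \<open>x\<close> ranges over any compact subset of \<open>X\<close>, \<open>y\<close> over the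
  fixed set \<open>L\<close>, which will be the support of the test function, and \<open>\<xi>\<close> over \<open>R\<close>.
\<close>

definition slabs :: "(real^'x::finite) set \<Rightarrow> (real^'y::finite) set \<Rightarrow> (real^'k::finite) set \<Rightarrow> ('x, 'y, 'k) pt set set" where
  "slabs X L R = {K \<times> L \<times> R | K. compact K \<and> K \<subseteq> X}"

lemma slabsI: "compact K \<Longrightarrow> K \<subseteq> X \<Longrightarrow> K \<times> L \<times> R \<in> slabs X L R"
  by (auto simp: slabs_def)

lemma (in symbol_calculus) symbolI:
  assumes "symbol0 \<P> m F" "\<And>t z. t \<in> T \<Longrightarrow> z \<in> \<Omega> \<Longrightarrow> F t differentiable (at z)"
    and "\<And>b. b \<in> W \<Longrightarrow> symbol \<P> W \<omega> (m - \<omega> b) (\<lambda>t. partial b (F t))"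
  shows "symbol \<P> W \<omega> m F"
  unfolding symbol_def
proof
  fix n show "symbol_upto n \<P> W \<omega> m F"
    using assms by (cases n) (auto simp: symbol_def)
qed

lemma (in symbol_calculus) symbol_symbol0: "symbol \<P> W \<omega> m F \<Longrightarrow> symbol0 \<P> m F"
  by (meson symbol_def symbol_upto_0)

lemma differentiable_compose_linear:
  fixes h :: "'a::euclidean_space \<Rightarrow> 'b::euclidean_space"
  assumes "f differentiable (at (h z))" "linear h"
  shows "(\<lambda>z. f (h z)) differentiable (at z)"
  by (rule differentiable_compose[where f = f and g = h])
    (use assms in \<open>simp_all add: linear_imp_differentiable\<close>)

text \<open>
  A derivative of \<open>f \<circ> h\<close> is again of this form, with \<open>f\<close> replaced by one of its derivatives, because
  \<open>h\<close> is linear.  The predicate \<open>Q\<close> carries what is known about \<open>f\<close> through this recursion.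
\<close>

lemma (in symbol_calculus) symbol_pullback:
  fixes h :: "'a \<Rightarrow> 'c::euclidean_space" and f :: "'c \<Rightarrow> 'b::real_normed_vector"
  assumes h: "linear h" and Q: "Q m f"
    and smooth: "\<And>m f. Q m f \<Longrightarrow> smooth_on UNIV f"
    and base: "\<And>m f. Q m f \<Longrightarrow> symbol0 \<P> m (\<lambda>t z. f (h z))"
    and step: "\<And>m f b. Q m f \<Longrightarrow> b \<in> W \<Longrightarrow> h b \<noteq> 0 \<Longrightarrow> Q (m - \<omega> b) (partial (h b) f)"
  shows "symbol \<P> W \<omega> m (\<lambda>t z. f (h z))"
proof -
  have "symbol_upto n \<P> W \<omega> m (\<lambda>t z. f (h z))" if "Q m f" for n m f
    using that
  proof (induction n arbitrary: m f)
    case 0 then show ?case by (simp add: base)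
  next
    case (Suc n)
    have eq: "partial b (\<lambda>z. f (h z)) = (\<lambda>z. partial (h b) f (h z))" for b
      using h by (intro ext partial_compose_linear)
    have "symbol_upto n \<P> W \<omega> (m - \<omega> b) (\<lambda>t. partial b (\<lambda>z. f (h z)))" if "b \<in> W" for b
    proof (cases "h b = 0")
      case True then show ?thesis by (simp add: eq symbol_upto_zero)
    next
      case False show ?thesis unfolding eq by (rule Suc.IH[OF step[OF Suc.prems that False]])
    qed
    moreover have "(\<lambda>z. f (h z)) differentiable (at z)" for z
      by (rule differentiable_compose_linear[OF smooth_onD(1)[OF smooth[OF Suc.prems] UNIV_I] h])
    ultimately show ?case using base[OF Suc.prems] by simp
  qed
  then show ?thesis using Q by (simp add: symbol_def)
qed

lemma partial_zero_on_open:
  assumes "open U" "z \<in> U" "\<And>w. w \<in> U \<Longrightarrow> f w = 0"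
  shows "partial v f z = 0"
  using partial_cong_open[OF assms(1,2), of f "\<lambda>_. 0"] assms(3) by simp

text \<open>
  A family of phase functions and amplitudes.  Derivatives of a phase function are of symbol type
  only away from \<open>\<xi> = 0\<close>, where \<open>\<partial>\<^sub>\<xi>\<^sup>2\<Phi>\<close> is unbounded.  Derivatives in \<open>x\<close> alone are homogeneous of
  degree 1 and hence bounded near \<open>\<xi> = 0\<close>; they are needed there because the factor \<open>e\<^bsup>i\<Phi>\<^esup>\<close> is
  not cut off.
\<close>

locale oscillatory_family =
  symbol_calculus T "X \<times> Y \<times> (Xi :: (real^'k::finite) set)" "\<lambda>z. japanese (snd (snd z))"
  for T :: "real set" and X :: "(real^'x::finite) set" and Y :: "(real^'y::finite) set" +
  fixes \<alpha> d \<delta> \<rho> :: real and \<eta> :: "real^'k \<Rightarrow> complex" and \<psi> :: "real^'y \<Rightarrow> complex"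
    and \<Phi> :: "real \<Rightarrow> ('x, 'y, 'k) pt \<Rightarrow> real" and a :: "real \<Rightarrow> ('x, 'y, 'k) pt \<Rightarrow> complex"
  assumes open_X: "open X" and open_Y: "open Y"
    and alpha_pos: "\<alpha> > 0" and delta: "0 \<le> \<delta>" "\<delta> < 1" and rho: "0 < \<rho>" "\<rho> \<le> 1"
    and cutoff: "cutoff \<eta>" and test: "\<psi> \<in> test_functions Y"
    and phase: "\<And>t. t \<in> T \<Longrightarrow> \<Phi> t \<in> phases \<alpha> X Y"
    and phase_far: "symbol (slabs X (fsupp \<psi>) {\<xi>. 1 \<le> norm \<xi>}) Basis (order_gain 1 0) 1 \<Phi>"
    and phase_x: "symbol (slabs X (fsupp \<psi>) Xi) (range dir_x) (order_gain 1 0) 1 \<Phi>"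
    and amplitude: "symbol (slabs X (fsupp \<psi>) Xi) Basis (order_gain \<rho> \<delta>) d a"
begin

abbreviation "far \<equiv> slabs X (fsupp \<psi>) {\<xi>::real^'k. 1 \<le> norm \<xi>}"
abbreviation "all \<equiv> slabs X (fsupp \<psi>) (Xi :: (real^'k) set)"
abbreviation "gain \<equiv> order_gain \<rho> \<delta> :: ('x, 'y, 'k) pt \<Rightarrow> real"
abbreviation "gain1 \<equiv> order_gain 1 0 :: ('x, 'y, 'k) pt \<Rightarrow> real"

lemma support: "compact (fsupp \<psi>)" "fsupp \<psi> \<subseteq> Y" "closed (fsupp \<psi>)"
  using test by (auto simp: fsupp_def test_functions_def)

lemma gain_le: "gain b \<le> gain1 b"
  using delta rho by (simp add: order_gain_def)

text \<open>
  A smooth function of \<open>\<xi>\<close> with bounded support has every order.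
\<close>

lemma symbol_cutoff_like:
  fixes f :: "real^'k \<Rightarrow> 'c::real_normed_vector"
  assumes "smooth_on UNIV f" "\<And>\<xi>. norm \<xi> > 2 \<Longrightarrow> f \<xi> = 0"
  shows "symbol \<P> Basis gain1 m (\<lambda>t z. f (snd (snd z)))"
proof (rule symbol_pullback[where h = "\<lambda>z. snd (snd z)"
      and Q = "\<lambda>_ f. smooth_on UNIV f \<and> (\<forall>\<xi>. norm \<xi> > 2 \<longrightarrow> f \<xi> = 0)"])
  show "linear (\<lambda>z :: ('x, 'y, 'k) pt. snd (snd z))" by (simp add: linear_iff)
  show "smooth_on UNIV f \<and> (\<forall>\<xi>. norm \<xi> > 2 \<longrightarrow> f \<xi> = 0)" using assms by simp
  fix m :: real and f :: "real^'k \<Rightarrow> 'c" assume f: "smooth_on UNIV f \<and> (\<forall>\<xi>. norm \<xi> > 2 \<longrightarrow> f \<xi> = 0)"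
  then show "smooth_on UNIV f" by simp
  then have cf: "continuous_on UNIV f" by (rule smooth_onD(3))
  let ?g = "\<lambda>\<xi>. norm (f \<xi>) * japanese \<xi> powr (- m)"
  have "continuous_on (cball 0 2) ?g"
    using continuous_on_subset[OF cf] japanese_ne_0 by (intro continuous_intros) auto
  then have "bounded (?g ` cball 0 2)"
    by (intro compact_imp_bounded compact_continuous_image) auto
  then obtain C where C: "\<And>\<xi>. \<xi> \<in> cball 0 2 \<Longrightarrow> norm (?g \<xi>) \<le> C"
    unfolding bounded_iff by blast
  have "norm (f \<xi>) \<le> C * japanese \<xi> powr m" for \<xi>
  proof (cases "norm \<xi> \<le> 2")
    case True
    have "norm (f \<xi>) = ?g \<xi> * japanese \<xi> powr m"
      using japanese_ne_0[of \<xi>] by (simp add: powr_add[symmetric])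
    also have "\<dots> \<le> C * japanese \<xi> powr m"
      using C[of \<xi>] True by (intro mult_right_mono) auto
    finally show ?thesis .
  next
    case False
    have "0 \<le> C" using order_trans[OF norm_ge_zero C[of 0]] by simp
    then show ?thesis using f False by simp
  qed
  moreover have "continuous_on (T \<times> X \<times> Y \<times> Xi) (\<lambda>(t, z). f (snd (snd z)))"
    unfolding split_beta by (intro continuous_on_compose2[OF cf] continuous_intros) auto
  ultimately show "symbol0 \<P> m (\<lambda>t z. f (snd (snd z)))" by (auto simp: symbol0_def)
  fix b :: "('x, 'y, 'k) pt" assume b: "b \<in> Basis" "snd (snd b) \<noteq> 0"
  then have "snd (snd b) \<in> Basis" by (auto simp: Basis_prod_def)
  moreover have "open {\<xi> :: real^'k. norm \<xi> > 2}" by (intro open_Collect_less continuous_intros)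
  then have "partial (snd (snd b)) f \<xi> = 0" if "norm \<xi> > 2" for \<xi>
    by (rule partial_zero_on_open) (use that f in auto)
  ultimately show "smooth_on UNIV (partial (snd (snd b)) f) \<and>
      (\<forall>\<xi>. norm \<xi> > 2 \<longrightarrow> partial (snd (snd b)) f \<xi> = 0)"
    using f by (auto intro: smooth_onD(2))
qed

lemma symbol_test_like:
  fixes f :: "real^'y \<Rightarrow> 'c::real_normed_vector"
  assumes "smooth_on UNIV f" "0 \<le> m"
  shows "symbol (slabs X (fsupp \<psi>) R) Basis gain m (\<lambda>t z. f (fst (snd z)))"
proof (rule symbol_pullback[where h = "\<lambda>z. fst (snd z)" and Q = "\<lambda>m f. smooth_on UNIV f \<and> 0 \<le> m"])
  show "linear (\<lambda>z :: ('x, 'y, 'k) pt. fst (snd z))" by (simp add: linear_iff)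
  show "smooth_on UNIV f \<and> 0 \<le> m" using assms by simp
  fix m :: real and f :: "real^'y \<Rightarrow> 'c" assume f: "smooth_on UNIV f \<and> 0 \<le> m"
  then show "smooth_on UNIV f" by simp
  then have cf: "continuous_on UNIV f" by (rule smooth_onD(3))
  have "bounded (f ` fsupp \<psi>)"
    using continuous_on_subset[OF cf] support by (intro compact_imp_bounded compact_continuous_image) auto
  then obtain C where C: "\<And>y. y \<in> fsupp \<psi> \<Longrightarrow> norm (f y) \<le> C"
    unfolding bounded_iff by blast
  have "norm (f y) \<le> \<bar>C\<bar> * japanese \<xi> powr m" if "y \<in> fsupp \<psi>" for y and \<xi> :: "real^'k"
  proof -
    have "\<bar>C\<bar> * 1 \<le> \<bar>C\<bar> * japanese \<xi> powr m"
      using f japanese_ge_1 by (intro mult_left_mono ge_one_powr_ge_zero) auto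
    then show ?thesis using C[OF that] by simp
  qed
  moreover have "continuous_on (T \<times> X \<times> Y \<times> Xi) (\<lambda>(t, z). f (fst (snd z)))"
    unfolding split_beta by (intro continuous_on_compose2[OF cf] continuous_intros) auto
  ultimately show "symbol0 (slabs X (fsupp \<psi>) R) m (\<lambda>t z. f (fst (snd z)))"
    by (fastforce simp: symbol0_def slabs_def)
  fix b :: "('x, 'y, 'k) pt" assume b: "b \<in> Basis" "fst (snd b) \<noteq> 0"
  then have "fst (snd b) \<in> Basis" "gain b = - \<delta>" by (auto simp: Basis_prod_def order_gain_def)
  then show "smooth_on UNIV (partial (fst (snd b)) f) \<and> 0 \<le> m - gain b"
    using f delta by (auto intro: smooth_onD(2))
qed

lemma symbol_xi_component: "symbol \<P> Basis gain1 1 (\<lambda>t z. snd (snd z) $ l)"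
proof (rule symbolI)
  have "\<bar>\<xi> $ l\<bar> \<le> 1 * japanese \<xi> powr 1" for \<xi> :: "real^'k"
    using order_trans[OF component_le_norm_cart norm_le_japanese] japanese_pos[of \<xi>] by simp
  then show "symbol0 \<P> 1 (\<lambda>t z. snd (snd z) $ l)"
    unfolding symbol0_def real_norm_def split_beta by (intro conjI ballI exI[of _ 1] continuous_intros) auto
  have lin: "linear (\<lambda>z :: ('x, 'y, 'k) pt. snd (snd z) $ l)" by (simp add: linear_iff)
  then show "(\<lambda>z :: ('x, 'y, 'k) pt. snd (snd z) $ l) differentiable (at z)" for z
    by (rule linear_imp_differentiable)
  fix b :: "('x, 'y, 'k) pt" assume "b \<in> Basis"
  have "partial b (\<lambda>z. snd (snd z) $ l) = (\<lambda>z. snd (snd b) $ l)"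
    using lin by (intro ext partial_eq_derivative linear_imp_has_derivative)
  then show "symbol \<P> Basis gain1 (1 - gain1 b) (\<lambda>t. partial b (\<lambda>z. snd (snd z) $ l))"
    by (simp add: symbol_const order_gain_def)
qed

lemma symbol_norm_xi_sq: "symbol \<P> Basis gain1 2 (\<lambda>t z. (norm (snd (snd z)))\<^sup>2)"
proof -
  have "symbol \<P> Basis gain1 2 (\<lambda>t z. \<Sum>l\<in>UNIV. snd (snd z) $ l * snd (snd z) $ l)"
    using symbol_mult[OF symbol_xi_component symbol_xi_component] by (intro symbol_sum) auto
  then show ?thesis by (simp add: power2_norm_eq_inner inner_vec_def)
qed

lemma symbol_cutoff: "symbol \<P> Basis gain1 m (\<lambda>t z. \<eta> (snd (snd z)))"
  using cutoff by (intro symbol_cutoff_like) (auto simp: cutoff_def test_functions_def)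

lemma cutoff_one: "norm \<xi> < 1 \<Longrightarrow> \<eta> \<xi> = 1"
  using cutoff by (simp add: cutoff_def)

lemma symbol_phase_xi: "symbol far Basis gain1 0 (\<lambda>t. partial (dir_xi l) (\<Phi> t))"
  using symbolD(4)[OF phase_far, of "dir_xi l"] by simp

lemma symbol_phase_y: "symbol far Basis gain1 1 (\<lambda>t. partial (dir_y k) (\<Phi> t))"
  using symbolD(4)[OF phase_far, of "dir_y k"] by simp

lemma osc_r_eq:
  "osc_r \<phi> = (\<lambda>z. (norm (snd (snd z)))\<^sup>2 * (\<Sum>l\<in>UNIV. partial (dir_xi l) \<phi> z * partial (dir_xi l) \<phi> z)
     + (\<Sum>k\<in>UNIV. partial (dir_y k) \<phi> z * partial (dir_y k) \<phi> z))"
  by (auto simp: osc_r_def grad_xi_def grad_y_def power2_norm_eq_inner inner_vec_def)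

lemma symbol_osc_r: "symbol far Basis gain1 2 (\<lambda>t. osc_r (\<Phi> t))"
proof -
  have xi: "symbol far Basis gain1 0 (\<lambda>t z. \<Sum>l\<in>UNIV. partial (dir_xi l) (\<Phi> t) z * partial (dir_xi l) (\<Phi> t) z)"
    using symbol_mult[OF symbol_phase_xi symbol_phase_xi] by (intro symbol_sum) auto
  have y: "symbol far Basis gain1 2 (\<lambda>t z. \<Sum>k\<in>UNIV. partial (dir_y k) (\<Phi> t) z * partial (dir_y k) (\<Phi> t) z)"
    using symbol_mult[OF symbol_phase_y symbol_phase_y] by (intro symbol_sum) auto
  show ?thesis
    unfolding osc_r_eq using symbol_mult[OF symbol_norm_xi_sq xi] y by (intro symbol_add) simp_all
qed

text \<open>
  This is the second of the two lower bounds on the gradient, multiplied by \<open>\<parallel>\<xi>\<parallel>\<^sup>2\<close>.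
\<close>

lemma osc_r_lower:
  assumes "t \<in> T" "z \<in> X \<times> Y \<times> Xi"
  shows "\<alpha> * (norm (snd (snd z)))\<^sup>2 \<le> osc_r (\<Phi> t) z" and "osc_r (\<Phi> t) z \<noteq> 0"
proof -
  obtain x y \<xi> where z: "z = (x, y, \<xi>)" "x \<in> X" "y \<in> Y" "\<xi> \<in> Xi" using assms(2) by auto
  then have nz: "(norm \<xi>)\<^sup>2 > 0" by (simp add: Xi_def)
  have "\<alpha> \<le> (norm (grad_y (\<Phi> t) z))\<^sup>2 / (norm \<xi>)\<^sup>2 + (norm (grad_xi (\<Phi> t) z))\<^sup>2"
    using phase[OF assms(1)] z by (auto simp: phases_def)
  then have "\<alpha> * (norm \<xi>)\<^sup>2 \<le> ((norm (grad_y (\<Phi> t) z))\<^sup>2 / (norm \<xi>)\<^sup>2 + (norm (grad_xi (\<Phi> t) z))\<^sup>2) * (norm \<xi>)\<^sup>2"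
    using nz by (intro mult_right_mono) auto
  also have "\<dots> = osc_r (\<Phi> t) z" using nz by (simp add: osc_r_def z field_simps)
  finally show 1: "\<alpha> * (norm (snd (snd z)))\<^sup>2 \<le> osc_r (\<Phi> t) z" by (simp add: z)
  have "0 < \<alpha> * (norm (snd (snd z)))\<^sup>2" using nz alpha_pos by (simp add: z)
  with 1 show "osc_r (\<Phi> t) z \<noteq> 0" by linarith
qed

lemma symbol_osc_r_inverse: "symbol far Basis gain1 (- 2) (\<lambda>t z. inverse (osc_r (\<Phi> t) z))"
proof (rule symbol_inverse[OF symbol_osc_r osc_r_lower(2)])
  fix P assume P: "P \<in> far"
  have "\<alpha> / 4 * japanese (snd (snd z)) powr 2 \<le> norm (osc_r (\<Phi> t) z)"
    if "t \<in> T" "z \<in> P \<inter> (X \<times> Y \<times> Xi)" for t z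
  proof -
    have "1 \<le> norm (snd (snd z))" using that P by (auto simp: slabs_def)
    then have "(japanese (snd (snd z)))\<^sup>2 \<le> (2 * norm (snd (snd z)))\<^sup>2"
      using less_imp_le[OF japanese_pos] by (intro power_mono japanese_le)
    then have "\<alpha> / 4 * (japanese (snd (snd z)))\<^sup>2 \<le> \<alpha> / 4 * (2 * norm (snd (snd z)))\<^sup>2"
      using alpha_pos by (intro mult_left_mono) auto
    also have "\<dots> = \<alpha> * (norm (snd (snd z)))\<^sup>2" by (simp add: power_mult_distrib)
    also have "\<dots> \<le> osc_r (\<Phi> t) z" using that by (intro osc_r_lower) auto
    also have "\<dots> \<le> norm (osc_r (\<Phi> t) z)" by simp
    also have "(japanese (snd (snd z)))\<^sup>2 = japanese (snd (snd z)) powr 2"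
      using powr_realpow[OF japanese_pos, of "snd (snd z)" 2] by simp
    finally show ?thesis .
  qed
  then show "\<exists>c>0. \<forall>t\<in>T. \<forall>z\<in>P \<inter> (X \<times> Y \<times> Xi). c * japanese (snd (snd z)) powr 2 \<le> norm (osc_r (\<Phi> t) z)"
    using alpha_pos by (intro exI[of _ "\<alpha> / 4"]) simp
qed

lemma symbol_far_to_all:
  assumes "symbol far W \<omega> m F" "\<And>t z. t \<in> T \<Longrightarrow> norm (snd (snd z)) < 1 \<Longrightarrow> F t z = 0"
  shows "symbol all W \<omega> m F"
proof (rule symbol_localize[OF assms(1), where U = "{z. norm (snd (snd z)) < 1}"])
  show "open {z :: ('x, 'y, 'k) pt. norm (snd (snd z)) < 1}"
    by (intro open_Collect_less continuous_intros)
  fix P' assume "P' \<in> all"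
  then obtain K where K: "P' = K \<times> fsupp \<psi> \<times> Xi" "compact K" "K \<subseteq> X" by (auto simp: slabs_def)
  then show "\<exists>P\<in>far. P' \<subseteq> P \<union> {z. norm (snd (snd z)) < 1}"
    by (intro bexI[of _ "K \<times> fsupp \<psi> \<times> {\<xi>. 1 \<le> norm \<xi>}"]) (auto intro: slabsI)
qed (use assms(2) in auto)

lemma symbol_gain: "symbol \<P> W gain1 m F \<Longrightarrow> symbol \<P> W gain m F"
  by (rule symbol_weaken) (auto intro: gain_le)

lemma osc_alpha_near: "norm (snd (snd z)) < 1 \<Longrightarrow> osc_alpha \<eta> \<phi> l z = 0"
  and osc_beta_near: "norm (snd (snd z)) < 1 \<Longrightarrow> osc_beta \<eta> \<phi> k z = 0"
  by (auto simp: osc_alpha_def osc_beta_def cutoff_one split: prod.splits)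

text \<open>
  The coefficients are estimated with type \<open>(1, 0)\<close>, in which \<open>\<partial>\<^sub>\<xi>\<Phi>\<close> has order 0 and \<open>\<partial>\<^sub>y\<Phi>\<close> order 1.
  With type \<open>(\<rho>, \<delta>)\<close> from the start, these orders would be \<open>1 - \<rho>\<close> and \<open>1 + \<delta>\<close>, and the gain of \<open>L\<close>
  would be lost.
\<close>

lemma symbol_osc_alpha_far: "symbol far Basis gain1 0 (\<lambda>t. osc_alpha \<eta> (\<Phi> t) l)"
  and symbol_osc_beta_far: "symbol far Basis gain1 (- 1) (\<lambda>t. osc_beta \<eta> (\<Phi> t) k)"
proof -
  have eta: "symbol far Basis gain1 0 (\<lambda>t z. 1 + - \<eta> (snd (snd z)))"
    by (intro symbol_add symbol_const symbol_uminus symbol_cutoff) simp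
  have r: "symbol far Basis gain1 (- 2) (\<lambda>t z. - \<i> * (of_real (inverse (osc_r (\<Phi> t) z)) * (1 + - \<eta> (snd (snd z)))))"
    using symbol_cmult[OF symbol_mult[OF symbol_of_real[OF symbol_osc_r_inverse] eta], of "- \<i>"] by simp
  have "symbol far Basis gain1 2 (\<lambda>t z. of_real ((norm (snd (snd z)))\<^sup>2 * partial (dir_xi l) (\<Phi> t) z) :: complex)"
    using symbol_of_real[OF symbol_mult[OF symbol_norm_xi_sq symbol_phase_xi]] by simp
  from symbol_mult[OF r this]
  have "symbol far Basis gain1 (- 2 + 2) (\<lambda>t. osc_alpha \<eta> (\<Phi> t) l)"
    by (rule symbol_cong) (auto simp: osc_alpha_def divide_inverse)
  then show "symbol far Basis gain1 0 (\<lambda>t. osc_alpha \<eta> (\<Phi> t) l)" by simp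
  have "symbol far Basis gain1 1 (\<lambda>t z. of_real (partial (dir_y k) (\<Phi> t) z) :: complex)"
    by (intro symbol_of_real symbol_phase_y)
  from symbol_mult[OF r this]
  have "symbol far Basis gain1 (- 2 + 1) (\<lambda>t. osc_beta \<eta> (\<Phi> t) k)"
    by (rule symbol_cong) (auto simp: osc_beta_def divide_inverse)
  then show "symbol far Basis gain1 (- 1) (\<lambda>t. osc_beta \<eta> (\<Phi> t) k)" by simp
qed

lemma symbol_osc_alpha: "symbol all Basis gain 0 (\<lambda>t. osc_alpha \<eta> (\<Phi> t) l)"
  and symbol_osc_beta: "symbol all Basis gain (- 1) (\<lambda>t. osc_beta \<eta> (\<Phi> t) k)"
proof -
  show "symbol all Basis gain 0 (\<lambda>t. osc_alpha \<eta> (\<Phi> t) l)"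
    by (rule symbol_gain[OF symbol_far_to_all[OF symbol_osc_alpha_far osc_alpha_near]])
  show "symbol all Basis gain (- 1) (\<lambda>t. osc_beta \<eta> (\<Phi> t) k)"
    by (rule symbol_gain[OF symbol_far_to_all[OF symbol_osc_beta_far osc_beta_near]])
qed

lemma symbol_alpha_phase:
  "symbol all Basis gain 0 (\<lambda>t z. of_real (partial (dir_xi l) (\<Phi> t) z) * osc_alpha \<eta> (\<Phi> t) l z)"
  and symbol_beta_phase:
  "symbol all Basis gain 0 (\<lambda>t z. of_real (partial (dir_y k) (\<Phi> t) z) * osc_beta \<eta> (\<Phi> t) k z)"
proof -
  have "symbol far Basis gain1 0 (\<lambda>t z. of_real (partial (dir_xi l) (\<Phi> t) z) * osc_alpha \<eta> (\<Phi> t) l z)"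
    using symbol_mult[OF symbol_of_real[OF symbol_phase_xi] symbol_osc_alpha_far] by simp
  then show "symbol all Basis gain 0 (\<lambda>t z. of_real (partial (dir_xi l) (\<Phi> t) z) * osc_alpha \<eta> (\<Phi> t) l z)"
    by (intro symbol_gain symbol_far_to_all) (simp_all add: osc_alpha_near)
  have "symbol far Basis gain1 0 (\<lambda>t z. of_real (partial (dir_y k) (\<Phi> t) z) * osc_beta \<eta> (\<Phi> t) k z)"
    using symbol_mult[OF symbol_of_real[OF symbol_phase_y] symbol_osc_beta_far] by simp
  then show "symbol all Basis gain 0 (\<lambda>t z. of_real (partial (dir_y k) (\<Phi> t) z) * osc_beta \<eta> (\<Phi> t) k z)"
    by (intro symbol_gain symbol_far_to_all) (simp_all add: osc_beta_near)
qed

abbreviation "\<mu> \<equiv> min \<rho> (1 - \<delta>)"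

text \<open>
  A \<open>\<xi>\<close>-derivative of \<open>\<alpha>\<^sub>l F\<close> has order \<open>m - \<rho>\<close> and a \<open>y\<close>-derivative of \<open>\<beta>\<^sub>k F\<close> order \<open>m - 1 + \<delta>\<close>,
  while \<open>\<chi> F\<close> has any order.
\<close>

lemma symbol_osc_L:
  assumes F: "symbol all Basis gain m F"
  shows "symbol all Basis gain (m - \<mu>) (\<lambda>t. osc_L \<eta> (\<Phi> t) (F t))"
proof -
  have "symbol all Basis gain (0 + m - gain (dir_xi l)) (\<lambda>t. partial (dir_xi l) (\<lambda>w. osc_alpha \<eta> (\<Phi> t) l w * F t w))" for l
    by (rule symbolD(4)[OF symbol_mult[OF symbol_osc_alpha F]]) simp
  then have A: "symbol all Basis gain (m - \<mu>) (\<lambda>t. partial (dir_xi l) (\<lambda>w. osc_alpha \<eta> (\<Phi> t) l w * F t w))" for l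
    by (rule symbol_order_mono) simp
  have "symbol all Basis gain (- 1 + m - gain (dir_y k)) (\<lambda>t. partial (dir_y k) (\<lambda>w. osc_beta \<eta> (\<Phi> t) k w * F t w))" for k
    by (rule symbolD(4)[OF symbol_mult[OF symbol_osc_beta F]]) simp
  then have B: "symbol all Basis gain (m - \<mu>) (\<lambda>t. partial (dir_y k) (\<lambda>w. osc_beta \<eta> (\<Phi> t) k w * F t w))" for k
    by (rule symbol_order_mono) simp
  have C: "symbol all Basis gain (m - \<mu>) (\<lambda>t z. \<eta> (snd (snd z)) * F t z)"
    using symbol_mult[OF symbol_gain[OF symbol_cutoff[where m = "- \<mu>"]] F] by simp
  have "symbol all Basis gain (m - \<mu>) (\<lambda>t z.
      - (\<Sum>l\<in>UNIV. partial (dir_xi l) (\<lambda>w. osc_alpha \<eta> (\<Phi> t) l w * F t w) z)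
      + - (\<Sum>k\<in>UNIV. partial (dir_y k) (\<lambda>w. osc_beta \<eta> (\<Phi> t) k w * F t w) z)
      + \<eta> (snd (snd z)) * F t z)"
    using A B C by (intro symbol_add symbol_uminus symbol_sum) auto
  then show ?thesis by (rule symbol_cong) (auto simp: osc_L_def)
qed

lemma osc_L_vanish:
  fixes f :: "('x, 'y, 'k) pt \<Rightarrow> complex"
  assumes "open U" "\<And>w. w \<in> U \<Longrightarrow> f w = 0" "z \<in> U"
  shows "osc_L \<eta> \<phi> f z = 0"
proof -
  have "partial v (\<lambda>w. g w * f w) z = 0" for v and g :: "('x, 'y, 'k) pt \<Rightarrow> complex"
    by (rule partial_zero_on_open[OF assms(1,3)]) (simp add: assms(2))
  then show ?thesis using assms(2,3) by (cases z) (auto simp: osc_L_def)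
qed

definition osc_amp :: "nat \<Rightarrow> real \<Rightarrow> ('x, 'y, 'k) pt \<Rightarrow> complex" where
  "osc_amp n t = (osc_L \<eta> (\<Phi> t) ^^ n) (\<lambda>(x, y, \<xi>). a t (x, y, \<xi>) * \<psi> y)"

lemma symbol_osc_amp: "symbol all Basis gain (d - real n * \<mu>) (osc_amp n)"
proof (induction n)
  case 0
  have "smooth_on UNIV \<psi>" using test by (simp add: test_functions_def)
  from symbol_mult[OF amplitude symbol_test_like[OF this order_refl]] show ?case
    by (simp, elim symbol_cong) (auto simp: osc_amp_def)
next
  case (Suc n)
  from symbol_osc_L[OF this] show ?case
    by (simp add: osc_amp_def algebra_simps)
qed

lemma open_off_support: "open {z :: ('x, 'y, 'k) pt. fst (snd z) \<notin> fsupp \<psi>}"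
proof -
  have "{z :: ('x, 'y, 'k) pt. fst (snd z) \<notin> fsupp \<psi>} = UNIV \<times> (- fsupp \<psi>) \<times> UNIV" by auto
  moreover have "open (UNIV \<times> (- fsupp \<psi>) \<times> UNIV :: ('x, 'y, 'k) pt set)"
    using support(3) by (intro open_Times open_Compl open_UNIV)
  ultimately show ?thesis by simp
qed

lemma osc_amp_vanish: "fst (snd z) \<notin> fsupp \<psi> \<Longrightarrow> osc_amp n t z = 0"
proof (induction n arbitrary: z)
  case 0 then show ?case by (auto simp: osc_amp_def fsupp_outside split: prod.splits)
next
  case (Suc n)
  have "osc_L \<eta> (\<Phi> t) (osc_amp n t) z = 0"
    by (rule osc_L_vanish[OF open_off_support]) (use Suc in auto)
  then show ?case by (simp add: osc_amp_def)
qed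

end

context oscillatory_family
begin

section \<open>Oscillatory integrals\<close>

text \<open>
  The product \<open>e\<^bsup>i\<Phi>\<^esup> G\<close> as a function of the integration variables \<open>(\<xi>, y)\<close>, in the order of the
  iterated integral, and extended by 0 beyond \<open>Xi \<times> Y\<close>, where \<open>\<Phi>\<close> and \<open>G\<close> have no meaning.
\<close>

definition osc_integrand ::
  "(real \<Rightarrow> ('x, 'y, 'k) pt \<Rightarrow> complex) \<Rightarrow> real \<Rightarrow> real^'x \<Rightarrow> (real^'k) \<times> (real^'y) \<Rightarrow> complex" where
  "osc_integrand G t x = (\<lambda>p. indicator (Xi \<times> Y) p *\<^sub>R
     (exp (\<i> * of_real (\<Phi> t (x, snd p, fst p))) * G t (x, snd p, fst p)))"

definition osc_int :: "(real \<Rightarrow> ('x, 'y, 'k) pt \<Rightarrow> complex) \<Rightarrow> real \<Rightarrow> real^'x \<Rightarrow> complex" where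
  "osc_int G t x = (LINT p|lborel. osc_integrand G t x p)"

definition supported :: "(real \<Rightarrow> ('x, 'y, 'k) pt \<Rightarrow> complex) \<Rightarrow> bool" where
  "supported G \<longleftrightarrow> (\<forall>t\<in>T. \<forall>z. fst (snd z) \<notin> fsupp \<psi> \<longrightarrow> G t z = 0)"

lemma phase_continuous: "continuous_on (T \<times> X \<times> Y \<times> Xi) (\<lambda>(t, z). \<Phi> t z)"
  and phase_differentiable: "t \<in> T \<Longrightarrow> z \<in> X \<times> Y \<times> Xi \<Longrightarrow> \<Phi> t differentiable (at z)"
  using symbolD(1,3)[OF phase_far] by auto

lemma continuous_on_slice:
  assumes "continuous_on (T \<times> X \<times> Y \<times> Xi) (\<lambda>(t, z). F t z)" "t \<in> T" "x \<in> X"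
  shows "continuous_on (Xi \<times> Y) (\<lambda>p. F t (x, snd p, fst p))"
proof -
  have "continuous_on (Xi \<times> Y) (\<lambda>p. case (t, x, snd p, fst p) of (t, z) \<Rightarrow> F t z)"
    by (rule continuous_on_compose2[OF assms(1)]) (use assms(2,3) in \<open>auto intro!: continuous_intros\<close>)
  then show ?thesis by simp
qed

lemma osc_integrand_measurable:
  assumes "symbol0 \<P> m G" "t \<in> T" "x \<in> X"
  shows "osc_integrand G t x \<in> borel_measurable borel"
  unfolding osc_integrand_def
proof (rule borel_measurable_continuous_on_indicator)
  show "Xi \<times> Y \<in> sets borel" using open_Xi open_Y by (intro borel_open open_Times)
  have "continuous_on (T \<times> X \<times> Y \<times> Xi) (\<lambda>(t, z). G t z)" using assms(1) by (simp add: symbol0_def)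
  from continuous_on_slice[OF this assms(2,3)] continuous_on_slice[OF phase_continuous assms(2,3)]
  show "continuous_on (Xi \<times> Y) (\<lambda>p. exp (\<i> * of_real (\<Phi> t (x, snd p, fst p))) * G t (x, snd p, fst p))"
    by (intro continuous_intros)
qed

lemma osc_integrand_bound:
  assumes "symbol0 all m G" "supported G" "compact K" "K \<subseteq> X"
  obtains C where "\<And>t x p. t \<in> T \<Longrightarrow> x \<in> K \<Longrightarrow>
    norm (osc_integrand G t x p) \<le> C * japanese (fst p) powr m * indicator (fsupp \<psi>) (snd p)"
proof -
  have "K \<times> fsupp \<psi> \<times> Xi \<in> all" using assms by (intro slabsI)
  from assms(1)[unfolded symbol0_def, THEN conjunct2, THEN bspec, OF this]
  obtain C where C: "\<forall>t\<in>T. \<forall>z\<in>(K \<times> fsupp \<psi> \<times> Xi) \<inter> (X \<times> Y \<times> Xi).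
      norm (G t z) \<le> C * japanese (snd (snd z)) powr m"
    by (elim exE)
  have "norm (osc_integrand G t x p) \<le> \<bar>C\<bar> * japanese (fst p) powr m * indicator (fsupp \<psi>) (snd p)"
    if t: "t \<in> T" and x: "x \<in> K" for t x p
  proof (cases "p \<in> Xi \<times> Y \<and> snd p \<in> fsupp \<psi>")
    case True
    then have "norm (osc_integrand G t x p) = norm (G t (x, snd p, fst p))"
      by (simp add: osc_integrand_def norm_mult)
    also have "\<dots> \<le> C * japanese (fst p) powr m"
      using bspec[OF bspec[OF C t], of "(x, snd p, fst p)"] True x assms(4) by auto
    also have "\<dots> \<le> \<bar>C\<bar> * japanese (fst p) powr m" by (intro mult_right_mono) auto
    finally show ?thesis using True by simp
  next
    case False
    then have "osc_integrand G t x p = 0"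
      using assms(2) t by (auto simp: osc_integrand_def supported_def indicator_def)
    then show ?thesis by simp
  qed
  then show thesis by (rule that)
qed

lemma dominating_integrable:
  assumes "m < - real CARD('k)"
  shows "integrable lborel (\<lambda>p :: (real^'k) \<times> (real^'y). C * japanese (fst p) powr m * indicator (fsupp \<psi>) (snd p))"
  using integrable_tensor_indicator[OF integrable_japanese_powr[OF assms] _ support(1), of C]
  by (simp add: split_beta')

lemma osc_integrand_integrable:
  assumes "symbol0 all m G" "supported G" "m < - real CARD('k)" "t \<in> T" "x \<in> X"
  shows "integrable lborel (osc_integrand G t x)"
proof -
  obtain C where C: "\<And>s y p. s \<in> T \<Longrightarrow> y \<in> {x} \<Longrightarrow>
    norm (osc_integrand G s y p) \<le> C * japanese (fst p) powr m * indicator (fsupp \<psi>) (snd p)"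
    using osc_integrand_bound[OF assms(1,2), of "{x}"] assms(5) by auto
  show ?thesis
  proof (rule Bochner_Integration.integrable_bound[OF dominating_integrable[OF assms(3), of C]])
    show "osc_integrand G t x \<in> borel_measurable lborel"
      using osc_integrand_measurable[OF assms(1,4,5)] by simp
    show "AE p in lborel. norm (osc_integrand G t x p) \<le>
        norm (C * japanese (fst p) powr m * indicator (fsupp \<psi>) (snd p))"
      using order_trans[OF C[OF assms(4)] abs_ge_self] by (intro AE_I2) simp
  qed
qed

lemma osc_int_continuous:
  assumes "symbol0 all m G" "supported G" "m < - real CARD('k)"
  shows "continuous_on (T \<times> X) (\<lambda>(t, x). osc_int G t x)"
  unfolding osc_int_def split_beta
proof (rule continuous_on_integral_dominated)
  have cG: "continuous_on (T \<times> X \<times> Y \<times> Xi) (\<lambda>(t, z). G t z)" using assms(1) by (simp add: symbol0_def)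
  fix w :: "(real^'k) \<times> (real^'y)"
  show "continuous_on (T \<times> X) (\<lambda>p. osc_integrand G (fst p) (snd p) w)"
  proof (cases "w \<in> Xi \<times> Y")
    case True
    have "(\<lambda>p. (fst p, snd p, snd w, fst w)) ` (T \<times> X) \<subseteq> T \<times> X \<times> Y \<times> Xi" using True by auto
    moreover have "continuous_on (T \<times> X) (\<lambda>p. (fst p, snd p, snd w, fst w))"
      by (intro continuous_intros)
    ultimately
    have "continuous_on (T \<times> X) (\<lambda>p. G (fst p) (snd p, snd w, fst w))"
      "continuous_on (T \<times> X) (\<lambda>p. \<Phi> (fst p) (snd p, snd w, fst w))"
      using continuous_on_compose2[OF cG] continuous_on_compose2[OF phase_continuous] by fastforce+
    then show ?thesis unfolding osc_integrand_def by (intro continuous_intros)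
  qed (simp add: osc_integrand_def)
next
  show "osc_integrand G (fst p) (snd p) \<in> borel_measurable lborel" if "p \<in> T \<times> X" for p
    using osc_integrand_measurable[OF assms(1), of "fst p" "snd p"] that by auto
  fix K assume K: "compact K" "K \<subseteq> T \<times> X"
  have "compact (snd ` K)" "snd ` K \<subseteq> X"
    using K by (auto intro!: compact_continuous_image continuous_intros)
  from osc_integrand_bound[OF assms(1,2) this] obtain C where C: "\<And>t x p. t \<in> T \<Longrightarrow> x \<in> snd ` K \<Longrightarrow>
    norm (osc_integrand G t x p) \<le> C * japanese (fst p) powr m * indicator (fsupp \<psi>) (snd p)" by blast
  show "\<exists>g. integrable lborel g \<and> (\<forall>p\<in>K. \<forall>w. norm (osc_integrand G (fst p) (snd p) w) \<le> g w)"
    using K(2) by (intro exI[of _ "\<lambda>p. C * japanese (fst p) powr m * indicator (fsupp \<psi>) (snd p)"] conjI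
        dominating_integrable[OF assms(3)] ballI allI C) auto
qed

text \<open>
  The function \<open>e\<^bsup>-i\<Phi>\<^esup> \<partial>\<^sub>v(e\<^bsup>i\<Phi>\<^esup> G)\<close>.
\<close>

definition phase_partial ::
  "('x, 'y, 'k) pt \<Rightarrow> (real \<Rightarrow> ('x, 'y, 'k) pt \<Rightarrow> complex) \<Rightarrow> real \<Rightarrow> ('x, 'y, 'k) pt \<Rightarrow> complex" where
  "phase_partial v G t z = partial v (G t) z + \<i> * (of_real (partial v (\<Phi> t) z) * G t z)"

lemma partial_phase_mult:
  assumes "t \<in> T" "z \<in> X \<times> Y \<times> Xi" "G t differentiable (at z)"
  shows "partial v (\<lambda>z. exp (\<i> * of_real (\<Phi> t z)) * G t z) z = exp (\<i> * of_real (\<Phi> t z)) * phase_partial v G t z"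
    and "(\<lambda>z. exp (\<i> * of_real (\<Phi> t z)) * G t z) differentiable (at z)"
proof -
  have r: "(\<lambda>z. of_real (\<Phi> t z) :: complex) differentiable (at z)"
    using phase_differentiable[OF assms(1,2)] by (rule differentiable_of_real)
  have d: "(\<lambda>z. \<i> * of_real (\<Phi> t z)) differentiable (at z)"
    using r by (intro differentiable_mult) auto
  have "partial v (\<lambda>z. \<i> * of_real (\<Phi> t z)) z = \<i> * partial v (\<lambda>z. of_real (\<Phi> t z)) z"
    by (rule partial_bounded_linear[OF bounded_linear_mult_right r])
  also have "\<dots> = \<i> * of_real (partial v (\<Phi> t) z)"
    using partial_bounded_linear[OF bounded_linear_of_real phase_differentiable[OF assms(1,2)]] by simp
  finally show "partial v (\<lambda>z. exp (\<i> * of_real (\<Phi> t z)) * G t z) z = exp (\<i> * of_real (\<Phi> t z)) * phase_partial v G t z"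
    using partial_exp[OF d] assms(3) by (simp add: partial_mult phase_partial_def algebra_simps)
  show "(\<lambda>z. exp (\<i> * of_real (\<Phi> t z)) * G t z) differentiable (at z)"
    using partial_exp(2)[OF d] assms(3) by (rule differentiable_mult)
qed

lemma supported_partial:
  assumes "supported G"
  shows "supported (\<lambda>t. partial v (G t))"
  unfolding supported_def
  by (intro ballI allI impI partial_zero_on_open[OF open_off_support]) (use assms in \<open>auto simp: supported_def\<close>)

lemma supported_phase_partial: "supported G \<Longrightarrow> supported (phase_partial v G)"
  using supported_partial[of G v] by (simp add: supported_def phase_partial_def)

text \<open>
  Both terms have order at most \<open>m + 1\<close>: the derivative of \<open>G\<close> has order \<open>m + \<delta>\<close>, and \<open>\<partial>\<^sub>x\<Phi>\<close> has
  order 1.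
\<close>

lemma symbol_phase_partial_x:
  assumes "symbol all (range dir_x) gain m G"
  shows "symbol all (range dir_x) gain (m + 1) (phase_partial (dir_x i) G)"
proof -
  have 1: "symbol all (range dir_x) gain (m + 1) (\<lambda>t. partial (dir_x i) (G t))"
    using symbol_order_mono[OF symbolD(4)[OF assms, of "dir_x i"], of "m + 1"] delta by simp
  have "symbol all (range dir_x) gain 1 (\<lambda>t. partial (dir_x i) (\<Phi> t))"
    using symbolD(4)[OF phase_x, of "dir_x i"] by (intro symbol_gain) simp
  from symbol_cmult[OF symbol_mult[OF symbol_of_real[OF this] assms], of \<i>]
  have "symbol all (range dir_x) gain (m + 1) (\<lambda>t z. \<i> * (of_real (partial (dir_x i) (\<Phi> t) z) * G t z))"
    by (simp add: add.commute)
  from symbol_add[OF 1 this] show ?thesis unfolding phase_partial_def .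
qed

lemma partial_slice_x: "partial u (\<lambda>x. H (x, y, \<xi>)) x = partial (u, 0, 0) H (x, y, \<xi>)"
  by (simp add: partial_def)

lemma osc_int_partial:
  assumes G: "symbol all (range dir_x) gain m G" and supp: "supported G" and m: "m + 1 < - real CARD('k)"
    and t: "t \<in> T" and x: "x \<in> X"
  shows "osc_int G t differentiable (at x)"
    and "partial (axis i 1) (osc_int G t) x = osc_int (phase_partial (dir_x i) G) t x"
proof -
  have diff: "(\<lambda>x. osc_integrand G t x w) differentiable (at y)"
    and part: "partial (axis i 1) (\<lambda>x. osc_integrand G t x w) y = osc_integrand (phase_partial (dir_x i) G) t y w"
    if y: "y \<in> X" for y w and i :: 'x
  proof -
    let ?E = "\<lambda>z. exp (\<i> * of_real (\<Phi> t z)) * G t z"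
    have "(\<lambda>x. osc_integrand G t x w) differentiable (at y) \<and>
      partial (axis i 1) (\<lambda>x. osc_integrand G t x w) y = osc_integrand (phase_partial (dir_x i) G) t y w"
    proof (cases "w \<in> Xi \<times> Y")
      case True
      then have z: "(y, snd w, fst w) \<in> X \<times> Y \<times> Xi" using y by auto
      note E = partial_phase_mult[where G = G, OF t z symbolD(3)[OF G t z]]
      have eq: "(\<lambda>x. osc_integrand G t x w) = (\<lambda>x. ?E (x, snd w, fst w))"
        using True by (simp add: osc_integrand_def)
      have "((\<lambda>x. (x, snd w, fst w)) has_derivative (\<lambda>h. (h, 0, 0))) (at y)"
        by (auto intro!: derivative_eq_intros simp: zero_prod_def)
      then have "(\<lambda>x. (x, snd w, fst w)) differentiable (at y)" by (rule differentiableI)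
      then have "(\<lambda>x. ?E (x, snd w, fst w)) differentiable (at y)"
        by (rule differentiable_compose[where f = ?E and g = "\<lambda>x. (x, snd w, fst w)", OF E(2)])
      moreover have "partial (axis i 1) (\<lambda>x. ?E (x, snd w, fst w)) y = partial (dir_x i) ?E (y, snd w, fst w)"
        unfolding dir_x_def by (rule partial_slice_x[where H = ?E])
      ultimately show ?thesis
        unfolding eq E(1) using True by (simp add: osc_integrand_def)
    next
      case False then show ?thesis by (simp add: osc_integrand_def)
    qed
    then show "(\<lambda>x. osc_integrand G t x w) differentiable (at y)"
      "partial (axis i 1) (\<lambda>x. osc_integrand G t x w) y = osc_integrand (phase_partial (dir_x i) G) t y w" by auto
  qed
  have G0: "symbol0 all m G" using G by (rule symbol_symbol0)
  have DG0: "symbol0 all (m + 1) (phase_partial (dir_x i) G)" for i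
    by (rule symbol_symbol0[OF symbol_phase_partial_x[OF G]])
  have B: "\<exists>i. b = axis i 1" if "b \<in> Basis" for b :: "real^'x"
    using that by (auto simp: Basis_vec_def)
  have meas: "osc_integrand G t y \<in> borel_measurable lborel" if "y \<in> X" for y
    using osc_integrand_measurable[OF G0 t that] by simp
  have meas': "(\<lambda>w. partial b (\<lambda>y. osc_integrand G t y w) x) \<in> borel_measurable lborel" if b: "b \<in> Basis" for b
  proof -
    obtain i where "b = axis i 1" using B[OF b] by blast
    then show ?thesis using part[OF x] osc_integrand_measurable[OF DG0 t x] by simp
  qed
  have int: "integrable lborel (osc_integrand G t x)"
    using m by (intro osc_integrand_integrable[OF G0 supp _ t x]) simp
  have bound: "\<exists>g. integrable lborel g \<and> (\<forall>y\<in>K. \<forall>w. norm (partial b (\<lambda>y. osc_integrand G t y w) y) \<le> g w)"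
    if b: "b \<in> Basis" and K: "compact K" "K \<subseteq> X" for b K
  proof -
    obtain i where i: "b = axis i 1" using B[OF b] by blast
    obtain C where C: "\<And>s y p. s \<in> T \<Longrightarrow> y \<in> K \<Longrightarrow> norm (osc_integrand (phase_partial (dir_x i) G) s y p)
        \<le> C * japanese (fst p) powr (m + 1) * indicator (fsupp \<psi>) (snd p)"
      using osc_integrand_bound[OF DG0 supported_phase_partial[OF supp] K] by blast
    show ?thesis
      using K(2) t by (intro exI[of _ "\<lambda>p. C * japanese (fst p) powr (m + 1) * indicator (fsupp \<psi>) (snd p)"] conjI
          dominating_integrable[OF m] ballI allI) (auto simp: i part subset_iff intro!: C)
  qed
  show "osc_int G t differentiable (at x)"
    unfolding osc_int_def[abs_def]
    by (rule has_derivative_integral_dominated(1)[OF open_X x diff meas meas' int bound])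
  have "partial (axis i 1) (osc_int G t) x = (LINT w|lborel. partial (axis i 1) (\<lambda>y. osc_integrand G t y w) x)"
    unfolding osc_int_def[abs_def]
    by (rule has_derivative_integral_dominated(2)[OF open_X x diff meas meas' int bound])
      (simp_all add: axis_in_Basis_iff)
  then show "partial (axis i 1) (osc_int G t) x = osc_int (phase_partial (dir_x i) G) t x"
    by (simp add: part[OF x] osc_int_def)
qed

text \<open>
  The product \<open>e\<^bsup>i\<Phi>\<^esup> S\<close> vanishes for small \<open>\<xi>\<close> and for \<open>y\<close> off the support of \<open>\<psi>\<close>.  It is therefore
  differentiable on the whole space of \<open>(\<xi>, y)\<close>, and the integral of a derivative is 0.
\<close>

lemma osc_int_phase_partial_eq_zero:
  assumes S: "symbol all Basis gain m S" "supported S"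
    and near: "\<And>t z. t \<in> T \<Longrightarrow> norm (snd (snd z)) < 1 \<Longrightarrow> S t z = 0"
    and m: "m < - real CARD('k)"
    and S': "symbol0 all m' (phase_partial (0, v, w) S)" and m': "m' < - real CARD('k)"
    and t: "t \<in> T" and x: "x \<in> X"
  shows "osc_int (phase_partial (0, v, w) S) t x = 0"
proof -
  let ?E = "\<lambda>z. exp (\<i> * of_real (\<Phi> t z)) * S t z"
  let ?H = "\<lambda>p :: (real^'k) \<times> (real^'y). ?E (x, snd p, fst p)"
  let ?O = "{p :: (real^'k) \<times> (real^'y). norm (fst p) < 1 \<or> snd p \<notin> fsupp \<psi>}"
  have "?O = (ball 0 1 \<times> UNIV) \<union> (UNIV \<times> (- fsupp \<psi>))" by auto
  then have O: "open ?O" using support(3) by (auto intro!: open_Un open_Times)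
  have XY: "open (Xi \<times> Y :: ((real^'k) \<times> (real^'y)) set)" using open_Xi open_Y by (rule open_Times)
  have cover: "p \<in> ?O" if "p \<notin> Xi \<times> Y" for p
    using that support(2) by (cases p) (auto simp: Xi_def)
  have H0: "?H p = 0" if "p \<in> ?O" for p
    using that near[OF t, of "(x, snd p, fst p)"] S(2) t by (auto simp: supported_def)
  have line: "partial (w, v) ?H p = partial (0, v, w) ?E (x, snd p, fst p)" for p
    by (simp add: partial_def)
  have inside: "?H differentiable (at p) \<and> partial (w, v) ?H p = osc_integrand (phase_partial (0, v, w) S) t x p"
    if p: "p \<in> Xi \<times> Y" for p
  proof
    have z: "(x, snd p, fst p) \<in> X \<times> Y \<times> Xi" using p x by auto
    note E = partial_phase_mult[where G = S, OF t z symbolD(3)[OF S(1) t z]]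
    have "((\<lambda>p :: (real^'k) \<times> (real^'y). (x, snd p, fst p)) has_derivative (\<lambda>h. (0, snd h, fst h))) (at p)"
      by (auto intro!: derivative_eq_intros)
    then have "(\<lambda>p :: (real^'k) \<times> (real^'y). (x, snd p, fst p)) differentiable (at p)" by (rule differentiableI)
    then show "?H differentiable (at p)"
      by (rule differentiable_compose[where f = ?E and g = "\<lambda>p. (x, snd p, fst p)", OF E(2)])
    show "partial (w, v) ?H p = osc_integrand (phase_partial (0, v, w) S) t x p"
      unfolding line E(1) using p by (simp add: osc_integrand_def)
  qed
  have outside: "?H differentiable (at p) \<and> partial (w, v) ?H p = 0" if "p \<in> ?O" for p
  proof
    show "?H differentiable (at p)"
      by (rule differentiable_cong_open[OF O that, of "\<lambda>_. 0"]) (simp_all only: H0, simp)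
    show "partial (w, v) ?H p = 0"
      by (rule partial_zero_on_open[OF O that]) (rule H0)
  qed
  have eq: "partial (w, v) ?H = osc_integrand (phase_partial (0, v, w) S) t x"
  proof
    fix p show "partial (w, v) ?H p = osc_integrand (phase_partial (0, v, w) S) t x p"
      using inside[of p] outside[of p] cover[of p] by (cases "p \<in> Xi \<times> Y") (auto simp: osc_integrand_def)
  qed
  have eqH: "?H = osc_integrand S t x"
  proof
    fix p show "?H p = osc_integrand S t x p"
      using H0[of p] cover[of p] by (cases "p \<in> Xi \<times> Y") (auto simp: osc_integrand_def)
  qed
  have supp': "supported (phase_partial (0, v, w) S)" using S(2) by (rule supported_phase_partial)
  have "(LINT p|lborel. partial (w, v) ?H p) = 0"
  proof (rule integral_partial_eq_zero)
    show "?H differentiable (at p)" for p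
      using inside[of p] outside[of p] cover[of p] by (cases "p \<in> Xi \<times> Y") auto
    show "integrable lborel ?H" unfolding eqH
      by (rule osc_integrand_integrable[OF symbol_symbol0[OF S(1)] S(2) m t x])
    show "integrable lborel (partial (w, v) ?H)" unfolding eq
      by (rule osc_integrand_integrable[OF S' supp' m' t x])
    have "continuous_on (T \<times> X \<times> Y \<times> Xi) (\<lambda>(t, z). phase_partial (0, v, w) S t z)" using S' by (simp add: symbol0_def)
    from continuous_on_slice[OF this t x] continuous_on_slice[OF phase_continuous t x]
    have "continuous_on (Xi \<times> Y) (\<lambda>p. exp (\<i> * of_real (\<Phi> t (x, snd p, fst p))) * phase_partial (0, v, w) S t (x, snd p, fst p))"
      by (intro continuous_intros)
    then have c1: "continuous_on (Xi \<times> Y) (partial (w, v) ?H)"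
      by (rule continuous_on_eq) (simp add: eq osc_integrand_def)
    have c2: "continuous_on ?O (partial (w, v) ?H)"
      by (rule continuous_on_eq[of _ "\<lambda>_. 0"]) (use outside in auto)
    have "continuous_on (Xi \<times> Y \<union> ?O) (partial (w, v) ?H)"
      by (rule continuous_on_open_Un[OF XY O c1 c2])
    moreover have "Xi \<times> Y \<union> ?O = UNIV" using cover by blast
    ultimately show "continuous_on UNIV (partial (w, v) ?H)" by simp
  qed
  then show ?thesis unfolding eq by (simp add: osc_int_def)
qed

text \<open>
  The terms in which the derivatives of \<open>e\<^bsup>i\<Phi>\<^esup>\<close> appear add up to \<open>(1 - \<chi>) G\<close>, because
  \<open>r = \<parallel>\<xi>\<parallel>\<^sup>2\<parallel>\<nabla>\<^sub>\<xi>\<Phi>\<parallel>\<^sup>2 + \<parallel>\<nabla>\<^sub>y\<Phi>\<parallel>\<^sup>2\<close>; this is the fact that the transpose of \<open>L\<close> fixes \<open>e\<^bsup>i\<Phi>\<^esup>\<close>.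
\<close>

lemma osc_L_decomposition:
  assumes t: "t \<in> T" and z: "z \<in> X \<times> Y \<times> Xi"
  shows "osc_L \<eta> (\<Phi> t) (G t) z = G t z
     - (\<Sum>l\<in>UNIV. phase_partial (dir_xi l) (\<lambda>t z. osc_alpha \<eta> (\<Phi> t) l z * G t z) t z)
     - (\<Sum>k\<in>UNIV. phase_partial (dir_y k) (\<lambda>t z. osc_beta \<eta> (\<Phi> t) k z * G t z) t z)"
proof -
  obtain x y \<xi> where z': "z = (x, y, \<xi>)" by (cases z)
  let ?r = "of_real (osc_r (\<Phi> t) z) :: complex"
  let ?c = "(1 - \<eta> \<xi>) / ?r"
  have r: "?r \<noteq> 0" using osc_r_lower(2)[OF t z] by simp
  have ring: "\<i> * (p * (- \<i> / r * e * q * g)) = e / r * (q * p) * g" for p r e q g :: complex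
  proof -
    have "\<i> * (p * (- \<i> / r * e * q * g)) = - (\<i> * \<i>) * (e / r * (q * p) * g)"
      by (simp only: divide_inverse mult_ac minus_mult_left minus_mult_right)
    then show ?thesis by simp
  qed
  have a: "\<i> * (of_real (partial (dir_xi l) (\<Phi> t) z) * (osc_alpha \<eta> (\<Phi> t) l z * g)) =
      ?c * of_real ((norm \<xi>)\<^sup>2 * (partial (dir_xi l) (\<Phi> t) z * partial (dir_xi l) (\<Phi> t) z)) * g" for l g
    by (simp only: osc_alpha_def z' prod.case ring) (simp add: mult.assoc)
  have b: "\<i> * (of_real (partial (dir_y k) (\<Phi> t) z) * (osc_beta \<eta> (\<Phi> t) k z * g)) =
      ?c * of_real (partial (dir_y k) (\<Phi> t) z * partial (dir_y k) (\<Phi> t) z) * g" for k g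
    by (simp only: osc_beta_def z' prod.case ring) (simp add: mult.assoc)
  have "(\<Sum>l\<in>UNIV. ?c * of_real ((norm \<xi>)\<^sup>2 * (partial (dir_xi l) (\<Phi> t) z * partial (dir_xi l) (\<Phi> t) z)) * G t z)
      + (\<Sum>k\<in>UNIV. ?c * of_real (partial (dir_y k) (\<Phi> t) z * partial (dir_y k) (\<Phi> t) z) * G t z)
      = ?c * ?r * G t z"
    unfolding osc_r_eq
    by (simp add: z' sum_distrib_left sum_distrib_right distrib_left distrib_right)
  also have "\<dots> = (1 - \<eta> \<xi>) * G t z" using r by simp
  finally have sum: "(\<Sum>l\<in>UNIV. ?c * of_real ((norm \<xi>)\<^sup>2 * (partial (dir_xi l) (\<Phi> t) z * partial (dir_xi l) (\<Phi> t) z)) * G t z)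
      + (\<Sum>k\<in>UNIV. ?c * of_real (partial (dir_y k) (\<Phi> t) z * partial (dir_y k) (\<Phi> t) z) * G t z) = (1 - \<eta> \<xi>) * G t z" .
  have L: "osc_L \<eta> (\<Phi> t) (G t) z =
     - (\<Sum>l\<in>UNIV. partial (dir_xi l) (\<lambda>w. osc_alpha \<eta> (\<Phi> t) l w * G t w) z)
     - (\<Sum>k\<in>UNIV. partial (dir_y k) (\<lambda>w. osc_beta \<eta> (\<Phi> t) k w * G t w) z)
     + \<eta> \<xi> * G t z" by (simp add: osc_L_def z')
  show ?thesis
    unfolding L phase_partial_def a b sum.distrib using sum by (simp add: algebra_simps)
qed

lemma osc_int_osc_L:
  assumes G: "symbol all Basis gain m G" "supported G" and m: "m < - real CARD('k)"
    and t: "t \<in> T" and x: "x \<in> X"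
  shows "osc_int (\<lambda>t. osc_L \<eta> (\<Phi> t) (G t)) t x = osc_int G t x"
proof -
  let ?A = "\<lambda>l t z. osc_alpha \<eta> (\<Phi> t) l z * G t z" and ?B = "\<lambda>k t z. osc_beta \<eta> (\<Phi> t) k z * G t z"
  have A: "symbol all Basis gain m (?A l)" for l
    using symbol_mult[OF symbol_osc_alpha G(1)] by simp
  have B: "symbol all Basis gain (m - 1) (?B k)" for k
    using symbol_mult[OF symbol_osc_beta G(1)] by simp
  have A': "symbol0 all m (phase_partial (dir_xi l) (?A l))" for l
  proof -
    have "symbol all Basis gain m (\<lambda>t. partial (dir_xi l) (?A l t))"
      using symbol_order_mono[OF symbolD(4)[OF A, of "dir_xi l"], of m] rho by simp
    moreover have "symbol all Basis gain m (\<lambda>t z. \<i> * (of_real (partial (dir_xi l) (\<Phi> t) z) * ?A l t z))"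
      using symbol_cmult[OF symbol_mult[OF symbol_alpha_phase G(1)], of \<i>] by (simp add: mult.assoc)
    ultimately have "symbol all Basis gain m (phase_partial (dir_xi l) (?A l))"
      unfolding phase_partial_def by (rule symbol_add)
    then show ?thesis by (rule symbol_symbol0)
  qed
  have B': "symbol0 all m (phase_partial (dir_y k) (?B k))" for k
  proof -
    have "symbol all Basis gain m (\<lambda>t. partial (dir_y k) (?B k t))"
      using symbol_order_mono[OF symbolD(4)[OF B, of "dir_y k"], of m] delta by simp
    moreover have "symbol all Basis gain m (\<lambda>t z. \<i> * (of_real (partial (dir_y k) (\<Phi> t) z) * ?B k t z))"
      using symbol_cmult[OF symbol_mult[OF symbol_beta_phase G(1)], of \<i>] by (simp add: mult.assoc)
    ultimately have "symbol all Basis gain m (phase_partial (dir_y k) (?B k))"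
      unfolding phase_partial_def by (rule symbol_add)
    then show ?thesis by (rule symbol_symbol0)
  qed
  have supp: "supported (?A l)" "supported (?B k)" for l k
    using G(2) by (simp_all add: supported_def)
  note supp' = supp[THEN supported_phase_partial]
  have int: "integrable lborel (osc_integrand G t x)"
    "integrable lborel (osc_integrand (phase_partial (dir_xi l) (?A l)) t x)"
    "integrable lborel (osc_integrand (phase_partial (dir_y k) (?B k)) t x)" for l k
    by (rule osc_integrand_integrable[OF symbol_symbol0[OF G(1)] G(2) m t x]
        osc_integrand_integrable[OF A' supp'(1) m t x] osc_integrand_integrable[OF B' supp'(2) m t x])+
  have zA: "osc_int (phase_partial (dir_xi l) (?A l)) t x = 0" for l
    using osc_int_phase_partial_eq_zero[OF A supp(1) _ m A'[unfolded dir_xi_def] m t x]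
    by (simp add: osc_alpha_near flip: dir_xi_def)
  have zB: "osc_int (phase_partial (dir_y k) (?B k)) t x = 0" for k
    using osc_int_phase_partial_eq_zero[OF B supp(2) _ _ B'[unfolded dir_y_def] m t x] m
    by (simp add: osc_beta_near flip: dir_y_def)
  have "osc_integrand (\<lambda>t. osc_L \<eta> (\<Phi> t) (G t)) t x p = osc_integrand G t x p
     - (\<Sum>l\<in>UNIV. osc_integrand (phase_partial (dir_xi l) (?A l)) t x p)
     - (\<Sum>k\<in>UNIV. osc_integrand (phase_partial (dir_y k) (?B k)) t x p)" for p
  proof (cases "p \<in> Xi \<times> Y")
    case True
    then have "(x, snd p, fst p) \<in> X \<times> Y \<times> Xi" using x by auto
    from osc_L_decomposition[OF t this, of G] show ?thesis
      using True by (simp add: osc_integrand_def sum_distrib_left right_diff_distrib)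
  qed (simp add: osc_integrand_def)
  then have "osc_int (\<lambda>t. osc_L \<eta> (\<Phi> t) (G t)) t x = (LINT p|lborel. osc_integrand G t x p
     - (\<Sum>l\<in>UNIV. osc_integrand (phase_partial (dir_xi l) (?A l)) t x p)
     - (\<Sum>k\<in>UNIV. osc_integrand (phase_partial (dir_y k) (?B k)) t x p))"
    by (simp add: osc_int_def)
  also have "\<dots> = osc_int G t x - (\<Sum>l\<in>UNIV. osc_int (phase_partial (dir_xi l) (?A l)) t x)
     - (\<Sum>k\<in>UNIV. osc_int (phase_partial (dir_y k) (?B k)) t x)"
    using int unfolding osc_int_def
    by (subst Bochner_Integration.integral_diff Bochner_Integration.integral_sum;
        (intro Bochner_Integration.integrable_diff Bochner_Integration.integrable_sum)?; simp)+
  also have "\<dots> = osc_int G t x" by (simp add: zA zB)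
  finally show ?thesis .
qed

lemma supported_osc_amp: "supported (osc_amp n)"
  by (simp add: supported_def osc_amp_vanish)

lemma osc_int_osc_amp_mono:
  assumes "d - real n * \<mu> < - real CARD('k)" "n \<le> n'" "t \<in> T" "x \<in> X"
  shows "osc_int (osc_amp n') t x = osc_int (osc_amp n) t x"
  using assms(2)
proof (induction n' rule: dec_induct)
  case (step n')
  have "real n * \<mu> \<le> real n' * \<mu>" using step rho delta by (intro mult_right_mono) auto
  then have "osc_int (\<lambda>t. osc_L \<eta> (\<Phi> t) (osc_amp n' t)) t x = osc_int (osc_amp n') t x"
    using assms by (intro osc_int_osc_L[OF symbol_osc_amp supported_osc_amp]) auto
  then show ?case using step by (simp add: osc_amp_def)
qed simp

text \<open>
  Fubini's theorem replaces the iterated integral by one over the product space.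
\<close>

lemma osc_integral_eq_osc_int:
  assumes "d - real n * \<mu> < - real CARD('k)" "t \<in> T" "x \<in> X"
  shows "osc_integral \<eta> n Y (\<Phi> t) (a t) \<psi> x = 1 / (2 * of_real pi) ^ CARD('k) * osc_int (osc_amp n) t x"
proof -
  have "integrable (lborel \<Otimes>\<^sub>M lborel) (osc_integrand (osc_amp n) t x)"
    using osc_integrand_integrable[OF symbol_symbol0[OF symbol_osc_amp] supported_osc_amp assms]
    by (simp add: lborel_prod)
  from lborel_pair.integral_fst'[OF this]
  have "osc_int (osc_amp n) t x = (LINT \<xi>|lborel. LINT y|lborel. osc_integrand (osc_amp n) t x (\<xi>, y))"
    by (simp add: osc_int_def lborel_prod)
  also have "\<dots> = (LINT \<xi>:Xi|lborel. LINT y:Y|lborel.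
      exp (\<i> * of_real (\<Phi> t (x, y, \<xi>))) * osc_amp n t (x, y, \<xi>))"
    unfolding set_lebesgue_integral_def osc_integrand_def
    by (intro Bochner_Integration.integral_cong refl)
      (simp add: indicator_times scaleR_scaleR[symmetric] del: scaleR_scaleR)
  finally show ?thesis by (simp add: osc_integral_def osc_amp_def)
qed

text \<open>
  Differentiating an oscillatory integral of amplitude \<open>L\<^sup>n(a \<psi>)\<close> in the \<open>x\<close>-directions of a word
  gives an oscillatory integral with this amplitude.
\<close>

primrec word_amp :: "nat \<Rightarrow> (real^'x) list \<Rightarrow> real \<Rightarrow> ('x, 'y, 'k) pt \<Rightarrow> complex" where
  "word_amp n [] = osc_amp n"
| "word_amp n (b # ws) = phase_partial (b, 0, 0) (word_amp n ws)"

lemma word_amp_symbol: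
  assumes "set ws \<subseteq> Basis"
  shows "symbol all (range dir_x) gain (d - real n * \<mu> + real (length ws)) (word_amp n ws)"
    and "supported (word_amp n ws)"
proof -
  show "symbol all (range dir_x) gain (d - real n * \<mu> + real (length ws)) (word_amp n ws)"
    using assms
  proof (induction ws)
    case Nil show ?case by (simp, rule symbol_weaken[OF symbol_osc_amp]) auto
  next
    case (Cons b ws)
    then obtain i where "b = axis i 1" by (auto simp: Basis_vec_def)
    then have "((b, 0, 0) :: ('x, 'y, 'k) pt) = dir_x i" by (simp add: dir_x_def)
    moreover have "symbol all (range dir_x) gain (d - real n * \<mu> + real (length ws) + 1) (phase_partial (dir_x i) (word_amp n ws))"
      using Cons by (intro symbol_phase_partial_x) simp
    ultimately show ?case by (simp add: ac_simps)
  qed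
  show "supported (word_amp n ws)"
    by (induction ws) (auto intro: supported_osc_amp supported_phase_partial)
qed

context
  fixes \<kappa> :: nat
  assumes kappa: "d - real \<kappa> * \<mu> < - real CARD('k)"
begin

abbreviation "A \<equiv> \<lambda>t. osc_integral \<eta> \<kappa> Y (\<Phi> t) (a t) \<psi>"

text \<open>
  The integral is first rewritten with the larger exponent \<open>n\<close>.  Each letter of the word then raises
  the order of the amplitude by 1, and the hypothesis keeps it in the range of absolute convergence
  throughout.
\<close>

lemma word_partial_osc_integral:
  assumes "set ws \<subseteq> Basis" "d - real n * \<mu> + real (length ws) < - real CARD('k)" "\<kappa> \<le> n" "t \<in> T" "x \<in> X"
  shows "word_partial ws (A t) x = 1 / (2 * of_real pi) ^ CARD('k) * osc_int (word_amp n ws) t x"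
  using assms(1,2,5)
proof (induction ws arbitrary: x)
  case Nil
  then show ?case using osc_integral_eq_osc_int[OF kappa assms(4)] osc_int_osc_amp_mono[OF kappa assms(3,4)] by simp
next
  case (Cons b ws)
  then obtain i where b: "b = axis i 1" by (auto simp: Basis_vec_def)
  then have bx: "((b, 0, 0) :: ('x, 'y, 'k) pt) = dir_x i" by (simp add: dir_x_def)
  have ws: "set ws \<subseteq> Basis" using Cons.prems by simp
  note D = osc_int_partial[OF word_amp_symbol[OF ws] _ assms(4) Cons.prems(3), of n]
  have "partial b (word_partial ws (A t)) x
      = partial b (\<lambda>x. 1 / (2 * of_real pi) ^ CARD('k) * osc_int (word_amp n ws) t x) x"
    by (rule partial_cong_open[OF open_X Cons.prems(3) Cons.IH]) (use Cons.prems in auto)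
  also have "\<dots> = 1 / (2 * of_real pi) ^ CARD('k) * partial b (osc_int (word_amp n ws) t) x"
    using D Cons.prems by (intro partial_bounded_linear bounded_linear_mult_right) auto
  also have "partial b (osc_int (word_amp n ws) t) x = osc_int (word_amp n (b # ws)) t x"
    using D(2)[of i] Cons.prems by (simp add: b bx[unfolded b])
  finally show ?case by simp
qed

lemma exists_order: "\<exists>n\<ge>\<kappa>. d - real n * \<mu> + N < - real CARD('k)"
proof -
  have mu: "\<mu> > 0" using rho delta by simp
  obtain n0 where n0: "(d + N + real CARD('k)) / \<mu> < real n0" using reals_Archimedean2 by blast
  have "d + N + real CARD('k) < real n0 * \<mu>" using n0 mu by (simp add: field_simps)
  also have "\<dots> \<le> real (max n0 \<kappa>) * \<mu>" using mu by (intro mult_right_mono) auto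
  finally show ?thesis by (intro exI[of _ "max n0 \<kappa>"]) auto
qed

lemma osc_integral_word_partial_regular:
  assumes ws: "set ws \<subseteq> Basis"
  shows "t \<in> T \<Longrightarrow> x \<in> X \<Longrightarrow> word_partial ws (A t) differentiable (at x)"
    and "continuous_on (T \<times> X) (\<lambda>(t, x). word_partial ws (A t) x)"
proof -
  obtain n where n: "n \<ge> \<kappa>" "d - real n * \<mu> + (real (length ws) + 1) < - real CARD('k)"
    using exists_order by blast
  let ?c = "1 / (2 * of_real pi) ^ CARD('k) :: complex"
  have eq: "word_partial ws (A t) x = ?c * osc_int (word_amp n ws) t x" if "t \<in> T" "x \<in> X" for t x
    using n that by (intro word_partial_osc_integral ws) auto
  show "word_partial ws (A t) differentiable (at x)" if t: "t \<in> T" and x: "x \<in> X"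
  proof (rule differentiable_cong_open[OF open_X x])
    show "(\<lambda>x. ?c * osc_int (word_amp n ws) t x) differentiable (at x)"
      using osc_int_partial(1)[OF word_amp_symbol[OF ws] _ t x, of n] n
      by (intro differentiable_mult) (auto simp: add.assoc)
  qed (use eq t in simp)
  have "continuous_on (T \<times> X) (\<lambda>(t, x). osc_int (word_amp n ws) t x)"
    by (rule osc_int_continuous[OF symbol_symbol0[OF word_amp_symbol(1)[OF ws, of n]] word_amp_symbol(2)[OF ws]])
      (use n in simp)
  then have "continuous_on (T \<times> X) (\<lambda>p. ?c * (case p of (t, x) \<Rightarrow> osc_int (word_amp n ws) t x))"
    by (intro continuous_intros)
  then show "continuous_on (T \<times> X) (\<lambda>(t, x). word_partial ws (A t) x)"
    by (rule continuous_on_eq) (auto simp: eq)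
qed

end

end

section \<open>Convergence in the seminorms\<close>

lemma word_partial_zero: "word_partial ws (\<lambda>z. 0 :: 'b::real_normed_vector) = (\<lambda>z. 0)"
proof (induction ws)
  case (Cons b ws)
  have "partial b (\<lambda>z. 0 :: 'b) = (\<lambda>z. 0)" by (rule ext) simp
  then show ?case by (simp add: Cons)
qed simp

text \<open>
  On a compact neighbourhood in \<open>x\<close> and \<open>y\<close> the difference from the limit is at most
  \<open>\<nu> z / (n + 1)\<close>, and the continuous weight \<open>\<nu>\<close> is locally bounded.
\<close>

lemma continuous_on_partial_families:
  fixes F :: "real \<Rightarrow> ('x::finite, 'y::finite, 'k::finite) pt \<Rightarrow> 'b::real_normed_vector"
  assumes "open X" "open Y"
    and cont: "\<And>t. t \<in> seq_params \<Longrightarrow> continuous_on (X \<times> Y \<times> Xi) (F t)"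
    and nu: "continuous_on (X \<times> Y \<times> Xi) \<nu>" "\<And>z. 0 \<le> \<nu> z"
    and conv: "\<And>K L. compact K \<Longrightarrow> K \<subseteq> X \<Longrightarrow> compact L \<Longrightarrow> L \<subseteq> Y \<Longrightarrow>
       \<exists>N. \<forall>n\<ge>N. \<forall>z\<in>K \<times> L \<times> Xi. norm (F (seq_param n) z - F 0 z) \<le> seq_param n * \<nu> z"
  shows "continuous_on (seq_params \<times> X \<times> Y \<times> Xi) (\<lambda>(t, z). F t z)"
proof (rule continuous_on_sequence_family[OF cont])
  fix z e assume z: "z \<in> X \<times> Y \<times> (Xi :: (real^'k) set)" and e: "(e::real) > 0"
  obtain x y \<xi> where xy: "z = (x, y, \<xi>)" "x \<in> X" "y \<in> Y" "\<xi> \<in> Xi" using z by auto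
  obtain r1 where r1: "r1 > 0" "cball x r1 \<subseteq> X" using assms(1) xy open_contains_cball by blast
  obtain r2 where r2: "r2 > 0" "cball y r2 \<subseteq> Y" using assms(2) xy open_contains_cball by blast
  obtain r3 where r3: "r3 > 0" "\<And>w. w \<in> X \<times> Y \<times> Xi \<Longrightarrow> dist w z < r3 \<Longrightarrow> dist (\<nu> w) (\<nu> z) < 1"
    using nu(1) z unfolding continuous_on_iff by (meson zero_less_one)
  obtain N1 where N1: "\<And>n w. n \<ge> N1 \<Longrightarrow> w \<in> cball x r1 \<times> cball y r2 \<times> Xi \<Longrightarrow>
      norm (F (seq_param n) w - F 0 w) \<le> seq_param n * \<nu> w"
    using conv[OF compact_cball r1(2) compact_cball r2(2)] by blast
  have "eventually (\<lambda>n. seq_param n < e / (\<nu> z + 1)) sequentially"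
    using e nu(2)[of z] by (intro order_tendstoD(2)[OF seq_param_tendsto] divide_pos_pos) auto
  then obtain N2 where N2: "\<And>n. n \<ge> N2 \<Longrightarrow> seq_param n < e / (\<nu> z + 1)"
    by (auto simp: eventually_sequentially)
  have "dist (F (seq_param n) w) (F 0 w) < e"
    if n: "n \<ge> max N1 N2" and w: "w \<in> X \<times> Y \<times> Xi" "dist w z < min r1 (min r2 r3)" for n w
  proof -
    obtain x' y' \<xi>' where w': "w = (x', y', \<xi>')" by (cases w)
    have "dist x' x < r1" "dist y' y < r2"
      using w(2) dist_fst_le[of w z] dist_fst_le[of "snd w" "snd z"] dist_snd_le[of w z]
      by (simp_all add: w' xy(1))
    then have "w \<in> cball x r1 \<times> cball y r2 \<times> Xi" using w(1) by (auto simp: w' dist_commute)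
    then have "dist (F (seq_param n) w) (F 0 w) \<le> seq_param n * \<nu> w" using N1 n by (simp add: dist_norm)
    also have "\<nu> w \<le> \<nu> z + 1" using r3(2)[OF w(1)] w(2) by (simp add: dist_real_def abs_if split: if_splits)
    then have "seq_param n * \<nu> w \<le> seq_param n * (\<nu> z + 1)"
      using seq_param_pos[of n] by (intro mult_left_mono) auto
    also have "\<dots> < e" using N2[of n] n nu(2)[of z] by (simp add: pos_less_divide_eq)
    finally show ?thesis .
  qed
  then show "\<exists>r>0. \<exists>N. \<forall>n\<ge>N. \<forall>w\<in>X \<times> Y \<times> Xi. dist w z < r \<longrightarrow> dist (F (seq_param n) w) (F 0 w) < e"
    using r1(1) r2(1) r3(1) by (intro exI[of _ "min r1 (min r2 r3)"] conjI exI[of _ "max N1 N2"]) auto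
qed

text \<open>
  On their index sets the seminorms bound derivatives in all words, not only in those that belong to
  a multi-index.
\<close>

lemma phase_seminorm_word:
  fixes f :: "('x::finite, 'y::finite, 'k::finite) pt \<Rightarrow> real"
  assumes "open X" "open Y" "phase_seminorm X Y m f < ennreal e" "smooth_on (X \<times> Y \<times> Xi) f"
    and "set ws \<subseteq> Basis" "length ws \<le> m" "x \<in> exhaust X m" "y \<in> exhaust Y m" "\<xi> \<in> Xi" "0 < e"
  shows "\<bar>word_partial ws f (x, y, \<xi>)\<bar> \<le> e * norm \<xi> powr (1 - word_gain 1 0 ws)"
proof -
  obtain j k l where len: "mlen j + mlen k + mlen l = length ws"
    and gain: "\<And>\<rho> \<delta>. word_gain \<rho> \<delta> ws = \<rho> * real (mlen l) - \<delta> * real (mlen j + mlen k)"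
    and mset: "mset ws = mset (multi_word dir_x j @ multi_word dir_y k @ multi_word dir_xi l)"
    using word_as_multi_index[OF assms(5)] by blast
  have z: "(x, y, \<xi>) \<in> X \<times> Y \<times> Xi" using assms(7-9) compact_exhaust(2)[OF assms(1), of m] compact_exhaust(2)[OF assms(2), of m] by auto
  have "ennreal (norm \<xi> powr (real (mlen l) - 1) * \<bar>deriv_xyxi j k l f (x, y, \<xi>)\<bar>) \<le> phase_seminorm X Y m f"
    unfolding phase_seminorm_def
    by (intro Sup_upper CollectI exI[of _ x] exI[of _ y] exI[of _ \<xi>] exI[of _ j] exI[of _ k] exI[of _ l])
      (use assms(6-9) len in simp)
  then have "ennreal (norm \<xi> powr (real (mlen l) - 1) * \<bar>deriv_xyxi j k l f (x, y, \<xi>)\<bar>) < ennreal e"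
    using assms(3) by (rule le_less_trans)
  then have le: "norm \<xi> powr (real (mlen l) - 1) * \<bar>deriv_xyxi j k l f (x, y, \<xi>)\<bar> \<le> e"
    using assms(10) by (simp add: ennreal_less_iff)
  have nz: "norm \<xi> > 0" using assms(9) by (simp add: Xi_def)
  have "\<bar>word_partial ws f (x, y, \<xi>)\<bar>
      = norm \<xi> powr (1 - real (mlen l)) * (norm \<xi> powr (real (mlen l) - 1) * \<bar>deriv_xyxi j k l f (x, y, \<xi>)\<bar>)"
    using nz word_partial_eq_deriv_xyxi[OF mset assms(5) open_Times[OF assms(1) open_Times[OF assms(2) open_Xi]] assms(4) z]
    by (simp add: mult.assoc[symmetric] powr_add[symmetric])
  also have "\<dots> \<le> norm \<xi> powr (1 - real (mlen l)) * e" using le by (intro mult_left_mono) auto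
  finally show ?thesis by (simp add: gain mult.commute)
qed

lemma amplitude_seminorm_word:
  fixes f :: "('x::finite, 'y::finite, 'k::finite) pt \<Rightarrow> complex"
  assumes "open X" "open Y" "amplitude_seminorm d \<rho> \<delta> X Y m f < ennreal e" "smooth_on (X \<times> Y \<times> Xi) f"
    and "set ws \<subseteq> Basis" "length ws \<le> m" "x \<in> exhaust X m" "y \<in> exhaust Y m" "\<xi> \<in> Xi" "0 < e"
  shows "norm (word_partial ws f (x, y, \<xi>)) \<le> e * japanese \<xi> powr (d - word_gain \<rho> \<delta> ws)"
proof -
  obtain j k l where len: "mlen j + mlen k + mlen l = length ws"
    and gain: "\<And>\<rho> \<delta>. word_gain \<rho> \<delta> ws = \<rho> * real (mlen l) - \<delta> * real (mlen j + mlen k)"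
    and mset: "mset ws = mset (multi_word dir_x j @ multi_word dir_y k @ multi_word dir_xi l)"
    using word_as_multi_index[OF assms(5)] by blast
  let ?g = "\<rho> * real (mlen l) - \<delta> * real (mlen j + mlen k)"
  have z: "(x, y, \<xi>) \<in> X \<times> Y \<times> Xi" using assms(7-9) compact_exhaust(2)[OF assms(1), of m] compact_exhaust(2)[OF assms(2), of m] by auto
  have "ennreal (japanese \<xi> powr (- d + \<rho> * real (mlen l) - \<delta> * real (mlen j + mlen k)) * norm (deriv_xyxi j k l f (x, y, \<xi>)))
      \<le> amplitude_seminorm d \<rho> \<delta> X Y m f"
    unfolding amplitude_seminorm_def
    by (intro Sup_upper CollectI exI[of _ x] exI[of _ y] exI[of _ \<xi>] exI[of _ j] exI[of _ k] exI[of _ l])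
      (use assms(6-9) len in simp)
  then have "ennreal (japanese \<xi> powr (- d + \<rho> * real (mlen l) - \<delta> * real (mlen j + mlen k)) * norm (deriv_xyxi j k l f (x, y, \<xi>)))
      < ennreal e"
    using assms(3) by (rule le_less_trans)
  moreover have "- d + \<rho> * real (mlen l) - \<delta> * real (mlen j + mlen k) = - (d - ?g)" by simp
  ultimately have le: "japanese \<xi> powr (- (d - ?g)) * norm (deriv_xyxi j k l f (x, y, \<xi>)) \<le> e"
    using assms(10) by (simp only: ennreal_less_iff mult_nonneg_nonneg powr_ge_zero norm_ge_zero less_imp_le)
  have "norm (word_partial ws f (x, y, \<xi>))
      = japanese \<xi> powr (d - ?g) * (japanese \<xi> powr (- (d - ?g)) * norm (deriv_xyxi j k l f (x, y, \<xi>)))"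
    unfolding mult.assoc[symmetric] powr_add[symmetric]
    using japanese_ne_0[of \<xi>] word_partial_eq_deriv_xyxi[OF mset assms(5) open_Times[OF assms(1) open_Times[OF assms(2) open_Xi]] assms(4) z] by simp
  also have "\<dots> \<le> japanese \<xi> powr (d - ?g) * e" using le by (intro mult_left_mono) auto
  finally show ?thesis unfolding gain by (simp add: mult.commute)
qed

lemma hoermander_classD:
  assumes "b \<in> hoermander_class d \<rho> \<delta> X Y"
  shows "smooth_on (X \<times> Y \<times> UNIV) b"
    and "compact K \<Longrightarrow> K \<subseteq> X \<times> Y \<Longrightarrow> \<exists>C. \<forall>x y \<xi>. (x, y) \<in> K \<longrightarrow> norm (deriv_xyxi j k l b (x, y, \<xi>))
      \<le> C * japanese \<xi> powr (d - \<rho> * real (mlen l) + \<delta> * real (mlen j + mlen k))"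
proof -
  note b = assms[unfolded hoermander_class_def mem_Collect_eq]
  show "smooth_on (X \<times> Y \<times> UNIV) b" by (rule conjunct1[OF b])
  show "\<exists>C. \<forall>x y \<xi>. (x, y) \<in> K \<longrightarrow> norm (deriv_xyxi j k l b (x, y, \<xi>))
      \<le> C * japanese \<xi> powr (d - \<rho> * real (mlen l) + \<delta> * real (mlen j + mlen k))"
    if "compact K" "K \<subseteq> X \<times> Y"
    by (rule conjunct2[OF b, rule_format, OF conjI[OF that]])
qed

lemma amplitude_smooth:
  assumes "open X" "open Y" "a \<in> amplitudes d \<rho> \<delta> X Y"
  shows "smooth_on (X \<times> Y \<times> Xi) a"
proof -
  obtain b where b: "b \<in> hoermander_class d \<rho> \<delta> X Y" "\<forall>z\<in>X \<times> Y \<times> Xi. a z = b z"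
    using assms(3) unfolding amplitudes_def by blast
  have ab: "a z = b z" if "z \<in> X \<times> Y \<times> Xi" for z
    by (rule bspec[OF b(2) that])
  have "smooth_on (X \<times> Y \<times> Xi) b"
    by (rule smooth_on_subset[OF hoermander_classD(1)[OF b(1)]]) auto
  then show ?thesis
    using smooth_on_cong[OF open_Times[OF assms(1) open_Times[OF assms(2) open_Xi]], of a b] ab by metis
qed

lemma amplitude_derivative_bound:
  fixes a :: "('x::finite, 'y::finite, 'k::finite) pt \<Rightarrow> complex"
  assumes "open X" "open Y" "a \<in> amplitudes d \<rho> \<delta> X Y" "set ws \<subseteq> Basis" "compact K" "K \<subseteq> X \<times> Y"
  obtains C where "\<And>x y \<xi>. (x, y) \<in> K \<Longrightarrow> \<xi> \<in> Xi \<Longrightarrow>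
    norm (word_partial ws a (x, y, \<xi>)) \<le> C * japanese \<xi> powr (d - word_gain \<rho> \<delta> ws)"
proof -
  obtain b where b: "b \<in> hoermander_class d \<rho> \<delta> X Y" "\<forall>z\<in>X \<times> Y \<times> Xi. a z = b z"
    using assms(3) unfolding amplitudes_def by blast
  have ab: "a z = b z" if "z \<in> X \<times> Y \<times> Xi" for z
    by (rule bspec[OF b(2) that])
  obtain j k l where len: "mlen j + mlen k + mlen l = length ws"
    and gain: "\<And>\<rho> \<delta>. word_gain \<rho> \<delta> ws = \<rho> * real (mlen l) - \<delta> * real (mlen j + mlen k)"
    and mset: "mset ws = mset (multi_word dir_x j @ multi_word dir_y k @ multi_word dir_xi l)"
    using word_as_multi_index[OF assms(4)] by blast
  obtain C where C: "\<forall>x y \<xi>. (x, y) \<in> K \<longrightarrow> norm (deriv_xyxi j k l b (x, y, \<xi>))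
      \<le> C * japanese \<xi> powr (d - \<rho> * real (mlen l) + \<delta> * real (mlen j + mlen k))"
    using hoermander_classD(2)[OF b(1) assms(5,6), of j k l] by (elim exE)
  have "norm (word_partial ws a (x, y, \<xi>)) \<le> C * japanese \<xi> powr (d - word_gain \<rho> \<delta> ws)"
    if "(x, y) \<in> K" "\<xi> \<in> Xi" for x y \<xi>
  proof -
    have z: "(x, y, \<xi>) \<in> X \<times> Y \<times> Xi" "(x, y, \<xi>) \<in> X \<times> Y \<times> UNIV" using that assms(6) by auto
    have "word_partial ws a (x, y, \<xi>) = word_partial ws b (x, y, \<xi>)"
      by (rule word_partial_cong_open[OF open_Times[OF assms(1) open_Times[OF assms(2) open_Xi]] _ z(1)]) (rule ab)
    also have "\<dots> = deriv_xyxi j k l b (x, y, \<xi>)"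
      by (rule word_partial_eq_deriv_xyxi[OF mset assms(4) open_Times[OF assms(1) open_Times[OF assms(2) open_UNIV]]
            hoermander_classD(1)[OF b(1)] z(2)])
    finally have "word_partial ws a (x, y, \<xi>) = deriv_xyxi j k l b (x, y, \<xi>)" .
    moreover have "d - word_gain \<rho> \<delta> ws = d - \<rho> * real (mlen l) + \<delta> * real (mlen j + mlen k)"
      unfolding gain by simp
    ultimately show ?thesis using C[rule_format, OF that(1), of \<xi>] by (simp only:)
  qed
  then show thesis by (rule that)
qed

text \<open>
  The limit sits at the parameter 0 and the \<open>n\<close>-th member at the parameter \<open>1 / (n + 1)\<close>.
\<close>

definition seq_family :: "'f \<Rightarrow> (nat \<Rightarrow> 'f) \<Rightarrow> real \<Rightarrow> 'f" where
  "seq_family f0 f t = (if t = 0 then f0 else f (THE n. t = seq_param n))"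

lemma seq_family_simps [simp]: "seq_family f0 f 0 = f0" "seq_family f0 f (seq_param n) = f n"
  using seq_param_pos[of n] by (auto simp: seq_family_def inj_seq_param intro: arg_cong[where f = f])

lemma seq_family_in: "f0 \<in> S \<Longrightarrow> (\<And>n. f n \<in> S) \<Longrightarrow> t \<in> seq_params \<Longrightarrow> seq_family f0 f t \<in> S"
  by (auto simp: seq_params_def)

text \<open>
  The common part of the arguments for phase functions and amplitudes; \<open>\<nu>\<close> is the weight that
  normalizes the derivative belonging to the word in the respective seminorm.  Compact subsets of
  \<open>X\<close> and \<open>Y\<close> are contained in all sufficiently late sets of the exhaustions, so every derivative on
  such a set is controlled from some index on.
\<close>

lemma family_words_regular:
  fixes f0 :: "('x::finite, 'y::finite, 'k::finite) pt \<Rightarrow> 'b::real_normed_vector"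
  assumes "open X" "open Y"
    and smooth: "smooth_on (X \<times> Y \<times> Xi) f0" "\<And>n. smooth_on (X \<times> Y \<times> Xi) (f n)"
    and ws: "set ws \<subseteq> Basis"
    and nu: "continuous_on (X \<times> Y \<times> Xi) \<nu>" "\<And>z. 0 \<le> \<nu> z"
    and each: "\<And>t K. t \<in> seq_params \<Longrightarrow> compact K \<Longrightarrow> K \<subseteq> X \<times> Y \<Longrightarrow>
       \<exists>C. \<forall>x y \<xi>. (x, y) \<in> K \<longrightarrow> \<xi> \<in> Xi \<longrightarrow> norm (word_partial ws (seq_family f0 f t) (x, y, \<xi>)) \<le> C * \<nu> (x, y, \<xi>)"
    and conv: "\<And>n x y \<xi>. length ws \<le> Suc n \<Longrightarrow> x \<in> exhaust X (Suc n) \<Longrightarrow> y \<in> exhaust Y (Suc n) \<Longrightarrow> \<xi> \<in> Xi \<Longrightarrow>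
       norm (word_partial ws (\<lambda>z. f n z - f0 z) (x, y, \<xi>)) \<le> seq_param n * \<nu> (x, y, \<xi>)"
  shows "continuous_on (seq_params \<times> X \<times> Y \<times> Xi) (\<lambda>(t, z). word_partial ws (seq_family f0 f t) z)"
    and "compact K \<Longrightarrow> K \<subseteq> X \<Longrightarrow> compact L \<Longrightarrow> L \<subseteq> Y \<Longrightarrow>
      \<exists>C. \<forall>t\<in>seq_params. \<forall>z\<in>K \<times> L \<times> Xi. norm (word_partial ws (seq_family f0 f t) z) \<le> C * \<nu> z"
proof -
  have op: "open (X \<times> Y \<times> (Xi :: (real^'k) set))" using assms(1,2) open_Xi by (intro open_Times)
  let ?F = "\<lambda>t. word_partial ws (seq_family f0 f t)"
  have conv': "\<exists>N. \<forall>n\<ge>N. \<forall>z\<in>K \<times> L \<times> Xi. norm (?F (seq_param n) z - ?F 0 z) \<le> seq_param n * \<nu> z"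
    if KL: "compact K" "K \<subseteq> X" "compact L" "L \<subseteq> Y" for K L
  proof -
    obtain N1 where N1: "\<And>m. m \<ge> N1 \<Longrightarrow> K \<subseteq> exhaust X m" using compact_subset_exhaust[OF assms(1) KL(1,2)] by blast
    obtain N2 where N2: "\<And>m. m \<ge> N2 \<Longrightarrow> L \<subseteq> exhaust Y m" using compact_subset_exhaust[OF assms(2) KL(3,4)] by blast
    have "norm (?F (seq_param n) z - ?F 0 z) \<le> seq_param n * \<nu> z"
      if n: "n \<ge> max (length ws) (max N1 N2)" and z: "z \<in> K \<times> L \<times> Xi" for n z
    proof -
      obtain x y \<xi> where z': "z = (x, y, \<xi>)" "x \<in> K" "y \<in> L" "\<xi> \<in> Xi" using z by auto
      have "z \<in> X \<times> Y \<times> Xi" using z' KL by auto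
      then have "?F (seq_param n) z - ?F 0 z = word_partial ws (\<lambda>z. f n z - f0 z) z"
        using word_partial_diff[OF op smooth(2) smooth(1) ws] by simp
      then show ?thesis using conv[of n x y \<xi>] n N1[of "Suc n"] N2[of "Suc n"] z' by auto
    qed
    then show ?thesis by blast
  qed
  have sm: "smooth_on (X \<times> Y \<times> Xi) (seq_family f0 f t)" if "t \<in> seq_params" for t
    using that smooth by (auto simp: seq_params_def)
  show "continuous_on (seq_params \<times> X \<times> Y \<times> Xi) (\<lambda>(t, z). ?F t z)"
  proof (rule continuous_on_partial_families[OF assms(1,2) _ nu conv'])
    show "continuous_on (X \<times> Y \<times> Xi) (?F t)" if "t \<in> seq_params" for t
      by (rule smooth_onD(3)[OF smooth_on_word_partial[OF sm[OF that] ws]])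
  qed
  show "\<exists>C. \<forall>t\<in>seq_params. \<forall>z\<in>K \<times> L \<times> Xi. norm (?F t z) \<le> C * \<nu> z"
    if KL: "compact K" "K \<subseteq> X" "compact L" "L \<subseteq> Y"
  proof (rule uniform_bound_sequence_family[OF nu(2) _ conv'[OF KL]])
    fix t assume t: "t \<in> seq_params"
    have "compact (K \<times> L)" "K \<times> L \<subseteq> X \<times> Y" using KL by (auto intro: compact_Times)
    from each[OF t this] obtain C where "\<forall>x y \<xi>. (x, y) \<in> K \<times> L \<longrightarrow> \<xi> \<in> Xi \<longrightarrow> norm (?F t (x, y, \<xi>)) \<le> C * \<nu> (x, y, \<xi>)"
      by (elim exE)
    then have "\<forall>z\<in>K \<times> L \<times> Xi. norm (?F t z) \<le> C * \<nu> z" by simp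
    then show "\<exists>C. \<forall>z\<in>K \<times> L \<times> Xi. norm (?F t z) \<le> C * \<nu> z" ..
  qed
qed

lemma symbol_calculus_japanese:
  "open X \<Longrightarrow> open Y \<Longrightarrow>
   symbol_calculus (X \<times> Y \<times> (Xi :: (real^'k::finite) set)) (\<lambda>z. japanese (snd (snd z)))"
  by unfold_locales (auto intro: open_Times open_Xi japanese_ge_1)

lemma norm_powr_le_japanese:
  assumes "1 \<le> norm \<xi>"
  shows "norm \<xi> powr e \<le> 2 powr \<bar>e\<bar> * japanese \<xi> powr e"
proof (cases "0 \<le> e")
  case True
  have "norm \<xi> powr e \<le> 1 * japanese \<xi> powr e"
    using True norm_le_japanese[of \<xi>] by (simp add: powr_mono2)
  also have "\<dots> \<le> 2 powr \<bar>e\<bar> * japanese \<xi> powr e"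
    by (intro mult_right_mono ge_one_powr_ge_zero) auto
  finally show ?thesis .
next
  case False
  have "norm \<xi> powr e \<le> (japanese \<xi> / 2) powr e"
    using False japanese_le[OF assms] japanese_pos[of \<xi>] by (intro powr_mono2') auto
  also have "\<dots> = 2 powr \<bar>e\<bar> * japanese \<xi> powr e"
  proof -
    have "\<bar>e\<bar> = - e" using False by simp
    then show ?thesis
      unfolding powr_divide by (simp only: powr_minus divide_inverse mult.commute)
  qed
  finally show ?thesis .
qed

context
  fixes X :: "(real^'x::finite) set" and Y :: "(real^'y::finite) set" and \<alpha> d \<rho> \<delta> :: real
    and \<Phi>0 :: "('x, 'y, 'k::finite) pt \<Rightarrow> real" and \<Phi>s :: "nat \<Rightarrow> ('x, 'y, 'k) pt \<Rightarrow> real"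
    and a0 :: "('x, 'y, 'k) pt \<Rightarrow> complex" and as :: "nat \<Rightarrow> ('x, 'y, 'k) pt \<Rightarrow> complex"
  assumes open_X: "open X" and open_Y: "open Y"
    and phi0: "\<Phi>0 \<in> phases \<alpha> X Y" and phis: "\<And>n. \<Phi>s n \<in> phases \<alpha> X Y"
    and a0: "a0 \<in> amplitudes d \<rho> \<delta> X Y" and as: "\<And>n. as n \<in> amplitudes d \<rho> \<delta> X Y"
    and phi_conv: "\<And>n. phase_seminorm X Y (Suc n) (\<Phi>s n - \<Phi>0) < ennreal (seq_param n)"
    and a_conv: "\<And>n. amplitude_seminorm d \<rho> \<delta> X Y (Suc n) (as n - a0) < ennreal (seq_param n)"
begin

interpretation symbol_calculus seq_params "X \<times> Y \<times> (Xi :: (real^'k) set)" "\<lambda>z. japanese (snd (snd z))"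
  using open_X open_Y by (rule symbol_calculus_japanese)

lemma phases_smooth: "smooth_on (X \<times> Y \<times> Xi) \<Phi>0" "smooth_on (X \<times> Y \<times> Xi) (\<Phi>s n)"
  using phi0 phis by (auto simp: phases_def phases_hg_def)

lemma amplitudes_smooth: "smooth_on (X \<times> Y \<times> Xi) a0" "smooth_on (X \<times> Y \<times> Xi) (as n)"
  by (rule amplitude_smooth[OF open_X open_Y a0], rule amplitude_smooth[OF open_X open_Y as])

lemma phase_family_words:
  assumes ws: "set ws \<subseteq> Basis"
  shows "continuous_on (seq_params \<times> X \<times> Y \<times> Xi) (\<lambda>(t, z). word_partial ws (seq_family \<Phi>0 \<Phi>s t) z)"
    and "compact K \<Longrightarrow> K \<subseteq> X \<Longrightarrow> compact L \<Longrightarrow> L \<subseteq> Y \<Longrightarrow>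
      \<exists>C. \<forall>t\<in>seq_params. \<forall>z\<in>K \<times> L \<times> Xi. norm (word_partial ws (seq_family \<Phi>0 \<Phi>s t) z)
        \<le> C * norm (snd (snd z)) powr (1 - word_gain 1 0 ws)"
proof -
  let ?\<nu> = "\<lambda>z :: ('x, 'y, 'k) pt. norm (snd (snd z)) powr (1 - word_gain 1 0 ws)"
  have nu: "continuous_on (X \<times> Y \<times> Xi) ?\<nu>"
    by (intro continuous_intros) (auto simp: Xi_def)
  have each: "\<exists>C. \<forall>x y \<xi>. (x, y) \<in> K \<longrightarrow> \<xi> \<in> Xi \<longrightarrow>
      norm (word_partial ws (seq_family \<Phi>0 \<Phi>s t) (x, y, \<xi>)) \<le> C * ?\<nu> (x, y, \<xi>)"
    if "t \<in> seq_params" "compact K" "K \<subseteq> X \<times> Y" for t K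
  proof -
    have "seq_family \<Phi>0 \<Phi>s t \<in> phases_hg X Y"
      using seq_family_in[OF phi0 phis that(1)] by (simp add: phases_def)
    from phase_derivative_bound[OF open_X open_Y this ws that(2,3)] show ?thesis
      unfolding real_norm_def snd_conv by metis
  qed
  have conv: "norm (word_partial ws (\<lambda>z. \<Phi>s n z - \<Phi>0 z) (x, y, \<xi>)) \<le> seq_param n * ?\<nu> (x, y, \<xi>)"
    if "length ws \<le> Suc n" "x \<in> exhaust X (Suc n)" "y \<in> exhaust Y (Suc n)" "\<xi> \<in> Xi" for n x y \<xi>
    using phase_seminorm_word[OF open_X open_Y phi_conv[of n, unfolded fun_diff_def] smooth_on_diff[OF open_domain phases_smooth(2,1)]
        ws that seq_param_pos] by simp
  show "continuous_on (seq_params \<times> X \<times> Y \<times> Xi) (\<lambda>(t, z). word_partial ws (seq_family \<Phi>0 \<Phi>s t) z)"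
    by (rule family_words_regular(1)[OF open_X open_Y phases_smooth ws nu _ each conv]) simp
  show "\<exists>C. \<forall>t\<in>seq_params. \<forall>z\<in>K \<times> L \<times> Xi. norm (word_partial ws (seq_family \<Phi>0 \<Phi>s t) z) \<le> C * ?\<nu> z"
    if "compact K" "K \<subseteq> X" "compact L" "L \<subseteq> Y"
    by (rule family_words_regular(2)[OF open_X open_Y phases_smooth ws nu _ each conv that]) simp
qed

lemma phase_family_symbol_far:
  assumes L: "compact L" "L \<subseteq> Y"
  shows "symbol (slabs X L {\<xi>. 1 \<le> norm \<xi>}) Basis (order_gain 1 0) 1 (seq_family \<Phi>0 \<Phi>s)"
proof (rule symbol_word_criterion)
  show "smooth_on (X \<times> Y \<times> Xi) (seq_family \<Phi>0 \<Phi>s t)" if "t \<in> seq_params" for t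
    using that phases_smooth by (auto simp: seq_params_def)
  fix ws :: "('x, 'y, 'k) pt list" assume ws: "set ws \<subseteq> Basis"
  let ?e = "1 - word_gain 1 0 ws"
  show "symbol0 (slabs X L {\<xi>. 1 \<le> norm \<xi>}) ?e (\<lambda>t. word_partial ws (seq_family \<Phi>0 \<Phi>s t))"
    unfolding symbol0_def
  proof (intro conjI ballI phase_family_words(1)[OF ws])
    fix P assume "P \<in> slabs X L {\<xi>::real^'k. 1 \<le> norm \<xi>}"
    then obtain K where K: "P = K \<times> L \<times> {\<xi>. 1 \<le> norm \<xi>}" "compact K" "K \<subseteq> X" by (auto simp: slabs_def)
    obtain C where C: "\<And>t z. t \<in> seq_params \<Longrightarrow> z \<in> K \<times> L \<times> Xi \<Longrightarrow>
        norm (word_partial ws (seq_family \<Phi>0 \<Phi>s t) z) \<le> C * norm (snd (snd z)) powr ?e"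
      using phase_family_words(2)[OF ws K(2,3) L] by blast
    have "norm (word_partial ws (seq_family \<Phi>0 \<Phi>s t) z) \<le> (\<bar>C\<bar> * 2 powr \<bar>?e\<bar>) * japanese (snd (snd z)) powr ?e"
      if t: "t \<in> seq_params" and z: "z \<in> P \<inter> (X \<times> Y \<times> Xi)" for t z
    proof -
      have z': "z \<in> K \<times> L \<times> Xi" "1 \<le> norm (snd (snd z))" using z K(1) by auto
      have "norm (word_partial ws (seq_family \<Phi>0 \<Phi>s t) z) \<le> C * norm (snd (snd z)) powr ?e"
        by (rule C[OF t z'(1)])
      also have "\<dots> \<le> \<bar>C\<bar> * (2 powr \<bar>?e\<bar> * japanese (snd (snd z)) powr ?e)"
        by (intro mult_mono norm_powr_le_japanese z'(2)) auto
      finally show ?thesis by (simp add: mult.assoc)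
    qed
    then show "\<exists>C. \<forall>t\<in>seq_params. \<forall>z\<in>P \<inter> (X \<times> Y \<times> Xi).
        norm (word_partial ws (seq_family \<Phi>0 \<Phi>s t) z) \<le> C * japanese (snd (snd z)) powr ?e" by blast
  qed
qed simp

lemma phase_family_symbol_x:
  assumes L: "compact L" "L \<subseteq> Y"
  shows "symbol (slabs X L Xi) (range dir_x) (order_gain 1 0) 1 (seq_family \<Phi>0 \<Phi>s)"
proof (rule symbol_word_criterion)
  show "smooth_on (X \<times> Y \<times> Xi) (seq_family \<Phi>0 \<Phi>s t)" if "t \<in> seq_params" for t
    using that phases_smooth by (auto simp: seq_params_def)
  show "range dir_x \<subseteq> (Basis :: ('x, 'y, 'k) pt set)" by auto
  fix ws :: "('x, 'y, 'k) pt list" assume wsx: "set ws \<subseteq> range dir_x"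
  then have ws: "set ws \<subseteq> Basis" by auto
  have e: "word_gain 1 0 ws = 0"
    using wsx by (induction ws) auto
  show "symbol0 (slabs X L Xi) (1 - word_gain 1 0 ws) (\<lambda>t. word_partial ws (seq_family \<Phi>0 \<Phi>s t))"
    unfolding symbol0_def e
  proof (intro conjI ballI phase_family_words(1)[OF ws])
    fix P assume "P \<in> slabs X L (Xi :: (real^'k) set)"
    then obtain K where K: "P = K \<times> L \<times> Xi" "compact K" "K \<subseteq> X" by (auto simp: slabs_def)
    obtain C where C: "\<And>t z. t \<in> seq_params \<Longrightarrow> z \<in> K \<times> L \<times> Xi \<Longrightarrow>
        norm (word_partial ws (seq_family \<Phi>0 \<Phi>s t) z) \<le> C * norm (snd (snd z)) powr (1 - 0)"
      using phase_family_words(2)[OF ws K(2,3) L] unfolding e by blast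
    have "norm (word_partial ws (seq_family \<Phi>0 \<Phi>s t) z) \<le> \<bar>C\<bar> * japanese (snd (snd z)) powr (1 - 0)"
      if t: "t \<in> seq_params" and z: "z \<in> P \<inter> (X \<times> Y \<times> Xi)" for t z
    proof -
      have "norm (word_partial ws (seq_family \<Phi>0 \<Phi>s t) z) \<le> C * norm (snd (snd z)) powr (1 - 0)"
        using z K(1) by (intro C[OF t]) auto
      also have "\<dots> \<le> \<bar>C\<bar> * japanese (snd (snd z)) powr (1 - 0)"
        by (intro mult_mono powr_mono2 norm_le_japanese) auto
      finally show ?thesis .
    qed
    then show "\<exists>C. \<forall>t\<in>seq_params. \<forall>z\<in>P \<inter> (X \<times> Y \<times> Xi).
        norm (word_partial ws (seq_family \<Phi>0 \<Phi>s t) z) \<le> C * japanese (snd (snd z)) powr (1 - 0)" by blast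
  qed
qed

lemma amplitude_family_symbol:
  assumes L: "compact L" "L \<subseteq> Y"
  shows "symbol (slabs X L Xi) Basis (order_gain \<rho> \<delta>) d (seq_family a0 as)"
proof (rule symbol_word_criterion)
  show "smooth_on (X \<times> Y \<times> Xi) (seq_family a0 as t)" if "t \<in> seq_params" for t
    using that amplitudes_smooth by (auto simp: seq_params_def)
  fix ws :: "('x, 'y, 'k) pt list" assume ws: "set ws \<subseteq> Basis"
  let ?e = "d - word_gain \<rho> \<delta> ws"
  let ?\<nu> = "\<lambda>z :: ('x, 'y, 'k) pt. japanese (snd (snd z)) powr ?e"
  have nu: "continuous_on (X \<times> Y \<times> Xi) ?\<nu>"
    using japanese_ne_0 by (intro continuous_intros) auto
  have each: "\<exists>C. \<forall>x y \<xi>. (x, y) \<in> K \<longrightarrow> \<xi> \<in> Xi \<longrightarrow>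
      norm (word_partial ws (seq_family a0 as t) (x, y, \<xi>)) \<le> C * ?\<nu> (x, y, \<xi>)"
    if tK: "t \<in> seq_params" "compact K" "K \<subseteq> X \<times> Y" for t K
  proof -
    obtain C where "\<And>x y \<xi>. (x, y) \<in> K \<Longrightarrow> \<xi> \<in> Xi \<Longrightarrow>
        norm (word_partial ws (seq_family a0 as t) (x, y, \<xi>)) \<le> C * japanese \<xi> powr ?e"
      by (rule amplitude_derivative_bound[OF open_X open_Y seq_family_in[OF a0 as tK(1)] ws tK(2,3)]) (rule that)
    then show ?thesis unfolding snd_conv by (intro exI allI impI)
  qed
  have conv: "norm (word_partial ws (\<lambda>z. as n z - a0 z) (x, y, \<xi>)) \<le> seq_param n * ?\<nu> (x, y, \<xi>)"
    if "length ws \<le> Suc n" "x \<in> exhaust X (Suc n)" "y \<in> exhaust Y (Suc n)" "\<xi> \<in> Xi" for n x y \<xi>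
  proof -
    have "amplitude_seminorm d \<rho> \<delta> X Y (Suc n) (\<lambda>z. as n z - a0 z) < ennreal (seq_param n)"
      using a_conv[of n] unfolding fun_diff_def .
    moreover have "smooth_on (X \<times> Y \<times> Xi) (\<lambda>z. as n z - a0 z)"
      by (rule smooth_on_diff[OF open_domain amplitudes_smooth(2,1)])
    ultimately show ?thesis
      unfolding snd_conv by (rule amplitude_seminorm_word[OF open_X open_Y _ _ ws that seq_param_pos])
  qed
  show "symbol0 (slabs X L Xi) ?e (\<lambda>t. word_partial ws (seq_family a0 as t))"
    unfolding symbol0_def
  proof (intro conjI ballI)
    show "continuous_on (seq_params \<times> X \<times> Y \<times> Xi) (\<lambda>(t, z). word_partial ws (seq_family a0 as t) z)"
      by (rule family_words_regular(1)[OF open_X open_Y amplitudes_smooth ws nu _ each conv]) simp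
    fix P assume "P \<in> slabs X L (Xi :: (real^'k) set)"
    then obtain K where K: "P = K \<times> L \<times> Xi" "compact K" "K \<subseteq> X" by (auto simp: slabs_def)
    have "\<exists>C. \<forall>t\<in>seq_params. \<forall>z\<in>K \<times> L \<times> Xi. norm (word_partial ws (seq_family a0 as t) z) \<le> C * ?\<nu> z"
      by (rule family_words_regular(2)[OF open_X open_Y amplitudes_smooth ws nu _ each conv K(2,3) L]) simp
    then show "\<exists>C. \<forall>t\<in>seq_params. \<forall>z\<in>P \<inter> (X \<times> Y \<times> Xi).
        norm (word_partial ws (seq_family a0 as t) z) \<le> C * ?\<nu> z"
      unfolding K(1) by blast
  qed
qed simp

text \<open>
  A sequence of pairs that converges in the seminorms satisfies the hypotheses under which oscillatory
  integrals have been studied.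
\<close>

lemma sequence_oscillatory_family:
  assumes "\<alpha> > 0" "0 \<le> \<delta>" "\<delta> < 1" "0 < \<rho>" "\<rho> \<le> 1" "cutoff \<eta>" "\<psi> \<in> test_functions Y"
  shows "oscillatory_family seq_params X Y \<alpha> d \<delta> \<rho> \<eta> \<psi> (seq_family \<Phi>0 \<Phi>s) (seq_family a0 as)"
proof -
  have L: "compact (fsupp \<psi>)" "fsupp \<psi> \<subseteq> Y"
    using assms(7) by (auto simp: fsupp_def test_functions_def)
  show ?thesis
    by unfold_locales
      (use assms open_X open_Y seq_family_in[OF phi0 phis] phase_family_symbol_far[OF L]
        phase_family_symbol_x[OF L] amplitude_family_symbol[OF L] in auto)
qed

end

section \<open>Continuity\<close>

lemma phase_seminorm_zero: "phase_seminorm X Y m (f - f) = 0"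
proof -
  have "f - f = (\<lambda>z. 0)" by (simp add: fun_eq_iff)
  then show ?thesis
    by (auto simp: phase_seminorm_def deriv_xyxi_eq_word_partial word_partial_zero intro!: antisym Sup_least)
qed

lemma amplitude_seminorm_zero: "amplitude_seminorm d \<rho> \<delta> X Y m (f - f) = 0"
proof -
  have "f - f = (\<lambda>z. 0)" by (simp add: fun_eq_iff)
  then show ?thesis
    by (auto simp: amplitude_seminorm_def deriv_xyxi_eq_word_partial word_partial_zero intro!: antisym Sup_least)
qed

lemma smooth_on_words:
  fixes f :: "'a::euclidean_space \<Rightarrow> 'b::real_normed_vector"
  assumes "\<And>ws z. set ws \<subseteq> Basis \<Longrightarrow> z \<in> S \<Longrightarrow> word_partial ws f differentiable (at z)"
  shows "smooth_on S f"
proof -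
  have "Ck_on n S f" if "\<forall>ws. set ws \<subseteq> Basis \<longrightarrow> (\<forall>z\<in>S. word_partial ws f differentiable (at z))" for n and f :: "'a \<Rightarrow> 'b"
    using that
  proof (induction n arbitrary: f)
    case 0
    have "f differentiable (at z)" if "z \<in> S" for z using 0[rule_format, of "[]"] that by simp
    then show ?case
      by (simp add: continuous_at_imp_continuous_on differentiable_imp_continuous_within)
  next
    case (Suc n)
    have "Ck_on n S (partial b f)" if b: "b \<in> Basis" for b
    proof (rule Suc.IH, intro allI impI)
      fix ws :: "'a list" assume "set ws \<subseteq> Basis"
      then show "\<forall>z\<in>S. word_partial ws (partial b f) differentiable (at z)"
        using Suc.prems[rule_format, of "ws @ [b]"] b by (simp add: word_partial_append)
    qed
    then show ?case using Suc.prems[rule_format, of "[]"] by simp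
  qed
  then show ?thesis using assms by (simp add: smooth_on_def)
qed

lemma smooth_seminorm_words:
  assumes "\<And>ws x. set ws \<subseteq> Basis \<Longrightarrow> length ws \<le> m \<Longrightarrow> x \<in> exhaust X m \<Longrightarrow> ennreal (norm (word_partial ws v x)) \<le> B"
  shows "smooth_seminorm X m v \<le> B"
  unfolding smooth_seminorm_def
proof (rule Sup_least)
  fix r assume "r \<in> {ennreal (norm (mpartial (\<lambda>i. axis i 1) j v x)) | x j. x \<in> exhaust X m \<and> mlen j \<le> m}"
  then obtain x j where r: "r = ennreal (norm (word_partial (multi_word (\<lambda>i. axis i 1) j) v x))" "x \<in> exhaust X m" "mlen j \<le> m"
    by (auto simp: mpartial_eq_word_partial multi_word_def)
  have "length (multi_word (\<lambda>i. axis i (1::real)) j) = mlen j"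
    unfolding size_mset[symmetric] mset_multi_word by (simp add: mlen_def size_multiset_sum)
  moreover have "set (multi_word (\<lambda>i. axis i (1::real)) j) \<subseteq> Basis"
    by (auto simp: multi_word_def axis_in_Basis_iff)
  ultimately show "r \<le> B" using assms r by auto
qed

text \<open>
  With it a basic open set contains, around each of its points, a ball centred at that point.
\<close>

lemma smooth_seminorm_triangle:
  assumes "open X" "smooth_on X u" "smooth_on X v" "smooth_on X w"
  shows "smooth_seminorm X m (u - w) \<le> smooth_seminorm X m (u - v) + smooth_seminorm X m (v - w)"
  unfolding smooth_seminorm_def[of X m "u - w"]
proof (rule Sup_least)
  fix r assume "r \<in> {ennreal (norm (mpartial (\<lambda>i. axis i 1) j (u - w) x)) | x j. x \<in> exhaust X m \<and> mlen j \<le> m}"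
  then obtain x j where r: "r = ennreal (norm (mpartial (\<lambda>i. axis i 1) j (u - w) x))" "x \<in> exhaust X m" "mlen j \<le> m" by blast
  let ?D = "\<lambda>f. mpartial (\<lambda>i. axis i 1) j f x"
  have x: "x \<in> X" using r(2) compact_exhaust(2)[OF assms(1)] by blast
  have B: "set (multi_word (\<lambda>i. axis i (1::real)) j) \<subseteq> Basis"
    by (auto simp: multi_word_def axis_in_Basis_iff)
  have diff: "?D (f - g) = ?D f - ?D g" if "smooth_on X f" "smooth_on X g" for f g
    using word_partial_diff[OF assms(1) that B x]
    by (simp add: mpartial_eq_word_partial multi_word_def fun_diff_def)
  have up: "ennreal (norm (?D f)) \<le> smooth_seminorm X m f" for f
    unfolding smooth_seminorm_def by (rule Sup_upper) (use r in blast)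
  have "norm (?D (u - w)) \<le> norm (?D (u - v)) + norm (?D (v - w))"
    using norm_triangle_ineq[of "?D (u - v)" "?D (v - w)"] assms by (simp add: diff)
  then have "r \<le> ennreal (norm (?D (u - v))) + ennreal (norm (?D (v - w)))"
    unfolding r(1) by (simp add: ennreal_leI flip: ennreal_plus)
  also have "\<dots> \<le> smooth_seminorm X m (u - v) + smooth_seminorm X m (v - w)" by (intro add_mono up)
  finally show "r \<le> smooth_seminorm X m (u - v) + smooth_seminorm X m (v - w)" .
qed

lemma uniform_limit_of_joint_continuity:
  fixes F :: "real \<Rightarrow> 'a::metric_space \<Rightarrow> 'b::metric_space"
  assumes "compact K" "continuous_on (seq_params \<times> K) (\<lambda>(t, x). F t x)" "e > 0"
  shows "\<exists>r>0. \<forall>n. seq_param n < r \<longrightarrow> (\<forall>x\<in>K. dist (F (seq_param n) x) (F 0 x) < e)"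
proof -
  have "uniformly_continuous_on (seq_params \<times> K) (\<lambda>(t, x). F t x)"
    by (rule compact_uniformly_continuous[OF assms(2) compact_Times[OF compact_seq_params assms(1)]])
  then obtain r where r: "r > 0" "\<forall>p\<in>seq_params \<times> K. \<forall>q\<in>seq_params \<times> K. dist q p < r \<longrightarrow>
      dist (case q of (t, x) \<Rightarrow> F t x) (case p of (t, x) \<Rightarrow> F t x) < e"
    using assms(3) unfolding uniformly_continuous_on_def by blast
  have "dist (F (seq_param n) x) (F 0 x) < e" if "seq_param n < r" "x \<in> K" for n x
    using r(2)[THEN bspec, of "(0, x)", THEN bspec, of "(seq_param n, x)"] that seq_param_pos[of n]
    by (simp add: seq_params_def dist_Pair_Pair)
  then show ?thesis using r(1) by blast
qed

theorem corollary3p10: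
  fixes X :: "(real^'x::finite) set" and Y :: "(real^'y::finite) set"
    and \<alpha> d \<delta> \<rho> :: real
    and \<eta> :: "real^'k::finite \<Rightarrow> complex"
    and \<kappa> :: nat
    and \<psi> :: "real^'y \<Rightarrow> complex"
  assumes "open X" and "open Y"
    and "\<alpha> > 0" and "0 \<le> \<delta>" and "\<delta> < 1" and "0 < \<rho>" and "\<rho> \<le> 1"
    and "cutoff \<eta>"
    and "d - real \<kappa> * min \<rho> (1 - \<delta>) < - real CARD('k)"
    and "\<psi> \<in> test_functions Y"
  shows "continuous_map
           (pair_topology d \<alpha> \<rho> \<delta> X Y
              :: ((('x, 'y, 'k) pt \<Rightarrow> real) \<times> (('x, 'y, 'k) pt \<Rightarrow> complex)) topology)
           (smooth_topology X)
           (\<lambda>(\<Phi>, a). osc_integral \<eta> \<kappa> Y \<Phi> a \<psi>)"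
proof -
  let ?S = "phases \<alpha> X Y \<times> amplitudes d \<rho> \<delta> X Y
    :: ((('x, 'y, 'k) pt \<Rightarrow> real) \<times> (('x, 'y, 'k) pt \<Rightarrow> complex)) set"
  let ?p = "pair_seminorm d \<rho> \<delta> X Y
    :: nat \<Rightarrow> ((('x, 'y, 'k) pt \<Rightarrow> real) \<times> (('x, 'y, 'k) pt \<Rightarrow> complex)) \<Rightarrow> ennreal"
  let ?A = "\<lambda>(\<Phi> :: ('x, 'y, 'k) pt \<Rightarrow> real, a). osc_integral \<eta> \<kappa> Y \<Phi> a \<psi>"
  have family: "oscillatory_family seq_params X Y \<alpha> d \<delta> \<rho> \<eta> \<psi>
      (seq_family (fst g0) (\<lambda>n. fst (g n))) (seq_family (snd g0) (\<lambda>n. snd (g n)))"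
    if g0: "g0 \<in> ?S" and g: "\<And>n. g n \<in> ?S" and conv: "\<And>n. ?p (Suc n) (g n - g0) < ennreal (seq_param n)" for g0 g
  proof (rule sequence_oscillatory_family[OF assms(1,2)])
    fix n
    have "?p (Suc n) (g n - g0) = phase_seminorm X Y (Suc n) (fst (g n) - fst g0)
        + amplitude_seminorm d \<rho> \<delta> X Y (Suc n) (snd (g n) - snd g0)"
      by (simp add: pair_seminorm_def split_beta)
    with conv[of n] show "phase_seminorm X Y (Suc n) (fst (g n) - fst g0) < ennreal (seq_param n)"
      "amplitude_seminorm d \<rho> \<delta> X Y (Suc n) (snd (g n) - snd g0) < ennreal (seq_param n)"
      by (auto intro: le_less_trans[rotated])
  qed (use assms g0 g in \<open>auto simp: mem_Times_iff\<close>)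
  have zero: "?p m (g - g) = 0" for m g
    by (cases g) (simp add: pair_seminorm_def phase_seminorm_zero amplitude_seminorm_zero)
  have smooth: "smooth_on X (?A g)" if "g \<in> ?S" for g
  proof (rule smooth_on_words)
    interpret oscillatory_family seq_params X Y \<alpha> d \<delta> \<rho> \<eta> \<psi> "seq_family (fst g) (\<lambda>n. fst g)" "seq_family (snd g) (\<lambda>n. snd g)"
      using that seq_param_pos zero by (intro family) auto
    fix ws :: "(real^'x) list" and x assume "set ws \<subseteq> Basis" "x \<in> X"
    from osc_integral_word_partial_regular(1)[OF assms(9) this(1) _ this(2), of 0]
    show "word_partial ws (?A g) differentiable (at x)"
      by (simp add: seq_params_def split_beta)
  qed
  have key: "\<exists>m'\<ge>1. \<exists>e'>0. \<forall>g\<in>?S. ?p m' (g - g0) < ennreal e' \<longrightarrow> smooth_seminorm X m (?A g - ?A g0) \<le> ennreal e"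
    if g0: "g0 \<in> ?S" and e: "e > 0" for g0 m e
  proof (rule ccontr)
    assume "\<not> ?thesis"
    then have "\<exists>g\<in>?S. ?p (Suc n) (g - g0) < ennreal (seq_param n) \<and> \<not> smooth_seminorm X m (?A g - ?A g0) \<le> ennreal e" for n
      using seq_param_pos[of n] by (metis One_nat_def Suc_le_mono le0)
    then obtain g where g: "\<And>n. g n \<in> ?S" "\<And>n. ?p (Suc n) (g n - g0) < ennreal (seq_param n)"
      and far_off: "\<And>n. \<not> smooth_seminorm X m (?A (g n) - ?A g0) \<le> ennreal e" by metis
    let ?\<Phi> = "seq_family (fst g0) (\<lambda>n. fst (g n))" and ?a = "seq_family (snd g0) (\<lambda>n. snd (g n))"
    interpret oscillatory_family seq_params X Y \<alpha> d \<delta> \<rho> \<eta> \<psi> ?\<Phi> ?a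
      by (rule family[OF g0 g])
    let ?B = "\<lambda>t. osc_integral \<eta> \<kappa> Y (?\<Phi> t) (?a t) \<psi>"
    have B: "?B 0 = ?A g0" "?B (seq_param n) = ?A (g n)" for n by (simp_all add: split_beta)
    \<comment> \<open>Only finitely many derivatives enter the seminorm, so one \<open>n\<close> serves for all of them.\<close>
    let ?W = "{ws :: (real^'x) list. set ws \<subseteq> Basis \<and> length ws \<le> m}"
    have "\<forall>ws\<in>?W. \<exists>r>0. \<forall>n. seq_param n < r \<longrightarrow> (\<forall>x\<in>exhaust X m.
        norm (word_partial ws (?B (seq_param n)) x - word_partial ws (?B 0) x) < e)"
    proof
      fix ws :: "(real^'x) list" assume "ws \<in> ?W"
      then have "continuous_on (seq_params \<times> exhaust X m) (\<lambda>(t, x). word_partial ws (?B t) x)"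
        using osc_integral_word_partial_regular(2)[OF assms(9), of ws] compact_exhaust(2)[OF assms(1), of m]
        by (auto elim: continuous_on_subset)
      from uniform_limit_of_joint_continuity[OF compact_exhaust(1)[OF assms(1)] this e]
      show "\<exists>r>0. \<forall>n. seq_param n < r \<longrightarrow> (\<forall>x\<in>exhaust X m.
        norm (word_partial ws (?B (seq_param n)) x - word_partial ws (?B 0) x) < e)"
        unfolding dist_norm .
    qed
    from bchoice[OF this] obtain r where rW: "\<forall>ws\<in>?W. r ws > 0 \<and> (\<forall>n. seq_param n < r ws \<longrightarrow> (\<forall>x\<in>exhaust X m.
        norm (word_partial ws (?B (seq_param n)) x - word_partial ws (?B 0) x) < e))" ..
    have r: "r ws > 0"
      "seq_param n < r ws \<Longrightarrow> x \<in> exhaust X m \<Longrightarrow>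
        norm (word_partial ws (?B (seq_param n)) x - word_partial ws (?B 0) x) < e" if "ws \<in> ?W" for ws n x
      using bspec[OF rW that] by simp_all
    have fin: "finite ?W" by (rule finite_lists_length_le[OF finite_Basis])
    have "eventually (\<lambda>n. \<forall>ws\<in>?W. seq_param n < r ws) sequentially"
      using r(1) by (intro eventually_ball_finite[OF fin] ballI order_tendstoD(2)[OF seq_param_tendsto])
    then obtain n where n: "\<And>ws. ws \<in> ?W \<Longrightarrow> seq_param n < r ws"
      by (auto simp: eventually_sequentially)
    have "smooth_seminorm X m (?A (g n) - ?A g0) \<le> ennreal e"
    proof (rule smooth_seminorm_words)
      fix ws :: "(real^'x) list" and x assume ws: "set ws \<subseteq> Basis" "length ws \<le> m" and x: "x \<in> exhaust X m"
      have "x \<in> X" using x compact_exhaust(2)[OF assms(1)] by blast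
      then have "word_partial ws (?A (g n) - ?A g0) x = word_partial ws (?B (seq_param n)) x - word_partial ws (?B 0) x"
        unfolding B fun_diff_def using smooth[OF g0] smooth[OF g(1)] by (intro word_partial_diff[OF assms(1) _ _ ws(1)])
      then show "ennreal (norm (word_partial ws (?A (g n) - ?A g0) x)) \<le> ennreal e"
        using r(2)[OF _ n x, of ws] ws by (intro ennreal_leI) auto
    qed
    with far_off show False by blast
  qed
  let ?GS = "{{g \<in> ?S. ?p m (g - f) < ennreal \<epsilon>} | f m \<epsilon>. f \<in> ?S \<and> 1 \<le> m \<and> (0::real) < \<epsilon>}"
  let ?GT = "{{v \<in> smooth_functions X. smooth_seminorm X m (v - f) < ennreal \<epsilon>} | f m \<epsilon>. f \<in> smooth_functions X \<and> 1 \<le> m \<and> (0::real) < \<epsilon>}"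
  have top: "topspace (pair_topology d \<alpha> \<rho> \<delta> X Y :: ((('x, 'y, 'k) pt \<Rightarrow> real) \<times> (('x, 'y, 'k) pt \<Rightarrow> complex)) topology) \<subseteq> ?S"
    unfolding pair_topology_def seminorm_topology_def topology_generated_by_topspace by blast
  have nbhd: "openin (pair_topology d \<alpha> \<rho> \<delta> X Y) {g \<in> ?S. ?p m (g - f) < ennreal \<epsilon>}"
    if "f \<in> ?S" "1 \<le> m" "0 < \<epsilon>" for f m \<epsilon>
    unfolding pair_topology_def seminorm_topology_def
    by (rule topology_generated_by_Basis) (use that in blast)
  show ?thesis
    unfolding smooth_topology_def seminorm_topology_def
  proof (rule continuous_on_generated_topo)
    fix U assume "U \<in> ?GT"
    then obtain f m \<epsilon> where U: "U = {v \<in> smooth_functions X. smooth_seminorm X m (v - f) < ennreal \<epsilon>}"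
      "f \<in> smooth_functions X" "1 \<le> m" "0 < \<epsilon>" by blast
    show "openin (pair_topology d \<alpha> \<rho> \<delta> X Y) (?A -` U \<inter> topspace (pair_topology d \<alpha> \<rho> \<delta> X Y))"
    proof (subst openin_subopen, rule ballI)
      fix g0 assume g0: "g0 \<in> ?A -` U \<inter> topspace (pair_topology d \<alpha> \<rho> \<delta> X Y)"
      then have g0S: "g0 \<in> ?S" and lt: "smooth_seminorm X m (?A g0 - f) < ennreal \<epsilon>" using top U(1) by auto
      obtain c where c: "smooth_seminorm X m (?A g0 - f) = ennreal c" "0 \<le> c"
        using lt by (cases "smooth_seminorm X m (?A g0 - f)") auto
      then have c\<epsilon>: "c < \<epsilon>" using lt by (simp add: ennreal_less_iff)
      obtain m' e' where m': "m' \<ge> 1" "e' > 0"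
        "\<And>g. g \<in> ?S \<Longrightarrow> ?p m' (g - g0) < ennreal e' \<Longrightarrow> smooth_seminorm X m (?A g - ?A g0) \<le> ennreal ((\<epsilon> - c) / 2)"
        using key[OF g0S, of "(\<epsilon> - c) / 2" m] c\<epsilon> by (auto simp: Bex_def)
      let ?V = "{g \<in> ?S. ?p m' (g - g0) < ennreal e'}"
      have V: "openin (pair_topology d \<alpha> \<rho> \<delta> X Y) ?V" by (rule nbhd[OF g0S m'(1,2)])
      have "?A g \<in> U" if g: "g \<in> ?V" for g
      proof -
        have gS: "g \<in> ?S" using g by blast
        have "smooth_seminorm X m (?A g - f) \<le> smooth_seminorm X m (?A g - ?A g0) + smooth_seminorm X m (?A g0 - f)"
          using U(2) smooth[OF gS] smooth[OF g0S] by (intro smooth_seminorm_triangle assms(1)) (auto simp: smooth_functions_def)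
        also have "\<dots> \<le> ennreal ((\<epsilon> - c) / 2) + ennreal c"
          unfolding c(1) using m'(3)[of g] g by (intro add_mono) auto
        also have "\<dots> = ennreal ((\<epsilon> - c) / 2 + c)" using c\<epsilon> c(2) by (simp flip: ennreal_plus)
        also have "\<dots> < ennreal \<epsilon>" using c\<epsilon> c(2) by (intro ennreal_lessI) (auto simp: field_simps)
        finally show ?thesis using smooth[OF gS] by (simp add: U(1) smooth_functions_def)
      qed
      then have "?V \<subseteq> ?A -` U \<inter> topspace (pair_topology d \<alpha> \<rho> \<delta> X Y)"
        using openin_subset[OF V] by blast
      moreover have "g0 \<in> ?V" using g0S m'(2) zero by simp
      ultimately show "\<exists>V. openin (pair_topology d \<alpha> \<rho> \<delta> X Y) V \<and> g0 \<in> V \<and>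
          V \<subseteq> ?A -` U \<inter> topspace (pair_topology d \<alpha> \<rho> \<delta> X Y)" using V by blast
    qed
  next
    show "?A ` topspace (pair_topology d \<alpha> \<rho> \<delta> X Y) \<subseteq> \<Union> ?GT"
    proof
      fix v assume "v \<in> ?A ` topspace (pair_topology d \<alpha> \<rho> \<delta> X Y)"
      then have v: "v \<in> smooth_functions X" using top smooth by (auto simp: smooth_functions_def)
      have "smooth_seminorm X 1 (v - v) \<le> 0"
        by (rule smooth_seminorm_words) (simp add: fun_diff_def word_partial_zero)
      then have "v \<in> {w \<in> smooth_functions X. smooth_seminorm X 1 (w - v) < ennreal 1}" using v by simp
      moreover have "{w \<in> smooth_functions X. smooth_seminorm X 1 (w - v) < ennreal 1} \<in> ?GT"
        using v by (intro CollectI exI[of _ v] exI[of _ 1] exI[of _ "1 :: real"]) simp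
      ultimately show "v \<in> \<Union> ?GT" by (rule UnionI[rotated])
    qed
  qed
qed

end
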